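(* For all $z$ in the upper half plane, $$\Delta_{4,14,1}(z)=-\frac{\eta^6(z)\eta^6(14z)}{\eta^2(2z)\eta^2(7z)}+\frac{\eta^6(2z)\eta^6(7z)}{\eta^2(z)\eta^2(14z)}$$ and $$\Delta_{4,14,2}(z)=-4\,\eta^2(z)\eta^2(2z)\eta^2(7z)\eta^2(14z)+\frac{\eta^6(z)\eta^6(14z)}{\eta^2(2z)\eta^2(7z)}+\frac{\eta^6(2z)\eta^6(7z)}{\eta^2(z)\eta^2(14z)}.$$
   Context: Let $q=e^{2\pi i z}$ with $\mathrm{Im}(z)>0$ and let $\eta(z)=q^{1/24}\prod_{n\ge1}(1-q^n)$ be the Dedekind eta function. $S_4(\Gamma_0(14))$ is the space of cusp forms of weight $4$ and trivial character for $\Gamma_0(14)$. It contains exactly two normalized newforms (normalized Hecke eigenforms in the new subspace, with coefficient of $q$ equal to $1$): $\Delta_{4,14,1}(z)=\sum_{n\ge1}\tau_{4,14,1}(n)q^n$ is the one whose $q^2$-coefficient is $\tau_{4,14,1}(2)=2$, i.e. $\Delta_{4,14,1}=q+2q^2-2q^3+\cdots$, and $\Delta_{4,14,2}(z)=\sum_{n\ge1}\tau_{4,14,2}(n)q^n$ is the one whose $q^2$-coefficient is $\tau_{4,14,2}(2)=-2$, i.e. $\Delta_{4,14,2}=q-2q^2+8q^3+\cdots$. *)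

theory Defs
  imports "HOL-Complex_Analysis.Complex_Analysis"
begin

text \<open>
  Modular forms are represented by functions on all of \<^typ>\<open>complex\<close>; every condition below only
  involves their values on the upper half plane.
\<close>

definition upper_half_plane :: "complex set" where
  "upper_half_plane = {z. Im z > 0}"

definition nome :: "complex \<Rightarrow> complex" where
  "nome z = exp (2 * of_real pi * \<i> * z)"

definition dedekind_eta :: "complex \<Rightarrow> complex" where
  "dedekind_eta z = exp (2 * of_real pi * \<i> * z / 24) * (\<Prod>n. 1 - nome z ^ Suc n)"

definition has_q_expansion :: "(complex \<Rightarrow> complex) \<Rightarrow> (nat \<Rightarrow> complex) \<Rightarrow> bool" where
  "has_q_expansion f a \<longleftrightarrow> (\<forall>z\<in>upper_half_plane. (\<lambda>n. a n * nome z ^ n) sums f z)"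

definition SL2Z :: "(int^2^2) set" where
  "SL2Z = {A. det A = 1}"

definition Gamma0 :: "nat \<Rightarrow> (int^2^2) set" where
  "Gamma0 N = {A \<in> SL2Z. int N dvd A $ 2 $ 1}"

definition moebius_action :: "int^2^2 \<Rightarrow> complex \<Rightarrow> complex" where
  "moebius_action A z =
     (of_int (A $ 1 $ 1) * z + of_int (A $ 1 $ 2)) / (of_int (A $ 2 $ 1) * z + of_int (A $ 2 $ 2))"

definition slash :: "nat \<Rightarrow> int^2^2 \<Rightarrow> (complex \<Rightarrow> complex) \<Rightarrow> complex \<Rightarrow> complex" where
  "slash k A f z = f (moebius_action A z) / (of_int (A $ 2 $ 1) * z + of_int (A $ 2 $ 2)) ^ k"

text \<open>
  The last condition is vanishing at all cusps: every cusp is the image of \<open>\<infinity>\<close> under some element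
  of \<open>SL2Z\<close>, and the filter expresses convergence as \<open>Im z \<rightarrow> \<infinity>\<close>, uniformly in \<open>Re z\<close>.
\<close>
definition cusp_forms :: "nat \<Rightarrow> nat \<Rightarrow> (complex \<Rightarrow> complex) set" where
  "cusp_forms k N = {f.
     f holomorphic_on upper_half_plane \<and>
     (\<forall>A\<in>Gamma0 N. \<forall>z\<in>upper_half_plane. slash k A f z = f z) \<and>
     (\<forall>A\<in>SL2Z. (slash k A f \<longlongrightarrow> 0) (filtercomap Im at_top))}"

text \<open>
  The Hecke operator \<open>T\<^sub>n\<close> on forms for \<open>Gamma0 N\<close> with trivial character, with
  \<open>a = n div d\<close> restricted to be coprime to \<open>N\<close>; for a prime \<open>p\<close> dividing \<open>N\<close> it is \<open>U\<^sub>p\<close>.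
\<close>
definition hecke :: "nat \<Rightarrow> nat \<Rightarrow> nat \<Rightarrow> (complex \<Rightarrow> complex) \<Rightarrow> complex \<Rightarrow> complex" where
  "hecke k N n f z =
     of_nat n ^ (k - 1) *
     (\<Sum>d | d dvd n \<and> coprime (n div d) N. \<Sum>b<d.
        f ((of_nat (n div d) * z + of_nat b) / of_nat d) / of_nat d ^ k)"

definition hecke_eigenform :: "nat \<Rightarrow> nat \<Rightarrow> (complex \<Rightarrow> complex) \<Rightarrow> bool" where
  "hecke_eigenform k N f \<longleftrightarrow>
     f \<in> cusp_forms k N \<and> (\<exists>z\<in>upper_half_plane. f z \<noteq> 0) \<and>
     (\<forall>n\<ge>1. \<exists>c. \<forall>z\<in>upper_half_plane. hecke k N n f z = c * f z)"

definition fundamental_domain :: "complex set" where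
  "fundamental_domain = {z \<in> upper_half_plane. \<bar>Re z\<bar> \<le> 1 / 2 \<and> norm z \<ge> 1}"

definition right_cosets_Gamma0 :: "nat \<Rightarrow> (int^2^2) set set" where
  "right_cosets_Gamma0 N = (\<lambda>A. (\<lambda>B. B ** A) ` Gamma0 N) ` SL2Z"

text \<open>
  The Petersson product on \<open>Gamma0 N\<close>, not divided by the volume. Its fundamental domain is the union
  of the translates of the one for \<open>SL2Z\<close> by representatives of the right cosets; for forms on
  \<open>Gamma0 N\<close> the summands do not depend on the choice of representatives.
\<close>
definition petersson :: "nat \<Rightarrow> nat \<Rightarrow> (complex \<Rightarrow> complex) \<Rightarrow> (complex \<Rightarrow> complex) \<Rightarrow> complex" where
  "petersson k N f g =
     (\<Sum>C\<in>right_cosets_Gamma0 N.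
        (LINT z:fundamental_domain|lborel.
           slash k (SOME A. A \<in> C) f z * cnj (slash k (SOME A. A \<in> C) g z) *
           (of_real (Im z) ^ k / of_real (Im z) ^ 2)))"

inductive_set old_subspace :: "nat \<Rightarrow> nat \<Rightarrow> (complex \<Rightarrow> complex) set" for k N where
  zero: "(\<lambda>_. 0) \<in> old_subspace k N"
| lift: "g \<in> cusp_forms k M \<Longrightarrow> M dvd N \<Longrightarrow> M \<noteq> N \<Longrightarrow> d dvd N div M \<Longrightarrow>
           (\<lambda>z. g (of_nat d * z)) \<in> old_subspace k N"
| add: "f \<in> old_subspace k N \<Longrightarrow> g \<in> old_subspace k N \<Longrightarrow> (\<lambda>z. f z + g z) \<in> old_subspace k N"
| scale: "f \<in> old_subspace k N \<Longrightarrow> (\<lambda>z. c * f z) \<in> old_subspace k N"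

definition new_subspace :: "nat \<Rightarrow> nat \<Rightarrow> (complex \<Rightarrow> complex) set" where
  "new_subspace k N = {f \<in> cusp_forms k N. \<forall>g\<in>old_subspace k N. petersson k N f g = 0}"

definition newforms :: "nat \<Rightarrow> nat \<Rightarrow> (complex \<Rightarrow> complex) set" where
  "newforms k N = {f \<in> new_subspace k N. hecke_eigenform k N f \<and>
     (\<exists>a. has_q_expansion f a \<and> a 1 = 1)}"

end

theory Submission imports Defs begin

text \<open>
  Let \<open>f\<close> be one of the two newforms, with \<open>q\<^sup>2\<close>-coefficient \<open>2 s\<close>, \<open>s = 1\<close> or \<open>s = - 1\<close>,
  and let \<open>7 \<mu>\<close> be its eigenvalue under \<open>U\<^sub>7\<close>.

  The trace of \<open>f | W\<^sub>2\<close> to \<open>Gamma0 7\<close> is \<open>p = f | W\<^sub>2 + s f\<close>. It satisfies \<open>p | W\<^sub>2 = s p\<close>, which at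
  level 7 reads \<open>p(z) = 4 s p(2 z)\<close>; so \<open>p\<close> has all periods \<open>2 ^ (- n)\<close>, is constant, and vanishes.
  The trace of \<open>f | W\<^sub>7\<close> to \<open>Gamma0 2\<close> is \<open>P = f | W\<^sub>7 + \<mu> f\<close>, and it vanishes because
  \<open>P\<^sup>2 / (\<eta>(z) \<eta>(2 z)) ^ 8\<close> is an invariant holomorphic function tending to 0 at the cusp. So \<open>f\<^sup>2\<close>
  is invariant under all Atkin--Lehner involutions.

  The square of the eta quotient \<open>t\<close> claimed to be \<open>f\<close> has the same invariance, hence
  \<open>\<Phi> = (f\<^sup>2 - t\<^sup>2) / (\<eta>(z) \<eta>(2 z) \<eta>(7 z) \<eta>(14 z)) ^ 4\<close> is invariant too. The denominator vanishes
  nowhere and the expansions of \<open>f\<close> and \<open>t\<close> agree up to \<open>q\<^sup>2\<close>, so \<open>\<Phi>\<close> is bounded at the only cusp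
  and therefore constant. As \<open>f\<close> and \<open>t\<close> also agree at \<open>q\<^sup>4\<close>, comparing the coefficients of
  \<open>q\<^sup>4\<close> and \<open>q\<^sup>5\<close> shows that the constant is 0.

  The inversion formula for \<open>\<eta>\<close> comes from the theta function: \<open>\<theta>(v / \<tau>, - 1 / \<tau>) / \<theta>(v, \<tau>)\<close>, up to
  the exponential of a quadratic polynomial in \<open>v\<close>, is doubly periodic and entire, hence a constant.
  Its value at \<open>v = 0\<close> is a quotient of eta values, while the product of its values at the three half
  periods is explicit by Euler's identity.
\<close>

section \<open>Products of the form \<open>\<Prod>n. 1 - a * q ^ n\<close>\<close>

text \<open>The q-Pochhammer symbol (a; q) with infinitely many factors. Keeping \<open>a\<close>
  and \<open>q\<close> apart lets it serve both for eta, where a = q, and for theta, where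
  \<open>a\<close> varies.\<close>

definition qpoch :: "complex \<Rightarrow> complex \<Rightarrow> complex" where
  "qpoch a q = (\<Prod>n. 1 - a * q ^ n)"

lemma qpoch_convergent:
  fixes a q :: complex
  assumes "norm q < 1"
  shows "convergent_prod (\<lambda>n. 1 - a * q ^ n)"
proof (rule abs_convergent_prod_imp_convergent_prod)
  have "summable (\<lambda>n. norm a * norm q ^ n)"
    using assms by (intro summable_mult summable_geometric) auto
  then show "abs_convergent_prod (\<lambda>n. 1 - a * q ^ n)"
    unfolding abs_convergent_prod_conv_summable by (simp add: norm_mult norm_power)
qed

lemma qpoch_has_prod: "norm q < 1 \<Longrightarrow> (\<lambda>n. 1 - a * q ^ n) has_prod qpoch a q"
  unfolding qpoch_def by (rule convergent_prod_has_prod[OF qpoch_convergent])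

lemma qpoch_LIMSEQ: "norm q < 1 \<Longrightarrow> (\<lambda>N. \<Prod>n<N. 1 - a * q ^ n) \<longlonglongrightarrow> qpoch a q"
  by (intro has_prod_imp_tendsto' qpoch_has_prod)

lemma qpoch_eq_0_iff: "norm q < 1 \<Longrightarrow> qpoch a q = 0 \<longleftrightarrow> (\<exists>n. a * q ^ n = 1)"
  using has_prod_eq_0_iff[OF qpoch_has_prod] by (auto simp: image_iff)

lemma qpoch_rec:
  assumes "norm q < 1"
  shows "qpoch a q = (1 - a) * qpoch (a * q) q"
proof -
  have "(\<lambda>N. \<Prod>n<Suc N. 1 - a * q ^ n) \<longlonglongrightarrow> qpoch a q"
    using qpoch_LIMSEQ[OF assms] by (rule LIMSEQ_Suc)
  moreover have "(\<lambda>N. \<Prod>n<Suc N. 1 - a * q ^ n) \<longlonglongrightarrow> (1 - a) * qpoch (a * q) q"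
    unfolding prod.lessThan_Suc_shift
    using tendsto_mult[OF tendsto_const qpoch_LIMSEQ[OF assms, of "a * q"], of "1 - a"]
    by (simp add: mult.assoc)
  ultimately show ?thesis by (rule LIMSEQ_unique)
qed

text \<open>On a closed disc inside S both |a| and |q| attain their maxima, the latter below 1, so a
  geometric series dominates and the partial products converge uniformly.\<close>

lemma qpoch_holomorphic:
  assumes S: "open S" and a: "a holomorphic_on S" and q: "q holomorphic_on S"
    and lt: "\<And>z. z \<in> S \<Longrightarrow> norm (q z) < 1"
  shows "(\<lambda>z. qpoch (a z) (q z)) holomorphic_on S"
proof (rule holomorphic_uniform_sequence[OF S])
  show "(\<lambda>z. \<Prod>n<N. 1 - a z * q z ^ n) holomorphic_on S" for N
    by (intro holomorphic_intros a q)
  fix x assume "x \<in> S"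
  then obtain d where d: "d > 0" "cball x d \<subseteq> S"
    using S open_contains_cball by blast
  define K where "K = cball x d"
  have cont: "continuous_on K a" "continuous_on K q"
    using a q d holomorphic_on_imp_continuous_on holomorphic_on_subset unfolding K_def by blast+
  have K: "compact K" "K \<noteq> {}" using d by (auto simp: K_def)
  obtain xa where xa: "xa \<in> K" "\<And>z. z \<in> K \<Longrightarrow> norm (a z) \<le> norm (a xa)"
    using continuous_attains_sup[OF K, of "\<lambda>z. norm (a z)"] cont by (auto intro: continuous_intros)
  obtain xq where xq: "xq \<in> K" "\<And>z. z \<in> K \<Longrightarrow> norm (q z) \<le> norm (q xq)"
    using continuous_attains_sup[OF K, of "\<lambda>z. norm (q z)"] cont by (auto intro: continuous_intros)
  have r: "norm (q xq) < 1" using lt xq d by (auto simp: K_def)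
  have "uniformly_convergent_on K (\<lambda>N z. \<Sum>n<N. norm ((1 - a z * q z ^ n) - 1))"
  proof (rule Weierstrass_m_test')
    show "norm (norm (1 - a z * q z ^ n - 1)) \<le> norm (a xa) * norm (q xq) ^ n" if "z \<in> K" for n z
      using xa(2)[OF that] xq(2)[OF that] by (auto simp: norm_mult norm_power intro!: mult_mono power_mono)
    show "summable (\<lambda>n. norm (a xa) * norm (q xq) ^ n)"
      using r by (intro summable_mult summable_geometric) auto
  qed
  then have "uniformly_convergent_on K (\<lambda>N z. \<Prod>n<N. 1 - a z * q z ^ n)"
    by (intro uniformly_convergent_on_prod' K) (auto intro!: continuous_intros cont)
  then have ul: "uniform_limit K (\<lambda>N z. \<Prod>n<N. 1 - a z * q z ^ n) (\<lambda>z. lim (\<lambda>N. \<Prod>n<N. 1 - a z * q z ^ n)) sequentially"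
    by (simp add: uniformly_convergent_uniform_limit_iff)
  have "lim (\<lambda>N. \<Prod>n<N. 1 - a z * q z ^ n) = qpoch (a z) (q z)" if "z \<in> K" for z
    using that d(2) lt by (intro limI qpoch_LIMSEQ) (auto simp: K_def)
  then have "uniform_limit K (\<lambda>N z. \<Prod>n<N. 1 - a z * q z ^ n) (\<lambda>z. lim (\<lambda>N. \<Prod>n<N. 1 - a z * q z ^ n)) sequentially
      \<longleftrightarrow> uniform_limit K (\<lambda>N z. \<Prod>n<N. 1 - a z * q z ^ n) (\<lambda>z. qpoch (a z) (q z)) sequentially"
    by (intro uniform_limit_cong') auto
  then show "\<exists>d>0. cball x d \<subseteq> S \<and> uniform_limit (cball x d) (\<lambda>N z. \<Prod>n<N. 1 - a z * q z ^ n) (\<lambda>z. qpoch (a z) (q z)) sequentially"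
    using d ul by (auto simp: K_def)
qed

text \<open>Factorwise, (1 - x)(1 + x) = 1 - x^2 with x = a q^n.\<close>

lemma qpoch_mult_minus:
  assumes "norm q < 1"
  shows "qpoch a q * qpoch (- a) q = qpoch (a\<^sup>2) (q\<^sup>2)"
proof -
  have q2: "norm (q\<^sup>2) < 1" using assms by (simp add: norm_power power_less_one_iff)
  have "(\<lambda>N. (\<Prod>n<N. 1 - a * q ^ n) * (\<Prod>n<N. 1 - (- a) * q ^ n)) \<longlonglongrightarrow> qpoch a q * qpoch (- a) q"
    by (intro tendsto_mult qpoch_LIMSEQ assms)
  moreover have "(\<lambda>N. (\<Prod>n<N. 1 - a * q ^ n) * (\<Prod>n<N. 1 - (- a) * q ^ n)) = (\<lambda>N. \<Prod>n<N. 1 - a\<^sup>2 * (q\<^sup>2) ^ n)"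
    by (simp add: fun_eq_iff algebra_simps power2_eq_square power_mult_distrib flip: prod.distrib)
  ultimately show ?thesis using qpoch_LIMSEQ[OF q2, of "a\<^sup>2"] by (simp only: LIMSEQ_unique)
qed

lemma qpoch_even_odd:
  assumes "norm q < 1"
  shows "qpoch a q = qpoch a (q\<^sup>2) * qpoch (a * q) (q\<^sup>2)"
proof -
  have q2: "norm (q\<^sup>2) < 1" using assms by (simp add: norm_power power_less_one_iff)
  have "(\<Prod>n<2*N. 1 - a * q ^ n) = (\<Prod>n<N. 1 - a * (q\<^sup>2) ^ n) * (\<Prod>n<N. 1 - (a * q) * (q\<^sup>2) ^ n)" for N
  proof (induction N)
    case (Suc N)
    have e: "q ^ (2 * N) = (q\<^sup>2) ^ N" by (simp add: power_mult)
    have "(\<Prod>n<2 * Suc N. 1 - a * q ^ n) = (\<Prod>n<2*N. 1 - a * q ^ n) * (1 - a * q ^ (2*N)) * (1 - a * (q * q ^ (2*N)))"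
      by simp
    then show ?case unfolding Suc e by (simp only: prod.lessThan_Suc mult_ac)
  qed simp
  moreover have "(\<lambda>N. \<Prod>n<2*N. 1 - a * q ^ n) \<longlonglongrightarrow> qpoch a q"
    using LIMSEQ_subseq_LIMSEQ[OF qpoch_LIMSEQ[OF assms], of "\<lambda>N. 2 * N"] by (simp add: strict_mono_def o_def)
  moreover have "(\<lambda>N. (\<Prod>n<N. 1 - a * (q\<^sup>2) ^ n) * (\<Prod>n<N. 1 - (a * q) * (q\<^sup>2) ^ n)) \<longlonglongrightarrow> qpoch a (q\<^sup>2) * qpoch (a * q) (q\<^sup>2)"
    by (intro tendsto_mult qpoch_LIMSEQ q2)
  ultimately show ?thesis by (simp only: LIMSEQ_unique)
qed

text \<open>Euler's identity on partitions into distinct and into odd parts, with q = p^2: (-q; q)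
  is inverse to (q; q^2), and the latter splits as (p; q)(-p; q). Both
  \<open>qpoch_mult_minus\<close> and \<open>qpoch_even_odd\<close> express (q; q) through (q^2;
  q^2), which is then cancelled.\<close>

lemma qpoch_euler_identity:
  assumes "norm p < 1"
  shows "qpoch (- (p\<^sup>2)) (p\<^sup>2) * (qpoch p (p\<^sup>2) * qpoch (- p) (p\<^sup>2)) = 1"
proof -
  define q where "q = p\<^sup>2"
  have q: "norm q < 1" and q2: "norm (q\<^sup>2) < 1"
    using assms by (simp_all add: q_def norm_power power_less_one_iff)
  have e1: "qpoch q q * qpoch (- q) q = qpoch (q\<^sup>2) (q\<^sup>2)" by (rule qpoch_mult_minus[OF q])
  have e2: "qpoch q q = qpoch q (q\<^sup>2) * qpoch (q\<^sup>2) (q\<^sup>2)"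
    using qpoch_even_odd[OF q, of q] by (simp add: power2_eq_square)
  have e3: "qpoch p q * qpoch (- p) q = qpoch q (q\<^sup>2)"
    using qpoch_mult_minus[OF q, of p] by (simp add: q_def)
  have "norm (q\<^sup>2 * (q\<^sup>2) ^ n) < 1" for n
    using power_less_one_iff[of "norm (q\<^sup>2)" "Suc n"] q2 by (simp add: norm_mult norm_power)
  then have "q\<^sup>2 * (q\<^sup>2) ^ n \<noteq> 1" for n
    by (metis norm_one less_irrefl)
  then have nz: "qpoch (q\<^sup>2) (q\<^sup>2) \<noteq> 0"
    by (simp add: qpoch_eq_0_iff[OF q2])
  have "qpoch (q\<^sup>2) (q\<^sup>2) * (qpoch (- q) q * (qpoch p q * qpoch (- p) q)) = qpoch q q * qpoch (- q) q"
    unfolding e2 e3 by (simp only: mult_ac)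
  also have "\<dots> = qpoch (q\<^sup>2) (q\<^sup>2) * 1"
    by (simp only: e1 mult_1_right)
  finally show ?thesis
    using nz unfolding mult_cancel_left q_def[symmetric] by blast
qed

section \<open>A theta function\<close>

lemma nome_add: "nome (a + b) = nome a * nome b"
  by (simp add: nome_def exp_add distrib_left)

lemma nome_minus: "nome (- a) = inverse (nome a)"
  by (simp add: nome_def exp_minus)

lemma nome_diff: "nome (a - b) = nome a / nome b"
  by (simp add: nome_def exp_diff right_diff_distrib)

lemma nome_nonzero [simp]: "nome z \<noteq> 0"
  by (simp add: nome_def)

lemma nome_0 [simp]: "nome 0 = 1"
  by (simp add: nome_def)

lemma nome_power: "nome z ^ n = nome (of_nat n * z)"
  by (simp add: nome_def exp_of_nat_mult[symmetric] mult_ac)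

lemma nome_of_int [simp]: "nome (of_int n) = 1"
  using exp_integer_2pi[of "of_int n"] by (simp add: nome_def mult_ac)

lemma nome_1 [simp]: "nome 1 = 1"
  using nome_of_int[of 1] by simp

lemma nome_eq_1_iff: "nome z = 1 \<longleftrightarrow> z \<in> \<int>"
proof
  assume "nome z = 1"
  then obtain n :: int where "Im z = 0" "Re z = of_int n"
    unfolding nome_def exp_eq_1 by auto
  then have "z = of_int n" by (simp add: complex_eq_iff)
  then show "z \<in> \<int>" by simp
qed (auto elim: Ints_cases)

lemma nome_half [simp]: "nome (1 / 2) = - 1"
  using exp_pi_i by (simp add: nome_def)

lemma nome_minus_quarter: "nome (- 1 / 4) = - \<i>"
proof -
  have "nome (- 1 / 4) = cis (- (pi / 2))"
    by (simp add: nome_def cis_conv_exp)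
  then show ?thesis by (simp add: complex_eq_iff)
qed

lemma norm_nome: "norm (nome z) = exp (- (2 * pi * Im z))"
  by (simp add: nome_def)

lemma norm_nome_less_1 [simp]: "norm (nome z) < 1 \<longleftrightarrow> Im z > 0"
  by (simp add: norm_nome zero_less_mult_iff)

lemma nome_holomorphic [holomorphic_intros]:
  "f holomorphic_on A \<Longrightarrow> (\<lambda>z. nome (f z)) holomorphic_on A"
  unfolding nome_def by (intro holomorphic_intros)

lemma nome_tendsto [tendsto_intros]: "(f \<longlongrightarrow> a) F \<Longrightarrow> ((\<lambda>z. nome (f z)) \<longlongrightarrow> nome a) F"
  unfolding nome_def by (intro tendsto_intros)

text \<open>Jacobi's theta function in product form, without the factor (q; q) and without an
  exponential prefactor.\<close>

definition theta :: "complex \<Rightarrow> complex \<Rightarrow> complex" where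
  "theta \<tau> v = qpoch (nome v) (nome \<tau>) * qpoch (nome (\<tau> - v)) (nome \<tau>)"

text \<open>\<open>theta\<close> with the factor 1 - \<open>nome v\<close> removed. It does not
  vanish at v = 0, which makes the limit of a quotient of theta functions computable there.\<close>

definition theta_unit :: "complex \<Rightarrow> complex \<Rightarrow> complex" where
  "theta_unit \<tau> v = qpoch (nome (v + \<tau>)) (nome \<tau>) * qpoch (nome (\<tau> - v)) (nome \<tau>)"

context
  fixes \<tau> :: complex
  assumes \<tau>: "Im \<tau> > 0"
begin

lemma theta_eq_unit: "theta \<tau> v = (1 - nome v) * theta_unit \<tau> v"
  using qpoch_rec[of "nome \<tau>" "nome v"] \<tau> by (simp add: theta_def theta_unit_def nome_add)

lemma theta_plus_1: "theta \<tau> (v + 1) = theta \<tau> v"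
  by (simp add: theta_def nome_add nome_diff)

text \<open>With x = \<open>nome v\<close>, the shift removes the factor 1 - x from the first
  product and puts 1 - 1/x in front of the second; (1 - 1/x) / (1 - x) = - 1/x.\<close>

lemma theta_plus_tau: "theta \<tau> (v + \<tau>) = - nome (- v) * theta \<tau> v"
proof -
  have "theta \<tau> (v + \<tau>) = qpoch (nome (v + \<tau>)) (nome \<tau>) * qpoch (nome (- v)) (nome \<tau>)"
    by (simp add: theta_def)
  also have "qpoch (nome (- v)) (nome \<tau>) = (1 - nome (- v)) * qpoch (nome (\<tau> - v)) (nome \<tau>)"
    using qpoch_rec[of "nome \<tau>" "nome (- v)"] \<tau> by (simp add: nome_diff nome_minus field_simps)
  finally show ?thesis
    unfolding theta_eq_unit theta_unit_def by (simp add: nome_minus field_simps)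
qed

lemma theta_unit_holomorphic: "theta_unit \<tau> holomorphic_on UNIV"
  unfolding theta_unit_def using \<tau>
  by (intro holomorphic_intros qpoch_holomorphic) auto

lemma theta_holomorphic: "theta \<tau> holomorphic_on UNIV"
  unfolding theta_def using \<tau>
  by (intro holomorphic_intros qpoch_holomorphic) auto

lemma theta_unit_0: "theta_unit \<tau> 0 = (qpoch (nome \<tau>) (nome \<tau>))\<^sup>2"
  by (simp add: theta_unit_def power2_eq_square)

lemma qpoch_nome_nonzero: "qpoch (nome \<tau>) (nome \<tau>) \<noteq> 0"
proof -
  have "norm (nome \<tau> * nome \<tau> ^ n) < 1" for n
    using power_less_one_iff[of "norm (nome \<tau>)" "Suc n"] \<tau> by (simp add: norm_mult norm_power)
  then have "nome \<tau> * nome \<tau> ^ n \<noteq> 1" for n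
    by (metis norm_one less_irrefl)
  then show ?thesis using \<tau> by (simp add: qpoch_eq_0_iff)
qed

lemma theta_eq_0_imp:
  assumes "theta \<tau> v = 0"
  obtains m n :: int where "v = of_int m + of_int n * \<tau>"
proof -
  have "(\<exists>n. nome v * nome \<tau> ^ n = 1) \<or> (\<exists>n. nome (\<tau> - v) * nome \<tau> ^ n = 1)"
    using assms \<tau> by (simp add: theta_def qpoch_eq_0_iff)
  then obtain n where "v + of_nat n * \<tau> \<in> \<int> \<or> \<tau> - v + of_nat n * \<tau> \<in> \<int>"
    by (auto simp: nome_power nome_add[symmetric] nome_eq_1_iff)
  then show ?thesis
  proof
    assume "v + of_nat n * \<tau> \<in> \<int>"
    then obtain k where "v + of_nat n * \<tau> = of_int k" by (elim Ints_cases)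
    then have "v = of_int k + of_int (- int n) * \<tau>" by (simp add: algebra_simps)
    then show thesis by (rule that)
  next
    assume "\<tau> - v + of_nat n * \<tau> \<in> \<int>"
    then obtain k where "\<tau> - v + of_nat n * \<tau> = of_int k" by (elim Ints_cases)
    then have "v = of_int (- k) + of_int (1 + int n) * \<tau>" by (simp add: algebra_simps)
    then show thesis by (rule that)
  qed
qed

text \<open>At the half periods \<open>nome v\<close> is -1, p and -p with p^2 = q, so the values
  are 2 (-q; q)^2, (p; q)^2 and (-p; q)^2. Euler's identity evaluates their product.\<close>

lemma theta_half_periods: "theta \<tau> (1/2) * theta \<tau> (\<tau>/2) * theta \<tau> (1/2 + \<tau>/2) = 2"
proof -
  define p where "p = nome (\<tau> / 2)"
  have q: "nome \<tau> = p\<^sup>2" using nome_power[of "\<tau>/2" 2] by (simp add: p_def)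
  have p: "norm p < 1" using \<tau> by (simp add: p_def)
  have p0: "p \<noteq> 0" by (simp add: p_def)
  have q1: "norm (p\<^sup>2) < 1" using \<tau> q by (metis norm_nome_less_1)
  have "theta \<tau> (1/2) = 2 * (qpoch (- (p\<^sup>2)) (p\<^sup>2))\<^sup>2"
    unfolding theta_eq_unit theta_unit_def
    by (simp add: nome_add nome_diff q power2_eq_square)
  moreover have "theta \<tau> (\<tau>/2) = (qpoch p (p\<^sup>2))\<^sup>2"
    by (simp add: theta_def nome_diff q p_def[symmetric] power2_eq_square p0)
  moreover have "theta \<tau> (1/2 + \<tau>/2) = (qpoch (- p) (p\<^sup>2))\<^sup>2"
    by (simp add: theta_def nome_diff nome_add q p_def[symmetric] power2_eq_square p0)
  ultimately have "theta \<tau> (1/2) * theta \<tau> (\<tau>/2) * theta \<tau> (1/2 + \<tau>/2)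
      = 2 * (qpoch (- (p\<^sup>2)) (p\<^sup>2) * (qpoch p (p\<^sup>2) * qpoch (- p) (p\<^sup>2)))\<^sup>2"
    by (simp add: power_mult_distrib)
  then show ?thesis by (simp add: qpoch_euler_identity[OF p])
qed

end

lemma periodic_of_int:
  fixes f :: "complex \<Rightarrow> 'a"
  assumes "\<And>v. f (v + c) = f v"
  shows "f (v + of_int n * c) = f v"
proof (induction n arbitrary: v rule: int_induct[where k = 0])
  case (step1 i)
  show ?case using assms[of "v + of_int i * c"] step1 by (simp add: algebra_simps)
next
  case (step2 i)
  show ?case using assms[of "v + of_int (i - 1) * c"] step2 by (simp add: algebra_simps)
qed simp

text \<open>All values are taken on a compact period parallelogram, so h is bounded and Liouville's
  theorem applies.\<close>

lemma doubly_periodic_entire_constant: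
  assumes h: "h holomorphic_on UNIV" and \<tau>: "Im \<tau> > 0"
    and 1: "\<And>v. h (v + 1) = h v" and 2: "\<And>v. h (v + \<tau>) = h v"
  shows "h v = h 0"
proof -
  define par where "par = (\<lambda>(s, t). of_real s + of_real t * \<tau>) ` ({0..1} \<times> {0..1::real})"
  have "compact par"
    unfolding par_def
    by (intro compact_continuous_image compact_Times) (auto simp: case_prod_unfold intro!: continuous_intros)
  then have "compact (h ` par)"
    using h by (intro compact_continuous_image) (auto intro: holomorphic_on_imp_continuous_on holomorphic_on_subset)
  moreover have "range h \<subseteq> h ` par"
  proof clarify
    fix v
    define t where "t = Im v / Im \<tau>"
    define s where "s = Re v - t * Re \<tau>"
    have v: "v = of_real s + of_real t * \<tau>"
      using \<tau> by (simp add: complex_eq_iff s_def t_def)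
    have "h (of_real (frac s) + of_real (frac t) * \<tau>) = h v"
      using periodic_of_int[of h 1 "of_real (frac s) + of_real (frac t) * \<tau> + of_int \<lfloor>t\<rfloor> * \<tau>" "\<lfloor>s\<rfloor>", OF 1]
        periodic_of_int[of h \<tau> "of_real (frac s) + of_real (frac t) * \<tau>" "\<lfloor>t\<rfloor>", OF 2]
      by (simp add: v frac_def algebra_simps)
    moreover have "of_real (frac s) + of_real (frac t) * \<tau> \<in> par"
      unfolding par_def using frac_lt_1[of s] frac_lt_1[of t]
      by (intro image_eqI[of _ _ "(frac s, frac t)"]) (auto intro: less_imp_le)
    ultimately show "h v \<in> h ` par" by (metis imageI)
  qed
  ultimately have "bounded (range h)"
    using compact_imp_bounded bounded_subset by blast
  then obtain c where "\<And>x. h x = c"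
    using Liouville_theorem[OF h] unfolding constant_on_def by auto
  then show ?thesis by simp
qed

section \<open>The quotient of theta functions with periods -1/\<tau> and \<tau>\<close>

context
  fixes \<tau> :: complex
  assumes \<tau>: "Im \<tau> > 0"
begin

lemma Im_inverse_pos: "Im (- 1 / \<tau>) > 0"
  using \<tau> by (simp add: Im_divide sum_power2_gt_zero_iff)

lemma theta_shift_down:
  "theta \<tau> (w - \<tau>) = - nome (w - \<tau>) * theta \<tau> w"
  using theta_plus_tau[OF \<tau>, of "w - \<tau>"] by (simp add: nome_diff nome_minus)

text \<open>The quadratic exponent is chosen so that its changes under v + 1 and v + \<tau> cancel
  the multipliers of the numerator and of the denominator.\<close>

definition theta_quot :: "complex \<Rightarrow> complex" where
  "theta_quot v = theta (- 1 / \<tau>) (v / \<tau>) / theta \<tau> v * nome (- v\<^sup>2 / (2 * \<tau>) + (\<tau> - 1) * v / (2 * \<tau>))"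

text \<open>The limit of \<open>theta_quot\<close> at 0: the simple zeros of numerator and
  denominator contribute 1/\<tau>, the \<open>theta_unit\<close> factors contribute the
  square.\<close>

definition theta_const :: complex where
  "theta_const = (1 / \<tau>) * (qpoch (nome (- 1 / \<tau>)) (nome (- 1 / \<tau>)) / qpoch (nome \<tau>) (nome \<tau>))\<^sup>2"

lemma tau_nonzero: "\<tau> \<noteq> 0" using \<tau> by auto

text \<open>The denominator has period 1, but v/\<tau> moves by 1/\<tau>, the negative of the
  quasi-period of the numerator; for v + \<tau> the roles are exchanged.\<close>

lemma theta_quot_plus_1: "theta_quot (v + 1) = theta_quot v"
proof -
  have "theta (- 1 / \<tau>) ((v + 1) / \<tau>) = theta (- 1 / \<tau>) (v / \<tau> - (- 1 / \<tau>))"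
    by (simp add: add_divide_distrib)
  also have "\<dots> = - nome (v / \<tau> + 1 / \<tau>) * theta (- 1 / \<tau>) (v / \<tau>)"
    using theta_plus_tau[OF Im_inverse_pos, of "v / \<tau> - (- 1 / \<tau>)"] by (simp add: nome_minus nome_diff nome_add field_simps)
  finally have *: "theta (- 1 / \<tau>) ((v + 1) / \<tau>) = - nome (v / \<tau> + 1 / \<tau>) * theta (- 1 / \<tau>) (v / \<tau>)" .
  have "- (v + 1)\<^sup>2 / (2 * \<tau>) + (\<tau> - 1) * (v + 1) / (2 * \<tau>)
      = (- v\<^sup>2 / (2 * \<tau>) + (\<tau> - 1) * v / (2 * \<tau>)) + 1/2 - (v / \<tau> + 1 / \<tau>)"
    using tau_nonzero by (simp add: field_simps power2_eq_square)
  then have "nome (- (v + 1)\<^sup>2 / (2 * \<tau>) + (\<tau> - 1) * (v + 1) / (2 * \<tau>))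
      = - nome (- v\<^sup>2 / (2 * \<tau>) + (\<tau> - 1) * v / (2 * \<tau>)) / nome (v / \<tau> + 1 / \<tau>)"
    by (simp only: nome_diff nome_add[of _ "1/2"] nome_half) simp
  then show ?thesis
    unfolding theta_quot_def * theta_plus_1[OF \<tau>] by simp
qed

lemma theta_quot_plus_tau: "theta_quot (v + \<tau>) = theta_quot v"
proof -
  have *: "theta (- 1 / \<tau>) ((v + \<tau>) / \<tau>) = theta (- 1 / \<tau>) (v / \<tau>)"
    using theta_plus_1[OF Im_inverse_pos, of "v / \<tau>"] tau_nonzero by (simp add: add_divide_distrib)
  have "- (v + \<tau>)\<^sup>2 / (2 * \<tau>) + (\<tau> - 1) * (v + \<tau>) / (2 * \<tau>)
      = (- v\<^sup>2 / (2 * \<tau>) + (\<tau> - 1) * v / (2 * \<tau>)) + (- v) - 1/2"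
    using tau_nonzero by (simp add: field_simps power2_eq_square)
  then have "nome (- (v + \<tau>)\<^sup>2 / (2 * \<tau>) + (\<tau> - 1) * (v + \<tau>) / (2 * \<tau>))
      = - nome (- v\<^sup>2 / (2 * \<tau>) + (\<tau> - 1) * v / (2 * \<tau>)) * nome (- v)"
    by (simp only: nome_diff[of _ "1/2"] nome_add[of _ "- v"] nome_half) simp
  then show ?thesis
    unfolding theta_quot_def * theta_plus_tau[OF \<tau>] by simp
qed

lemma theta_quot_tendsto: "theta_quot \<midarrow>0\<rightarrow> theta_const"
proof -
  have "theta_unit (- 1 / \<tau>) \<midarrow>0\<rightarrow> theta_unit (- 1 / \<tau>) 0" "theta_unit \<tau> \<midarrow>0\<rightarrow> theta_unit \<tau> 0"
    using theta_unit_holomorphic[OF Im_inverse_pos] theta_unit_holomorphic[OF \<tau>]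
    by (metis UNIV_I at_within_open continuous_on_def holomorphic_on_imp_continuous_on open_UNIV)+
  note tu = this
  have "((\<lambda>v. v / \<tau>) \<longlongrightarrow> 0) (at 0)" by (auto intro!: tendsto_eq_intros simp: tau_nonzero)
  then have "filterlim (\<lambda>v. v / \<tau>) (at 0) (at 0)"
    unfolding filterlim_at using tau_nonzero by (auto simp: eventually_at_filter)
  then have 1: "((\<lambda>v. theta_unit (- 1 / \<tau>) (v / \<tau>)) \<longlongrightarrow> theta_unit (- 1 / \<tau>) 0) (at 0)"
    using tu(1) filterlim_compose by blast
  have d: "((\<lambda>v. 1 - nome (c * v)) has_field_derivative (- (2 * of_real pi * \<i> * c))) (at 0)" for c
    unfolding nome_def by (auto intro!: derivative_eq_intros)
  \<comment> \<open>Numerator and denominator both vanish at 0, so l'Hopital gives the quotient of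
    their derivatives.\<close>
  have "((\<lambda>v. (1 - nome (1 / \<tau> * v)) / (1 - nome (1 * v))) \<longlongrightarrow> - (2 * of_real pi * \<i> * (1 / \<tau>)) / - (2 * of_real pi * \<i> * 1)) (at 0)"
    by (rule lhopital_complex_simple[OF d d]) auto
  then have 2: "((\<lambda>v. (1 - nome (v / \<tau>)) / (1 - nome v)) \<longlongrightarrow> 1 / \<tau>) (at 0)" by simp
  have 3: "((\<lambda>v. nome (- v\<^sup>2 / (2 * \<tau>) + (\<tau> - 1) * v / (2 * \<tau>))) \<longlongrightarrow> 1) (at 0)"
    by (rule tendsto_eq_rhs, rule nome_tendsto, rule tendsto_intros) (auto intro!: tendsto_eq_intros simp: tau_nonzero)
  have nz: "theta_unit \<tau> 0 \<noteq> 0"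
    using qpoch_nome_nonzero[OF \<tau>] by (simp add: theta_unit_0[OF \<tau>])
  have "((\<lambda>v. (1 - nome (v / \<tau>)) / (1 - nome v) * (theta_unit (- 1 / \<tau>) (v / \<tau>) / theta_unit \<tau> v) *
      nome (- v\<^sup>2 / (2 * \<tau>) + (\<tau> - 1) * v / (2 * \<tau>))) \<longlongrightarrow>
      1 / \<tau> * (theta_unit (- 1 / \<tau>) 0 / theta_unit \<tau> 0) * 1) (at 0)"
    by (intro tendsto_mult tendsto_divide 1 2 3 tu(2) nz)
  moreover have "1 / \<tau> * (theta_unit (- 1 / \<tau>) 0 / theta_unit \<tau> 0) * 1 = theta_const"
    using theta_unit_0[OF \<tau>] theta_unit_0[OF Im_inverse_pos] by (simp add: theta_const_def power_divide)
  moreover have "theta_quot = (\<lambda>v. (1 - nome (v / \<tau>)) / (1 - nome v) * (theta_unit (- 1 / \<tau>) (v / \<tau>) / theta_unit \<tau> v) *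
      nome (- v\<^sup>2 / (2 * \<tau>) + (\<tau> - 1) * v / (2 * \<tau>)))"
    unfolding fun_eq_iff theta_quot_def theta_eq_unit[OF \<tau>] theta_eq_unit[OF Im_inverse_pos]
    by (intro allI) (simp only: times_divide_times_eq)
  ultimately show ?thesis by simp
qed

lemma theta_quot_const:
  assumes "theta \<tau> v \<noteq> 0"
  shows "theta_quot v = theta_const"
proof -
  \<comment> \<open>By the convention x / 0 = 0 the quotient is 0 at the zeros of
    \<open>theta\<close>; its continuous extension has to take the limit value there.\<close>
  define h where "h v = (if theta \<tau> v = 0 then theta_const else theta_quot v)" for v
  have p1: "h (v + 1) = h v" for v
    by (simp add: h_def theta_plus_1[OF \<tau>] theta_quot_plus_1)
  have p2: "h (v + \<tau>) = h v" for v
    by (simp add: h_def theta_plus_tau[OF \<tau>] theta_quot_plus_tau)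
  have op: "open {v. theta \<tau> v \<noteq> 0}"
  proof -
    have "open (theta \<tau> -` (- {0}))"
      using theta_holomorphic[OF \<tau>] by (intro open_vimage) (auto simp: holomorphic_on_imp_continuous_on)
    then show ?thesis by (simp add: vimage_def)
  qed
  have "theta_quot holomorphic_on {v. theta \<tau> v \<noteq> 0}"
  proof -
    have "theta \<tau> holomorphic_on {v. theta \<tau> v \<noteq> 0}"
      using theta_holomorphic[OF \<tau>] holomorphic_on_subset by blast
    moreover have "(\<lambda>v. theta (- 1 / \<tau>) (v / \<tau>)) holomorphic_on {v. theta \<tau> v \<noteq> 0}"
    proof -
      have "(\<lambda>v. v / \<tau>) holomorphic_on {v. theta \<tau> v \<noteq> 0}"
        by (intro holomorphic_intros) (simp add: tau_nonzero)
      from holomorphic_on_compose_gen[OF this theta_holomorphic[OF Im_inverse_pos]]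
      show ?thesis by (simp add: o_def)
    qed
    ultimately show ?thesis
      unfolding theta_quot_def by (intro holomorphic_intros) (auto simp: tau_nonzero)
  qed
  then have h1: "h holomorphic_on {v. theta \<tau> v \<noteq> 0}"
    by (rule holomorphic_transform) (simp add: h_def)
  have t0: "theta \<tau> 0 = 0" by (simp add: theta_eq_unit[OF \<tau>])
  have "eventually (\<lambda>v. theta \<tau> v \<noteq> 0) (at 0)"
  proof -
    have "eventually (\<lambda>v. theta_unit \<tau> v \<noteq> 0) (nhds 0)"
    proof -
      have "open (theta_unit \<tau> -` (- {0}))"
        using theta_unit_holomorphic[OF \<tau>] by (intro open_vimage) (auto simp: holomorphic_on_imp_continuous_on)
      moreover have "0 \<in> theta_unit \<tau> -` (- {0})"
        using qpoch_nome_nonzero[OF \<tau>] by (simp add: theta_unit_0[OF \<tau>])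
      ultimately show ?thesis unfolding eventually_nhds by blast
    qed
    moreover have "eventually (\<lambda>v::complex. v \<in> ball 0 1) (nhds 0)"
      by (rule eventually_nhds_in_open) auto
    ultimately have "eventually (\<lambda>v. v \<noteq> 0 \<longrightarrow> theta \<tau> v \<noteq> 0) (nhds 0)"
    proof eventually_elim
      case (elim v)
      have "nome v \<noteq> 1" if "v \<noteq> 0"
      proof
        assume "nome v = 1"
        then obtain k where "v = of_int k" by (auto simp: nome_eq_1_iff elim: Ints_cases)
        with elim that show False by simp
      qed
      with elim show ?case by (auto simp: theta_eq_unit[OF \<tau>])
    qed
    then show ?thesis by (simp add: eventually_at_filter)
  qed
  then obtain r where r: "r > 0" "\<And>v. v \<in> ball 0 r \<Longrightarrow> v \<noteq> 0 \<Longrightarrow> theta \<tau> v \<noteq> 0"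
    unfolding eventually_at by (auto simp: dist_commute)
  have h0: "h holomorphic_on ball 0 r"
  proof (rule no_isolated_singularity'[where K = "{0}"])
    show "h holomorphic_on ball 0 r - {0}"
      using h1 by (rule holomorphic_on_subset) (use r in auto)
    fix z :: complex assume "z \<in> {0}"
    have "theta_quot \<midarrow>0\<rightarrow> h 0" using theta_quot_tendsto t0 by (simp add: h_def)
    moreover have "eventually (\<lambda>v. theta_quot v = h v) (at 0)"
      using \<open>eventually (\<lambda>v. theta \<tau> v \<noteq> 0) (at 0)\<close> by eventually_elim (simp add: h_def)
    ultimately have "h \<midarrow>0\<rightarrow> h 0" by (rule Lim_transform_eventually)
    then show "(h \<longlongrightarrow> h z) (at z within ball 0 r)"
      using \<open>z \<in> {0}\<close> tendsto_within_subset[of h _ 0 UNIV "ball 0 r"] by simp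
  qed auto
  have "h field_differentiable at v" for v
  proof (cases "theta \<tau> v = 0")
    case False
    then have "v \<in> {v. theta \<tau> v \<noteq> 0}" by simp
    from at_within_open[OF this op] this show ?thesis
      using h1 unfolding holomorphic_on_def by metis
  next
    case True
    then obtain m n :: int where mn: "v = of_int m + of_int n * \<tau>" by (rule theta_eq_0_imp[OF \<tau>])
    \<comment> \<open>Every zero of \<open>theta\<close> is a lattice point, so double periodicity
      carries differentiability over from 0.\<close>
    have sh: "h w = h (w - v)" for w
      using periodic_of_int[of h 1 "w - v + of_int n * \<tau>" m, OF p1] periodic_of_int[of h \<tau> "w - v" n, OF p2]
      by (simp add: mn algebra_simps)
    have "h field_differentiable at 0"
      using h0 r(1) by (simp add: holomorphic_on_def at_within_open[of _ "ball 0 r"])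
    then have "(\<lambda>w. h (w - v)) field_differentiable at v"
      using field_differentiable_compose[of "\<lambda>w. w - v" v h]
      by (simp add: o_def field_differentiable_diff)
    moreover have "(\<lambda>w. h (w - v)) = h" using sh by (simp add: fun_eq_iff)
    ultimately show ?thesis by simp
  qed
  then have "h holomorphic_on UNIV" by (simp add: holomorphic_on_def)
  then have "h v = h 0" by (rule doubly_periodic_entire_constant[OF _ \<tau> p1 p2])
  then show ?thesis using assms t0 by (simp add: h_def)
qed

end

section \<open>The Dedekind eta function under inversion\<close>

lemma dedekind_eta_altdef: "dedekind_eta z = nome (z / 24) * qpoch (nome z) (nome z)"
  by (simp add: dedekind_eta_def qpoch_def nome_def)

lemma dedekind_eta_nonzero: "Im z > 0 \<Longrightarrow> dedekind_eta z \<noteq> 0"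
  using qpoch_nome_nonzero by (simp add: dedekind_eta_altdef)

lemma dedekind_eta_holomorphic: "dedekind_eta holomorphic_on {z. Im z > 0}"
proof -
  have "(\<lambda>z. nome (z / 24) * qpoch (nome z) (nome z)) holomorphic_on {z. Im z > 0}"
    by (intro holomorphic_intros qpoch_holomorphic open_halfspace_Im_gt) auto
  then show ?thesis by (simp add: dedekind_eta_altdef[abs_def])
qed

text \<open>The constant is the value of \<open>theta_quot\<close> at each half period, so its cube
  is the product of the three values. Both theta products in it equal 2, and only exponentials
  remain.\<close>

lemma theta_const_cubed:
  assumes \<tau>: "Im \<tau> > 0"
  shows "theta_const \<tau> ^ 3 = - nome (\<tau> / 4 - 1 / 4 + 1 / (4 * \<tau>))"
proof -
  define \<tau>' where "\<tau>' = - 1 / \<tau>"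
  have \<tau>': "Im \<tau>' > 0" unfolding \<tau>'_def by (rule Im_inverse_pos[OF \<tau>])
  have t0: "\<tau> \<noteq> 0" by (rule tau_nonzero[OF \<tau>])
  have nz: "theta \<tau> (1/2) \<noteq> 0" "theta \<tau> (\<tau>/2) \<noteq> 0" "theta \<tau> (1/2 + \<tau>/2) \<noteq> 0"
    using theta_half_periods[OF \<tau>] by auto
  define Q where "Q v = - v\<^sup>2 / (2 * \<tau>) + (\<tau> - 1) * v / (2 * \<tau>)" for v
  have q: "theta_quot \<tau> v = theta \<tau>' (v / \<tau>) / theta \<tau> v * nome (Q v)" for v
    by (simp add: theta_quot_def[OF \<tau>] \<tau>'_def Q_def)
  \<comment> \<open>(1/2)/\<tau> = \<tau>'/2 - \<tau>': up to lattice vectors the inversion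
    interchanges the half periods 1/2 and \<tau>/2 and keeps the third one.\<close>
  have n1: "theta \<tau>' ((1/2) / \<tau>) = - nome (- \<tau>' / 2) * theta \<tau>' (\<tau>' / 2)"
    using theta_shift_down[OF \<tau>', of "\<tau>' / 2"] by (simp add: \<tau>'_def mult.commute)
  have n2: "theta \<tau>' ((\<tau>/2) / \<tau>) = theta \<tau>' (1/2)"
    using t0 by simp
  have "(1/2 + \<tau>/2) / \<tau> = (1/2 + \<tau>'/2) - \<tau>'"
    using t0 by (simp add: \<tau>'_def field_simps)
  then have "theta \<tau>' ((1/2 + \<tau>/2) / \<tau>) = - nome ((1/2 + \<tau>'/2) - \<tau>') * theta \<tau>' (1/2 + \<tau>'/2)"
    using theta_shift_down[OF \<tau>', of "1/2 + \<tau>' / 2"] by simp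
  also have "(1/2 + \<tau>'/2) - \<tau>' = 1/2 + (- \<tau>'/2)" by simp
  finally have n3: "theta \<tau>' ((1/2 + \<tau>/2) / \<tau>) = nome (- \<tau>'/2) * theta \<tau>' (1/2 + \<tau>'/2)"
    by (simp only: nome_add nome_half) simp
  have "theta_const \<tau> ^ 3 = theta_quot \<tau> (1/2) * theta_quot \<tau> (\<tau>/2) * theta_quot \<tau> (1/2 + \<tau>/2)"
    using nz by (simp add: theta_quot_const[OF \<tau>] power3_eq_cube)
  also have "\<dots> = (theta \<tau>' ((1/2) / \<tau>) * theta \<tau>' ((\<tau>/2) / \<tau>) * theta \<tau>' ((1/2 + \<tau>/2) / \<tau>)) /
      (theta \<tau> (1/2) * theta \<tau> (\<tau>/2) * theta \<tau> (1/2 + \<tau>/2)) * (nome (Q (1/2)) * nome (Q (\<tau>/2)) * nome (Q (1/2 + \<tau>/2)))"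
    unfolding q by (simp only: divide_inverse inverse_mult_distrib mult_ac)
  also have "theta \<tau>' ((1/2) / \<tau>) * theta \<tau>' ((\<tau>/2) / \<tau>) * theta \<tau>' ((1/2 + \<tau>/2) / \<tau>) =
      - (nome (- \<tau>'/2) * nome (- \<tau>'/2)) * (theta \<tau>' (1/2) * theta \<tau>' (\<tau>'/2) * theta \<tau>' (1/2 + \<tau>'/2))"
    unfolding n1 n2 n3 by simp
  also have "\<dots> = - (nome (- \<tau>'/2) * nome (- \<tau>'/2)) * 2"
    by (simp only: theta_half_periods[OF \<tau>'])
  also have "- (nome (- \<tau>'/2) * nome (- \<tau>'/2)) * 2 / (theta \<tau> (1/2) * theta \<tau> (\<tau>/2) * theta \<tau> (1/2 + \<tau>/2)) *
      (nome (Q (1/2)) * nome (Q (\<tau>/2)) * nome (Q (1/2 + \<tau>/2))) =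
      - nome (- \<tau>'/2 + - \<tau>'/2 + (Q (1/2) + Q (\<tau>/2) + Q (1/2 + \<tau>/2)))"
    unfolding theta_half_periods[OF \<tau>] nome_add by simp
  also have "- \<tau>'/2 + - \<tau>'/2 + (Q (1/2) + Q (\<tau>/2) + Q (1/2 + \<tau>/2)) = \<tau> / 4 - 1 / 4 + 1 / (4 * \<tau>)"
    unfolding Q_def \<tau>'_def using t0 by (simp add: divide_simps power2_eq_square) algebra
  finally show ?thesis .
qed

text \<open>The cube of \<open>theta_const\<close> contains the sixth power of the quotient of Euler
  products. Its exponential and the prefactors \<open>nome (z / 4)\<close> of eta^6 leave only
  \<open>nome (- 1 / 4)\<close>, which is -i.\<close>

lemma dedekind_eta_S_pow6:
  assumes \<tau>: "Im \<tau> > 0"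
  shows "dedekind_eta (- 1 / \<tau>) ^ 6 = \<i> * \<tau> ^ 3 * dedekind_eta \<tau> ^ 6"
proof -
  define P where "P z = qpoch (nome z) (nome z)" for z
  have t0: "\<tau> \<noteq> 0" by (rule tau_nonzero[OF \<tau>])
  have P0: "P \<tau> \<noteq> 0" unfolding P_def by (rule qpoch_nome_nonzero[OF \<tau>])
  have eta: "dedekind_eta z ^ 6 = nome (z / 4) * P z ^ 6" for z
    by (simp add: dedekind_eta_altdef P_def power_mult_distrib nome_power)
  have "\<tau> ^ 3 * theta_const \<tau> ^ 3 * P \<tau> ^ 6 = P (- 1 / \<tau>) ^ 6"
    using t0 P0 by (simp add: theta_const_def[OF \<tau>] P_def power_divide power_mult_distrib power_mult[symmetric])
  then have "P (- 1 / \<tau>) ^ 6 = - (\<tau> ^ 3) * nome (\<tau> / 4 - 1 / 4 + 1 / (4 * \<tau>)) * P \<tau> ^ 6"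
    by (simp add: theta_const_cubed[OF \<tau>])
  then have "dedekind_eta (- 1 / \<tau>) ^ 6
      = - (\<tau> ^ 3) * (nome (- 1 / \<tau> / 4) * nome (\<tau> / 4 - 1 / 4 + 1 / (4 * \<tau>))) * P \<tau> ^ 6"
    by (simp add: eta)
  also have "nome (- 1 / \<tau> / 4) * nome (\<tau> / 4 - 1 / 4 + 1 / (4 * \<tau>)) = nome (- 1 / 4) * nome (\<tau> / 4)"
    unfolding nome_add[symmetric] by (rule arg_cong[of _ _ nome]) (use t0 in \<open>simp add: field_simps\<close>)
  finally show ?thesis unfolding eta nome_minus_quarter by simp
qed

text \<open>Squaring the formula for eta^6 shows that the cube of the quotient R is -1. So R is
  continuous with finite range on a connected set, hence constant, and the fixed point i of the
  inversion shows that the constant is -1.\<close>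

lemma dedekind_eta_S_pow4:
  assumes "Im z > 0"
  shows "dedekind_eta (- 1 / z) ^ 4 = - z\<^sup>2 * dedekind_eta z ^ 4"
proof -
  define S where "S = {z. Im z > 0}"
  define R where "R z = dedekind_eta (- 1 / z) ^ 4 / (z\<^sup>2 * dedekind_eta z ^ 4)" for z
  have S0: "z \<noteq> 0" "dedekind_eta z \<noteq> 0" "Im (- 1 / z) > 0" if "z \<in> S" for z
    using that dedekind_eta_nonzero Im_inverse_pos by (auto simp: S_def)
  have R3: "R z ^ 3 = -1" if "z \<in> S" for z
  proof -
    have "(dedekind_eta (- 1 / z) ^ 6)\<^sup>2 = - (z ^ 6) * (dedekind_eta z ^ 6)\<^sup>2"
      using dedekind_eta_S_pow6[of z] that by (simp add: S_def power_mult_distrib power_mult[symmetric])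
    then show ?thesis using S0[OF that]
      by (simp add: R_def power_divide power_mult_distrib power_mult[symmetric])
  qed
  have "R constant_on S"
  proof (rule continuous_finite_range_constant)
    show "connected S" unfolding S_def by (intro convex_connected convex_halfspace_Im_gt)
    have "dedekind_eta holomorphic_on S" using dedekind_eta_holomorphic by (simp add: S_def)
    moreover have "(\<lambda>z. dedekind_eta (- 1 / z)) holomorphic_on S"
    proof -
      have "(\<lambda>z. - 1 / z) holomorphic_on S" by (intro holomorphic_intros) (use S0 in auto)
      moreover have "(\<lambda>z. - 1 / z) ` S \<subseteq> S" using S0(3) by (auto simp: S_def)
      ultimately show ?thesis
        using holomorphic_on_compose_gen[OF _ \<open>dedekind_eta holomorphic_on S\<close>] unfolding o_def by blast
    qed
    ultimately have "R holomorphic_on S"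
      unfolding R_def by (intro holomorphic_intros) (use S0 in auto)
    then show "continuous_on S R" by (rule holomorphic_on_imp_continuous_on)
    have "finite {w::complex. w ^ 3 = - 1}" by (rule finite_nth_roots) simp
    then show "finite (R ` S)" by (rule finite_subset[rotated]) (use R3 in auto)
  qed
  then obtain c where c: "\<And>z. z \<in> S \<Longrightarrow> R z = c" unfolding constant_on_def by blast
  have "\<i> \<in> S" by (simp add: S_def)
  moreover have "R \<i> = -1" using S0(2)[OF \<open>\<i> \<in> S\<close>] by (simp add: R_def)
  ultimately have "R z = -1" using c assms by (auto simp: S_def)
  then show ?thesis using S0[of z] assms by (simp add: R_def S_def field_simps)
qed

lemma dedekind_eta_T_pow4: "dedekind_eta (z + 1) ^ 4 = nome (1 / 6) * dedekind_eta z ^ 4"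
proof -
  have "dedekind_eta z ^ 4 = nome (z / 6) * qpoch (nome z) (nome z) ^ 4" for z
    by (simp add: dedekind_eta_altdef power_mult_distrib nome_power)
  then show ?thesis by (simp add: nome_add add_divide_distrib)
qed

section \<open>Invariant holomorphic functions on the upper half plane\<close>

lemma filterlim_nome_at_0: "filterlim nome (at 0) (filtercomap Im at_top)"
proof -
  have "((\<lambda>y::real. exp (- (2 * pi * y))) \<longlongrightarrow> 0) at_top"
    by (rule filterlim_compose[OF exp_at_bot])
       (simp add: filterlim_uminus_at_bot filterlim_tendsto_pos_mult_at_top[OF tendsto_const _ filterlim_ident])
  from filterlim_compose[OF this filterlim_filtercomap]
  have "((\<lambda>z. norm (nome z)) \<longlongrightarrow> 0) (filtercomap Im at_top)"
    by (simp add: norm_nome)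
  then have "(nome \<longlongrightarrow> 0) (filtercomap Im at_top)"
    by (rule tendsto_norm_zero_cancel)
  then show ?thesis by (simp add: filterlim_at)
qed

lemma eventually_Im_greater: "eventually (\<lambda>z. Im z > B) (filtercomap Im at_top)"
  using eventually_gt_at_top by (rule eventually_filtercomapI)

lemma filtercomap_Im_neq_bot [simp]: "filtercomap Im at_top \<noteq> bot"
proof (rule filtercomap_neq_bot_surj)
  show "surj Im" by (metis surj_def complex.sel(2))
qed simp

lemma upper_half_plane_periodic_of_int:
  fixes f :: "complex \<Rightarrow> 'a"
  assumes "\<And>z. Im z > 0 \<Longrightarrow> f (z + 1) = f z" and z: "Im z > 0"
  shows "f (z + of_int n) = f z"
proof -
  \<comment> \<open>\<open>periodic_of_int\<close> asks for periodicity on the whole plane, so f is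
    extended by an arbitrary constant.\<close>
  define g where "g w = (if Im w > 0 then f w else undefined)" for w
  have "g (w + 1) = g w" for w using assms by (simp add: g_def)
  from periodic_of_int[of g 1 z n, OF this] show ?thesis using z by (simp add: g_def)
qed

text \<open>This replaces a fundamental domain. While Im z < \<delta>, \<open>step\<close> enlarges
  the height by the factor \<kappa>, so all values are taken on the part of a strip above \<delta>.
  There \<open>\<Phi> - C\<close> is small near the cusp, so unless it vanishes its modulus has a
  maximum on the half plane; it is then constant, and the limit at the cusp gives a
  contradiction.\<close>

lemma invariant_holomorphic_eq_limit:
  fixes \<Phi> :: "complex \<Rightarrow> complex"
  assumes hol: "\<Phi> holomorphic_on {z. Im z > 0}"
    and per: "\<And>z. Im z > 0 \<Longrightarrow> \<Phi> (z + 1) = \<Phi> z"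
    and lim: "(\<Phi> \<longlongrightarrow> C) (filtercomap Im at_top)"
    and \<delta>: "\<delta> > 0" and \<kappa>: "\<kappa> > 1"
    and step: "\<And>z. 0 < Im z \<Longrightarrow> Im z < \<delta> \<Longrightarrow> \<bar>Re z\<bar> \<le> 1/2 \<Longrightarrow> \<exists>z'. Im z' \<ge> \<kappa> * Im z \<and> \<Phi> z' = \<Phi> z"
    and z: "Im z > 0"
  shows "\<Phi> z = C"
proof -
  note per_int = upper_half_plane_periodic_of_int[of \<Phi>, OF per]
  have strip: "\<exists>z'. Im z' = Im z \<and> \<bar>Re z'\<bar> \<le> 1/2 \<and> \<Phi> z' = \<Phi> z" if "Im z > 0" for z
    using per_int[of z "- round (Re z)", OF _ that] of_int_round_abs_le[of "Re z"]
    by (intro exI[of _ "z + of_int (- round (Re z))"]) (simp add: abs_minus_commute)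
  \<comment> \<open>The exponent n bounds the number of steps needed to reach height
    \<delta>.\<close>
  have "\<exists>z'. Im z' \<ge> \<delta> \<and> \<Phi> z' = \<Phi> z" if "Im z > 0" "Im z * \<kappa> ^ n \<ge> \<delta>" for n z
    using that
  proof (induction n arbitrary: z)
    case (Suc n)
    show ?case
    proof (cases "Im z < \<delta>")
      case True
      obtain w where w: "Im w = Im z" "\<bar>Re w\<bar> \<le> 1/2" "\<Phi> w = \<Phi> z" using strip Suc.prems by blast
      with step[of w] True Suc.prems obtain z' where z': "Im z' \<ge> \<kappa> * Im z" "\<Phi> z' = \<Phi> z" by auto
      have "Im z' > 0" using z'(1) Suc.prems \<kappa> by (smt (verit) mult_pos_pos)
      moreover have "Im z * \<kappa> ^ Suc n \<le> Im z' * \<kappa> ^ n"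
        using mult_right_mono[OF z'(1), of "\<kappa> ^ n"] \<kappa> by (simp add: mult_ac)
      ultimately show ?thesis using Suc.IH[of z'] Suc.prems z' by auto
    qed (auto intro!: exI[of _ z])
  qed auto
  moreover have "\<exists>n. Im z * \<kappa> ^ n \<ge> \<delta>" if "Im z > 0" for z
  proof -
    obtain n where "\<delta> / Im z < \<kappa> ^ n" using real_arch_pow[OF \<kappa>] by blast
    then show ?thesis using that by (intro exI[of _ n]) (simp add: field_simps)
  qed
  ultimately have high: "\<exists>z'. Im z' \<ge> \<delta> \<and> \<bar>Re z'\<bar> \<le> 1/2 \<and> \<Phi> z' = \<Phi> z" if "Im z > 0" for z
    using strip that \<delta> by (metis less_le_trans)
  show ?thesis
  proof (rule ccontr)
    assume neq: "\<Phi> z \<noteq> C"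
    define \<Psi> where "\<Psi> z = \<Phi> z - C" for z
    have \<Psi>hol: "\<Psi> holomorphic_on {z. Im z > 0}"
      unfolding \<Psi>_def by (intro holomorphic_intros hol)
    have "(\<Psi> \<longlongrightarrow> 0) (filtercomap Im at_top)"
      unfolding \<Psi>_def using tendsto_diff[OF lim tendsto_const[of C]] by simp
    then have small: "eventually (\<lambda>w. norm (\<Psi> w) < e) (filtercomap Im at_top)" if "e > 0" for e
      using that by (simp add: tendsto_iff)
    have "norm (\<Psi> z) > 0" using neq by (simp add: \<Psi>_def)
    from small[OF this] obtain Y where Y: "\<And>w. Im w \<ge> Y \<Longrightarrow> norm (\<Psi> w) < norm (\<Psi> z)"
      unfolding eventually_filtercomap eventually_at_top_linorder by blast
    \<comment> \<open>Above height Y the modulus of \<open>\<Psi>\<close> is below its value at z,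
      so the maximum can be sought in this compact rectangle.\<close>
    define K where "K = {w. \<delta> \<le> Im w \<and> Im w \<le> Y \<and> \<bar>Re w\<bar> \<le> 1/2}"
    have K: "K = cbox (Complex (- 1/2) \<delta>) (Complex (1/2) Y)"
      by (auto simp: K_def in_cbox_complex_iff)
    obtain z0 where z0: "Im z0 \<ge> \<delta>" "\<bar>Re z0\<bar> \<le> 1/2" "\<Phi> z0 = \<Phi> z" using high[OF z] by blast
    have z0K: "z0 \<in> K" using z0 Y[of z0] by (force simp: K_def \<Psi>_def)
    have "continuous_on K (\<lambda>w. norm (\<Psi> w))"
      using \<Psi>hol \<delta> by (intro continuous_on_norm holomorphic_on_imp_continuous_on)
        (auto elim!: holomorphic_on_subset simp: K_def)
    then obtain z1 where z1: "z1 \<in> K" "\<And>w. w \<in> K \<Longrightarrow> norm (\<Psi> w) \<le> norm (\<Psi> z1)"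
      using continuous_attains_sup[of K "\<lambda>w. norm (\<Psi> w)"] z0K K by auto
    have max: "norm (\<Psi> w) \<le> norm (\<Psi> z1)" if "Im w > 0" for w
    proof -
      obtain w' where w': "Im w' \<ge> \<delta>" "\<bar>Re w'\<bar> \<le> 1/2" "\<Phi> w' = \<Phi> w" using high[OF \<open>Im w > 0\<close>] by blast
      show ?thesis
      proof (cases "w' \<in> K")
        case True
        then show ?thesis using z1(2)[of w'] w' by (simp add: \<Psi>_def)
      next
        case False
        then have "norm (\<Psi> w') < norm (\<Psi> z)" using w' by (intro Y) (auto simp: K_def)
        also have "norm (\<Psi> z) \<le> norm (\<Psi> z1)" using z1(2)[OF z0K] z0 by (simp add: \<Psi>_def)
        finally show ?thesis using w' by (simp add: \<Psi>_def)
      qed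
    qed
    have "\<Psi> constant_on {z. Im z > 0}"
    proof (rule maximum_modulus_principle[OF \<Psi>hol])
      show "connected {z. Im z > 0}" by (intro convex_connected convex_halfspace_Im_gt)
      show "z1 \<in> {z. Im z > 0}" using z1(1) \<delta> by (simp add: K_def)
    qed (use max in \<open>auto simp: open_halfspace_Im_gt\<close>)
    then obtain c where c: "\<And>w. Im w > 0 \<Longrightarrow> \<Psi> w = c" unfolding constant_on_def by auto
    have "norm (\<Psi> (Complex 0 (max 1 Y))) < norm (\<Psi> z)" by (intro Y) simp
    then show False using c[OF z] c[of "Complex 0 (max 1 Y)"] by simp
  qed
qed

text \<open>F is a function g of q = \<open>nome z\<close> on the punctured unit disc. The
  singularity at q = 0 is removable with value 0, so g(q)/q tends to g'(0).\<close>

lemma periodic_holomorphic_tendsto_0: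
  fixes F :: "complex \<Rightarrow> complex"
  assumes hol: "F holomorphic_on {z. Im z > 0}"
    and per: "\<And>z. Im z > 0 \<Longrightarrow> F (z + 1) = F z"
    and lim: "(F \<longlongrightarrow> 0) (filtercomap Im at_top)"
  shows "\<exists>L. ((\<lambda>z. F z / nome z) \<longlongrightarrow> L) (filtercomap Im at_top)"
proof -
  define l where "l q = Ln q / (2 * of_real pi * \<i>)" for q
  have nl: "nome (l q) = q" if "q \<noteq> 0" for q
    using that by (simp add: nome_def l_def)
  have Iml: "Im (l q) > 0 \<longleftrightarrow> norm q < 1" if "q \<noteq> 0" for q
    using norm_nome_less_1[of "l q"] nl[OF that] by simp
  note per_int = upper_half_plane_periodic_of_int[of F, OF per]
  have F_eq: "F z = F w" if "nome z = nome w" "Im z > 0" for z w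
  proof -
    have "nome (w - z) = 1" using that by (simp add: nome_diff)
    then obtain n where "w - z = of_int n" by (auto simp: nome_eq_1_iff elim: Ints_cases)
    then have "w = z + of_int n" by (simp add: algebra_simps)
    then show ?thesis using per_int that(2) by simp
  qed
  define g where "g q = (if q = 0 then 0 else F (l q))" for q
  have g_nome: "g (nome z) = F z" if "Im z > 0" for z
    using F_eq[of z "l (nome z)"] that nl by (simp add: g_def)
  have "g holomorphic_on ball 0 1"
  proof (rule no_isolated_singularity'[where K = "{0}"])
    show "g holomorphic_on ball 0 1 - {0}"
    proof (rule holomorphic_onI)
      fix q0 :: complex assume q0: "q0 \<in> ball 0 1 - {0}"
      \<comment> \<open>The principal logarithm jumps on the negative axis; since q / q0 is near 1
        for q near q0, this branch is differentiable at q0.\<close>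
      define L where "L q = l q0 + l (q / q0)" for q
      have nL: "nome (L q) = q" if "q \<noteq> 0" for q
        using that q0 nl[of q0] nl[of "q / q0"] by (simp add: L_def nome_add)
      have "L q0 = l q0" using q0 by (simp add: L_def l_def)
      have "L field_differentiable at q0"
        unfolding L_def l_def using q0
        by (intro derivative_intros field_differentiable_add field_differentiable_divide field_differentiable_const
            field_differentiable_ident field_differentiable_at_Ln[THEN field_differentiable_compose[unfolded o_def, rotated]]) auto
      moreover have "F field_differentiable at (L q0)"
        using hol Iml[of q0] q0 \<open>L q0 = l q0\<close> holomorphic_on_imp_differentiable_at[OF hol, of "L q0"]
        by (auto simp: open_halfspace_Im_gt)
      ultimately have "(\<lambda>q. F (L q)) field_differentiable at q0"
        using field_differentiable_compose[of L q0 F] by (simp add: o_def)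
      moreover have "eventually (\<lambda>q. F (L q) = g q) (nhds q0)"
      proof -
        have "eventually (\<lambda>q. q \<in> ball 0 1 - {0}) (nhds q0)"
          using q0 by (intro eventually_nhds_in_open) auto
        then show ?thesis
        proof eventually_elim
          case (elim q)
          then have "Im (L q) > 0" using norm_nome_less_1[of "L q"] nL[of q] by simp
          then show ?case using g_nome[of "L q"] nL[of q] elim by simp
        qed
      qed
      ultimately have "g field_differentiable at q0"
        unfolding field_differentiable_def using DERIV_cong_ev[of q0 q0 "\<lambda>q. F (L q)" g] by blast
      then show "g field_differentiable (at q0 within ball 0 1 - {0})"
        by (rule field_differentiable_at_within)
    qed
    fix q :: complex assume "q \<in> {0}"
    have "(g \<longlongrightarrow> 0) (at 0)"
    proof (rule tendstoI)
      fix e :: real assume "e > 0"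
      then have "eventually (\<lambda>z. dist (F z) 0 < e) (filtercomap Im at_top)" using lim by (simp add: tendsto_iff)
      then obtain Y where Y: "\<And>w. Im w \<ge> Y \<Longrightarrow> norm (F w) < e"
        unfolding eventually_filtercomap eventually_at_top_linorder by auto
      have "eventually (\<lambda>q::complex. q \<in> ball 0 (exp (- (2 * pi * Y)))) (nhds 0)"
        by (intro eventually_nhds_in_open) auto
      then have "eventually (\<lambda>q::complex. q \<in> ball 0 (exp (- (2 * pi * Y))) \<and> q \<noteq> 0) (at 0)"
        by (auto simp: eventually_at_filter elim: eventually_mono)
      then show "eventually (\<lambda>q. dist (g q) 0 < e) (at 0)"
      proof eventually_elim
        case (elim q)
        then have "norm (nome (l q)) < exp (- (2 * pi * Y))" using nl[of q] by simp
        then have "Im (l q) \<ge> Y" by (simp add: norm_nome)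
        then show ?case using Y[of "l q"] elim by (simp add: g_def)
      qed
    qed
    then have "(g \<longlongrightarrow> 0) (at 0 within ball 0 1)" by (rule tendsto_within_subset) simp
    then show "(g \<longlongrightarrow> g q) (at q within ball 0 1)"
      using \<open>q \<in> {0}\<close> by (simp add: g_def)
  qed auto
  then have "g field_differentiable at 0"
    using holomorphic_on_imp_differentiable_at[of g "ball 0 1" 0] by simp
  then obtain L where "(g has_field_derivative L) (at 0)" by (auto simp: field_differentiable_def)
  then have "((\<lambda>q. g q / q) \<longlongrightarrow> L) (at 0)" by (simp add: has_field_derivative_iff g_def)
  from filterlim_compose[OF this filterlim_nome_at_0]
  have "((\<lambda>z. g (nome z) / nome z) \<longlongrightarrow> L) (filtercomap Im at_top)" .
  moreover have "eventually (\<lambda>z. g (nome z) / nome z = F z / nome z) (filtercomap Im at_top)"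
    using eventually_Im_greater[of 0] by eventually_elim (simp add: g_nome)
  ultimately have "((\<lambda>z. F z / nome z) \<longlongrightarrow> L) (filtercomap Im at_top)"
    by (rule Lim_transform_eventually)
  then show ?thesis by blast
qed

section \<open>Expansions of the eta quotients\<close>

text \<open>Euler's function (q; q), that is eta without its factor q^(1/24).\<close>

definition euler :: "complex \<Rightarrow> complex" where
  "euler q = qpoch q q"

lemma euler_holomorphic: "euler holomorphic_on ball 0 1"
  unfolding euler_def by (intro qpoch_holomorphic holomorphic_intros) auto

lemma euler_nonzero:
  assumes "norm q < 1"
  shows "euler q \<noteq> 0"
proof -
  have "norm (q * q ^ n) < 1" for n
    using power_less_one_iff[of "norm q" "Suc n"] assms by (simp add: norm_mult norm_power)
  then have "q * q ^ n \<noteq> 1" for n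
    by (metis norm_one less_irrefl)
  then show ?thesis using assms by (simp add: euler_def qpoch_eq_0_iff)
qed

lemma euler_power_holomorphic: "k > 0 \<Longrightarrow> (\<lambda>q. euler (q ^ k)) holomorphic_on ball 0 1"
  unfolding euler_def by (intro qpoch_holomorphic holomorphic_intros) (auto simp: norm_power power_less_one_iff)

text \<open>The product differs from 1 by at most exp(S) - 1, where S sums the |a q^n| and is at
  most 2 |a| <= 1; then exp(S) <= 1 + S + S^2. It serves to show that a tail of Euler's product does
  not affect low coefficients.\<close>

lemma norm_qpoch_minus_1_le:
  assumes "norm q \<le> 1/2" "norm a \<le> 1/2"
  shows "norm (qpoch a q - 1) \<le> 4 * norm a"
proof -
  have le: "norm ((\<Prod>n<N. 1 - a * q ^ n) - 1) \<le> 4 * norm a" for N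
  proof -
    have "(\<Sum>n<N. norm q ^ n) \<le> (\<Sum>n. norm q ^ n)"
      using assms by (intro sum_le_suminf summable_geometric) auto
    also have "\<dots> = 1 / (1 - norm q)" using assms by (intro suminf_geometric) auto
    also have "\<dots> \<le> 2" using assms by (simp add: field_simps)
    finally have "norm a * (\<Sum>n<N. norm q ^ n) \<le> norm a * 2"
      by (rule mult_left_mono) simp
    then have s: "(\<Sum>n<N. norm (- (a * q ^ n))) \<le> 2 * norm a"
      by (simp add: norm_mult norm_power sum_distrib_left mult.commute)
    have "norm ((\<Prod>n<N. 1 + - (a * q ^ n)) - 1) \<le> (\<Prod>n<N. 1 + norm (- (a * q ^ n))) - 1"
      by (rule norm_prod_minus1_le_prod_minus1)
    also have "(\<Prod>n<N. 1 + norm (- (a * q ^ n))) \<le> exp (\<Sum>n<N. norm (- (a * q ^ n)))"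
      by (rule prod_le_exp_sum) simp
    also have "\<dots> \<le> exp (2 * norm a)" using s by simp
    also have "\<dots> \<le> 1 + 2 * norm a + (2 * norm a)\<^sup>2"
      using assms by (intro exp_bound) auto
    also have "(2 * norm a)\<^sup>2 \<le> 2 * norm a"
      using assms mult_left_le[of "2 * norm a" "2 * norm a"] by (simp add: power2_eq_square)
    finally show ?thesis by simp
  qed
  have "(\<lambda>N. norm ((\<Prod>n<N. 1 - a * q ^ n) - 1)) \<longlonglongrightarrow> norm (qpoch a q - 1)"
    using assms by (intro tendsto_intros qpoch_LIMSEQ) auto
  then show ?thesis by (rule Lim_bounded) (use le in auto)
qed

text \<open>Dividing by q^d, with d the order of the series, leaves the limit
  \<open>fps_nth f d\<close>, which is nonzero; if d < m, the bound forces this limit to be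
  0.\<close>

lemma fps_nth_eq_0_of_bound:
  fixes f :: "complex fps"
  assumes F: "F has_fps_expansion f" and bd: "eventually (\<lambda>q. norm (F q) \<le> M * norm q ^ m) (nhds 0)"
    and k: "k < m"
  shows "fps_nth f k = 0"
proof (rule ccontr)
  assume "fps_nth f k \<noteq> 0"
  then have nz: "f \<noteq> 0" and sd: "subdegree f \<le> k" by (auto intro: subdegree_leI)
  define d where "d = subdegree f"
  define G where "G x = (if x = 0 then fps_nth f d else F x / x ^ d)" for x
  have "G has_fps_expansion fps_shift d f"
    unfolding G_def by (rule has_fps_expansion_shift[OF F]) (auto simp: d_def)
  then have "isCont G 0" by (rule has_fps_expansion_imp_continuous)
  then have "G \<midarrow>0\<rightarrow> fps_nth f d" by (simp add: isCont_def G_def)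
  moreover have "G \<midarrow>0\<rightarrow> 0"
  proof (rule Lim_null_comparison)
    have "eventually (\<lambda>q. norm (F q) \<le> M * norm q ^ m) (at 0)"
      using bd by (simp add: eventually_at_filter eventually_mono)
    moreover have "eventually (\<lambda>q::complex. q \<noteq> 0) (at 0)" by (simp add: eventually_at_filter)
    ultimately show "eventually (\<lambda>q. norm (G q) \<le> M * norm q ^ (m - d)) (at 0)"
    proof eventually_elim
      case (elim q)
      have "norm q ^ m = norm q ^ (m - d) * norm q ^ d"
        using sd k by (simp add: d_def power_add[symmetric])
      with elim show ?case by (simp add: G_def norm_divide norm_power field_simps)
    qed
    show "(\<lambda>q::complex. M * norm q ^ (m - d)) \<midarrow>0\<rightarrow> 0"
      using sd k by (auto intro!: tendsto_eq_intros simp: d_def power_0_left)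
  qed
  ultimately have "fps_nth f d = 0" by (rule LIM_unique)
  with nz show False by (simp add: d_def)
qed

lemma fps_mult_nth_0_3:
  fixes a b :: "'a::comm_ring_1 fps"
  shows "fps_nth (a * b) 0 = fps_nth a 0 * fps_nth b 0"
    and "fps_nth (a * b) (Suc 0) = fps_nth a 0 * fps_nth b 1 + fps_nth a 1 * fps_nth b 0"
    and "fps_nth (a * b) 2 = fps_nth a 0 * fps_nth b 2 + fps_nth a 1 * fps_nth b 1 + fps_nth a 2 * fps_nth b 0"
    and "fps_nth (a * b) 3 = fps_nth a 0 * fps_nth b 3 + fps_nth a 1 * fps_nth b 2 + fps_nth a 2 * fps_nth b 1 + fps_nth a 3 * fps_nth b 0"
  by (simp_all add: fps_mult_nth eval_nat_numeral sum.atLeast0_atMost_Suc)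

lemma has_fps_expansion_eventually_eq:
  assumes "f has_fps_expansion F" "eventually (\<lambda>x. f x = g x) (nhds 0)"
  shows "g has_fps_expansion F"
  using assms(1) has_fps_expansion_cong[OF assms(2) refl] by simp

text \<open>The first three factors are split off; the remaining product (q^4; q) is 1 + O(q^4) and
  does not touch these coefficients.\<close>

lemma euler_has_fps_expansion:
  obtains e where "euler has_fps_expansion e" "fps_nth e 0 = 1" "fps_nth e 1 = -1" "fps_nth e 2 = -1" "fps_nth e 3 = 0"
proof -
  define R where "R q = qpoch (q ^ 4) q" for q
  have "R holomorphic_on ball 0 1"
    unfolding R_def by (intro qpoch_holomorphic holomorphic_intros) auto
  then have R: "R has_fps_expansion fps_expansion R 0"
    by (intro has_fps_expansion_fps_expansion[of "ball 0 1"]) auto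
  define r where "r = fps_expansion R 0"
  have "(\<lambda>q. R q - 1) has_fps_expansion r - 1"
    using R unfolding r_def by (intro fps_expansion_intros)
  moreover have "eventually (\<lambda>q. norm (R q - 1) \<le> 4 * norm q ^ 4) (nhds 0)"
  proof -
    have "eventually (\<lambda>q::complex. q \<in> ball 0 (1/2)) (nhds 0)"
      by (intro eventually_nhds_in_open) auto
    then show ?thesis
    proof eventually_elim
      case (elim q)
      then have "norm q ^ 4 \<le> norm q ^ 1" by (intro power_decreasing) auto
      with elim have "norm (q ^ 4) \<le> 1/2" by (simp add: norm_power)
      then show ?case using norm_qpoch_minus_1_le[of q "q ^ 4"] elim by (simp add: R_def norm_power)
    qed
  qed
  ultimately have "fps_nth (r - 1) k = 0" if "k < 4" for k
    using fps_nth_eq_0_of_bound that by blast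
  from this[of 0] this[of 1] this[of 2] this[of 3]
  have r: "fps_nth r 0 = 1" "fps_nth r (Suc 0) = 0" "fps_nth r 2 = 0" "fps_nth r 3 = 0"
    by simp_all
  have eq: "euler q = (1 - q) * ((1 - q ^ 2) * ((1 - q ^ 3) * R q))" if "norm q < 1" for q
    using that qpoch_rec[of q q] qpoch_rec[of q "q * q"] qpoch_rec[of q "q * q * q"]
    by (simp add: euler_def R_def eval_nat_numeral mult_ac)
  have "(\<lambda>q. (1 - q) * ((1 - q ^ 2) * ((1 - q ^ 3) * R q))) has_fps_expansion
      (1 - fps_X) * ((1 - fps_X ^ 2) * ((1 - fps_X ^ 3) * r))"
    using R unfolding r_def by (intro fps_expansion_intros)
  moreover have "eventually (\<lambda>q. (1 - q) * ((1 - q ^ 2) * ((1 - q ^ 3) * R q)) = euler q) (nhds 0)"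
  proof -
    have "eventually (\<lambda>q::complex. q \<in> ball 0 1) (nhds 0)"
      by (intro eventually_nhds_in_open) auto
    then show ?thesis by eventually_elim (simp add: eq)
  qed
  ultimately have "euler has_fps_expansion (1 - fps_X) * ((1 - fps_X ^ 2) * ((1 - fps_X ^ 3) * r))"
    by (rule has_fps_expansion_eventually_eq)
  then show ?thesis
    by (rule that) (simp_all add: fps_mult_nth_0_3 r fps_X_power_nth)
qed

lemma euler_power_has_fps_expansion:
  assumes "euler has_fps_expansion e" "k > 0"
  shows "(\<lambda>q. euler (q ^ k)) has_fps_expansion fps_compose e (fps_X ^ k)"
proof -
  have "(\<lambda>q::complex. q ^ k) has_fps_expansion fps_X ^ k" by (intro fps_expansion_intros)
  from has_fps_expansion_compose[OF assms(1) this] assms(2) show ?thesis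
    by (simp add: o_def)
qed

lemma fps_compose_X_power_nth_0_3:
  fixes e :: "complex fps"
  shows "k > 0 \<Longrightarrow> fps_nth (fps_compose e (fps_X ^ k)) 0 = fps_nth e 0"
    and "fps_nth (fps_compose e (fps_X ^ 2)) (Suc 0) = 0"
    and "fps_nth (fps_compose e (fps_X ^ 2)) 2 = fps_nth e 1"
    and "fps_nth (fps_compose e (fps_X ^ 2)) 3 = 0"
    and "k \<ge> 4 \<Longrightarrow> fps_nth (fps_compose e (fps_X ^ k)) (Suc 0) = 0"
    and "k \<ge> 4 \<Longrightarrow> fps_nth (fps_compose e (fps_X ^ k)) 2 = 0"
    and "k \<ge> 4 \<Longrightarrow> fps_nth (fps_compose e (fps_X ^ k)) 3 = 0"
  unfolding fps_compose_nth power_mult[symmetric] fps_X_power_nth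
  by (simp_all add: eval_nat_numeral sum.atLeast0_atMost_Suc)

text \<open>As 1 + 2 + 7 + 14 = 24, the product eta(z) eta(2z) eta(7z) eta(14z) is q times this
  function of q.\<close>

definition euler_prod :: "complex \<Rightarrow> complex" where
  "euler_prod q = euler q * euler (q ^ 2) * (euler (q ^ 7) * euler (q ^ 14))"

text \<open>The eta quotient t claimed to be the newform, divided by q and put over the common
  denominator \<open>euler_prod q ^ 2\<close>. The values s = 1 and s = -1 give the two forms; the
  factor 2 - 2 s is 0 or 4.\<close>

definition form_quot :: "complex \<Rightarrow> complex \<Rightarrow> complex" where
  "form_quot s q = ((euler (q ^ 2) * euler (q ^ 7)) ^ 8 - s * q ^ 2 * (euler q * euler (q ^ 14)) ^ 8
     - (2 - 2 * s) * q * euler_prod q ^ 4) / euler_prod q ^ 2"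

lemma euler_prod_holomorphic: "euler_prod holomorphic_on ball 0 1"
  unfolding euler_prod_def by (intro holomorphic_intros euler_power_holomorphic euler_holomorphic) auto

lemma euler_prod_nonzero: "norm q < 1 \<Longrightarrow> euler_prod q \<noteq> 0"
  by (simp add: euler_prod_def euler_nonzero norm_power power_less_one_iff)

lemma form_quot_holomorphic: "form_quot s holomorphic_on ball 0 1"
  unfolding form_quot_def
  by (intro holomorphic_intros euler_power_holomorphic euler_holomorphic euler_prod_holomorphic)
     (auto simp: euler_prod_nonzero)

lemma euler_prod_form_quot_expansions:
  assumes s: "s = 1 \<or> s = -1"
  obtains p \<tau> where "euler_prod has_fps_expansion p" "form_quot s has_fps_expansion \<tau>"
    "fps_nth (p ^ 4) 0 = 1" "fps_nth (p ^ 4) 1 = -4"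
    "fps_nth \<tau> 0 = 1" "fps_nth \<tau> 1 = 2 * s" "fps_nth \<tau> 3 = 4"
proof -
  obtain e where e: "euler has_fps_expansion e" "fps_nth e 0 = 1" "fps_nth e (Suc 0) = -1" "fps_nth e 2 = -1" "fps_nth e 3 = 0"
    using euler_has_fps_expansion by (metis One_nat_def)
  define e' where "e' k = fps_compose e (fps_X ^ k)" for k
  have e': "(\<lambda>q. euler (q ^ k)) has_fps_expansion e' k" if "k > 0" for k
    unfolding e'_def by (rule euler_power_has_fps_expansion[OF e(1) that])
  have e'_nth: "fps_nth (e' 2) 0 = 1" "fps_nth (e' 2) (Suc 0) = 0" "fps_nth (e' 2) 2 = -1" "fps_nth (e' 2) 3 = 0"
    "fps_nth (e' 7) 0 = 1" "fps_nth (e' 7) (Suc 0) = 0" "fps_nth (e' 7) 2 = 0" "fps_nth (e' 7) 3 = 0"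
    "fps_nth (e' 14) 0 = 1" "fps_nth (e' 14) (Suc 0) = 0" "fps_nth (e' 14) 2 = 0" "fps_nth (e' 14) 3 = 0"
    using e by (simp_all add: e'_def fps_compose_X_power_nth_0_3)
  define p where "p = e * e' 2 * (e' 7 * e' 14)"
  have p: "euler_prod has_fps_expansion p"
    unfolding euler_prod_def p_def by (intro fps_expansion_intros e e') auto
  have p_nth: "fps_nth p 0 = 1" "fps_nth p (Suc 0) = -1" "fps_nth p 2 = -2" "fps_nth p 3 = 1"
    by (simp_all add: p_def fps_mult_nth_0_3 e e'_nth)
  define d where "d = p * p"
  have d_nth: "fps_nth d 0 = 1" "fps_nth d (Suc 0) = -2" "fps_nth d 2 = -3" "fps_nth d 3 = 6"
    by (simp_all add: d_def fps_mult_nth_0_3 p_nth)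
  have p4: "p ^ 4 = d * d" by (simp add: d_def eval_nat_numeral mult_ac)
  have dd_nth: "fps_nth (d * d) 0 = 1" "fps_nth (d * d) (Suc 0) = -4" "fps_nth (d * d) 2 = -2"
    by (simp_all add: fps_mult_nth_0_3 d_nth)
  define v where "v = e' 2 * e' 7"
  have v_nth: "fps_nth v 0 = 1" "fps_nth v (Suc 0) = 0" "fps_nth v 2 = -1" "fps_nth v 3 = 0"
    by (simp_all add: v_def fps_mult_nth_0_3 e e'_nth)
  define v2 where "v2 = v * v"
  have v2_nth: "fps_nth v2 0 = 1" "fps_nth v2 (Suc 0) = 0" "fps_nth v2 2 = -2" "fps_nth v2 3 = 0"
    by (simp_all add: v2_def fps_mult_nth_0_3 v_nth)
  define v4 where "v4 = v2 * v2"
  have v4_nth: "fps_nth v4 0 = 1" "fps_nth v4 (Suc 0) = 0" "fps_nth v4 2 = -4" "fps_nth v4 3 = 0"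
    by (simp_all add: v4_def fps_mult_nth_0_3 v2_nth)
  have v8: "v ^ 8 = v4 * v4" by (simp add: v4_def v2_def eval_nat_numeral mult_ac)
  have v8_nth: "fps_nth (v4 * v4) 0 = 1" "fps_nth (v4 * v4) (Suc 0) = 0" "fps_nth (v4 * v4) 2 = -8" "fps_nth (v4 * v4) 3 = 0"
    by (simp_all add: fps_mult_nth_0_3 v4_nth)
  define x where "x = e * e' 14"
  have x_nth: "fps_nth x 0 = 1" "fps_nth x (Suc 0) = -1"
    by (simp_all add: x_def fps_mult_nth_0_3 e e'_nth)
  define x2 where "x2 = x * x"
  have x2_nth: "fps_nth x2 0 = 1" "fps_nth x2 (Suc 0) = -2"
    by (simp_all add: x2_def fps_mult_nth_0_3 x_nth)
  define x4 where "x4 = x2 * x2"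
  have x4_nth: "fps_nth x4 0 = 1" "fps_nth x4 (Suc 0) = -4"
    by (simp_all add: x4_def fps_mult_nth_0_3 x2_nth)
  have x8: "x ^ 8 = x4 * x4" by (simp add: x4_def x2_def eval_nat_numeral mult_ac)
  have x8_nth: "fps_nth (x4 * x4) 0 = 1" "fps_nth (x4 * x4) (Suc 0) = -8"
    by (simp_all add: fps_mult_nth_0_3 x4_nth)
  define n where "n = v4 * v4 - fps_const s * fps_X ^ 2 * (x4 * x4) - fps_const (2 - 2 * s) * fps_X * (d * d)"
  have n_nth: "fps_nth n 0 = 1" "fps_nth n (Suc 0) = - (2 - 2 * s)" "fps_nth n 2 = - 8 - s + 4 * (2 - 2 * s)"
      "fps_nth n 3 = 8 * s + 2 * (2 - 2 * s)"
    unfolding n_def mult.assoc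
    by (simp_all add: fps_X_power_mult_nth v8_nth x8_nth dd_nth v4_nth x4_nth d_nth numeral_3_eq_3[symmetric])
  have N: "(\<lambda>q. (euler (q ^ 2) * euler (q ^ 7)) ^ 8 - s * q ^ 2 * (euler q * euler (q ^ 14)) ^ 8
     - (2 - 2 * s) * q * euler_prod q ^ 4) has_fps_expansion n"
    unfolding n_def v8[symmetric] x8[symmetric] p4[symmetric] v_def x_def
    by (intro fps_expansion_intros e e' p) auto
  define \<tau> where "\<tau> = fps_expansion (form_quot s) 0"
  have \<tau>: "form_quot s has_fps_expansion \<tau>"
    unfolding \<tau>_def using form_quot_holomorphic by (intro has_fps_expansion_fps_expansion[of "ball 0 1"]) auto
  have "(\<lambda>q. form_quot s q * (euler_prod q * euler_prod q)) has_fps_expansion \<tau> * d"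
    unfolding d_def by (intro fps_expansion_intros \<tau> p)
  moreover have "eventually (\<lambda>q. form_quot s q * (euler_prod q * euler_prod q) =
      (euler (q ^ 2) * euler (q ^ 7)) ^ 8 - s * q ^ 2 * (euler q * euler (q ^ 14)) ^ 8
     - (2 - 2 * s) * q * euler_prod q ^ 4) (nhds 0)"
  proof -
    have "eventually (\<lambda>q::complex. q \<in> ball 0 1) (nhds 0)"
      by (intro eventually_nhds_in_open) auto
    then show ?thesis
      by eventually_elim (simp add: form_quot_def euler_prod_nonzero power2_eq_square)
  qed
  ultimately have "(\<lambda>q. (euler (q ^ 2) * euler (q ^ 7)) ^ 8 - s * q ^ 2 * (euler q * euler (q ^ 14)) ^ 8
     - (2 - 2 * s) * q * euler_prod q ^ 4) has_fps_expansion \<tau> * d"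
    by (rule has_fps_expansion_eventually_eq)
  \<comment> \<open>The constant term of d is 1, so comparing coefficients in n = \<tau> d
    determines those of \<tau> one after the other.\<close>
  with N have nd: "n = \<tau> * d" by (rule fps_expansion_unique_complex)
  have t0: "fps_nth \<tau> 0 = 1"
    using n_nth(1) unfolding nd fps_mult_nth_0_3 d_nth by simp
  have t1: "fps_nth \<tau> 1 = 2 * s"
    using n_nth(2) unfolding nd fps_mult_nth_0_3 d_nth t0 by (simp add: d_nth algebra_simps)
  have t2: "fps_nth \<tau> 2 = 3 - 5 * s"
    using n_nth(3) unfolding nd fps_mult_nth_0_3 d_nth t0 t1 by (simp add: d_nth algebra_simps)
  have t3: "fps_nth \<tau> 3 = 4"
    using n_nth(4) s unfolding nd fps_mult_nth_0_3 d_nth t0 t1 t2 by (auto simp: d_nth algebra_simps)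
  show ?thesis
    by (rule that[OF p \<tau>]) (simp_all add: p4 d_nth t0 t1[simplified] t3)
qed

section \<open>The Atkin--Lehner involution at 2\<close>

lemma linear_nonzero:
  assumes "Im z > 0" "Re c \<noteq> 0" "Im c = 0" "Im d = 0"
  shows "c * z + d \<noteq> 0" "c * z - d \<noteq> 0"
  using assms by (auto simp: complex_eq_iff)

lemma Im_moebius_pos:
  fixes a b c d :: real
  assumes z: "Im z > 0" and det: "a * d - b * c > 0"
  shows "Im ((of_real a * z + of_real b) / (of_real c * z + of_real d)) > 0"
proof -
  have nz: "of_real c * z + of_real d \<noteq> (0::complex)"
  proof
    assume "of_real c * z + of_real d = (0::complex)"
    then have "c * Im z = 0" "c * Re z + d = 0" by (simp_all add: complex_eq_iff)
    with z have "c = 0" "d = 0" by auto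
    with det show False by simp
  qed
  have "Im ((of_real a * z + of_real b) / (of_real c * z + of_real d))
      = (a * d - b * c) * Im z / (norm (of_real c * z + of_real d :: complex))\<^sup>2"
    by (simp add: Im_divide cmod_power2 algebra_simps)
  then show ?thesis using z det nz by simp
qed

lemma divide_divide_cancel:
  fixes k :: "'a::field"
  assumes "k \<noteq> 0"
  shows "(x / k) / (y / k) = x / y"
  using assms by simp

lemma slash_cancel_1:
  fixes k :: "'a::field_char_0"
  assumes "D \<noteq> 0"
  shows "4 * (D ^ 4 * F) / (2 * D / k) ^ 4 = k ^ 4 * F / 4"
  using assms by (simp add: power_divide power_mult_distrib)

lemma slash_cancel_2:
  fixes k :: "'a::field_char_0"
  shows "(2 * D / k) ^ 4 * F / 4 = D ^ 4 * (4 * F / k ^ 4)"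
  by (simp add: power_divide power_mult_distrib)

lemma Im_inverse_power2 [simp]: "Im (1 / 2 ^ n) = 0"
proof -
  have "(1 / 2 ^ n :: complex) = of_real (1 / 2 ^ n)" by simp
  then show ?thesis by (simp only: Im_complex_of_real)
qed

text \<open>The eigenvalues of \<open>f\<close> under \<open>U\<^sub>2\<close> and \<open>U\<^sub>7\<close> are \<open>2 s\<close> and \<open>7 \<mu>\<close>.\<close>
locale level14_form =
  fixes f :: "complex \<Rightarrow> complex" and s \<mu> :: complex
  assumes hol: "f holomorphic_on {z. Im z > 0}"
    and modular: "\<And>(a::int) b c d z. a * d - b * c = 1 \<Longrightarrow> 14 dvd c \<Longrightarrow> Im z > 0 \<Longrightarrow>
      f ((of_int a * z + of_int b) / (of_int c * z + of_int d)) = (of_int c * z + of_int d) ^ 4 * f z"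
    and cusp: "\<And>(a::int) b c d. a * d - b * c = 1 \<Longrightarrow>
      ((\<lambda>z. f ((of_int a * z + of_int b) / (of_int c * z + of_int d)) / (of_int c * z + of_int d) ^ 4) \<longlongrightarrow> 0) (filtercomap Im at_top)"
    and U2: "\<And>z. Im z > 0 \<Longrightarrow> f (z / 2) + f ((z + 1) / 2) = 4 * s * f z"
    and s: "s = 1 \<or> s = -1"
    and U7: "\<And>z. Im z > 0 \<Longrightarrow> (\<Sum>b<7. f ((z + of_nat b) / 7)) = 49 * \<mu> * f z"
begin

text \<open>The matrices (-4, 1; 14, -4) and (7, -4; 14, -7) of determinants 2 and 7 represent the
  Atkin-Lehner involutions. The second has trace 0, so W7 is an involution already on
  points.\<close>

definition W2 :: "complex \<Rightarrow> complex" where "W2 z = (-4 * z + 1) / (14 * z - 4)"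
definition W7 :: "complex \<Rightarrow> complex" where "W7 z = (7 * z - 4) / (14 * z - 7)"

lemma W2_pos: "Im z > 0 \<Longrightarrow> Im (W2 z) > 0"
  using Im_moebius_pos[of z "-4" "-4" 1 14] by (simp add: W2_def)

lemma W7_pos: "Im z > 0 \<Longrightarrow> Im (W7 z) > 0"
  using Im_moebius_pos[of z 7 "-7" "-4" 14] by (simp add: W7_def)

lemma f_plus_1: "Im z > 0 \<Longrightarrow> f (z + 1) = f z"
  using modular[of 1 1 1 0 z] by simp

text \<open>f slashed with W2; the factor 4 is det^(k/2) for determinant 2 and weight k = 4.\<close>

definition G where "G z = 4 * f (W2 z) / (14 * z - 4) ^ 4"
definition p where "p z = G z + s * f z"

text \<open>The relation U2 turns s f into f slashed with (1, 0; 0, 2) and (1, 1; 0, 2). Together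
  with G these are the three coset terms of a trace from level 14 to level 7.\<close>

lemma p_altdef: "Im z > 0 \<Longrightarrow> p z = G z + f (z / 2) / 4 + f ((z + 1) / 2) / 4"
  using U2[of z] by (simp add: p_def field_simps)

text \<open>
  The matrix \<open>(-2, 1; 7, -4)\<close> of \<open>Gamma0 7\<close> permutes the three summands of \<open>p\<close>, each of which is \<open>f\<close>
  slashed with a matrix of determinant 2; it is chosen because its product with \<open>(2, 0; 0, 1)\<close>
  is the matrix of \<open>W2\<close>.
\<close>
lemma G_slash:
  assumes z: "Im z > 0"
  shows "G ((-2 * z + 1) / (7 * z - 4)) = (7 * z - 4) ^ 4 * (f (z / 2) / 4)"
proof -
  have nz: "7 * z - 4 \<noteq> 0" "-56 * (z/2) + 15 \<noteq> 0" "-28 * z + 15 \<noteq> 0"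
    using linear_nonzero[OF z, of 7 4] linear_nonzero[OF z, of "-56/2" 15] linear_nonzero[OF z, of "-28" 15] by simp_all
  have e: "14 * ((-2 * z + 1) / (7 * z - 4)) - 4 = 2 * (-28 * z + 15) / (7 * z - 4)"
    using nz by (simp add: field_simps)
  \<comment> \<open>In matrices: W2 (-2, 1; 7, -4) = (15, -4; -56, 15) (1, 0; 0, 2).\<close>
  have "W2 ((-2 * z + 1) / (7 * z - 4)) = (15 * (z/2) + -4) / (-56 * (z/2) + 15)"
    unfolding W2_def e using nz by (simp add: divide_simps)
  also have "f \<dots> = (-56 * (z/2) + 15) ^ 4 * f (z / 2)"
    using modular[of 15 15 "-4" "-56" "z/2"] z by simp
  finally have fW: "f (W2 ((-2 * z + 1) / (7 * z - 4))) = (-28 * z + 15) ^ 4 * f (z / 2)" by simp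
  show ?thesis unfolding G_def e fW slash_cancel_1[OF nz(3)] by simp
qed

lemma f_half_slash:
  assumes z: "Im z > 0"
  shows "f ((-2 * z + 1) / (7 * z - 4) / 2) / 4 = (7 * z - 4) ^ 4 * G z"
proof -
  define w where "w = W2 z"
  have w: "Im w > 0" using W2_pos[OF z] by (simp add: w_def)
  have nz: "7 * z - 4 \<noteq> 0" "14 * z - 4 \<noteq> 0" "28 * w + 9 \<noteq> 0"
    using linear_nonzero[OF z, of 7 4] linear_nonzero[OF z, of 14 4] linear_nonzero[OF w, of 28 9] by simp_all
  have e: "28 * w + 9 = 2 * (7 * z - 4) / (14 * z - 4)"
    unfolding w_def W2_def using nz by (simp add: field_simps)
  have n: "-3 * w + -1 = (-2 * z + 1) / (14 * z - 4)"
    unfolding w_def W2_def using nz by (simp add: field_simps)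
  \<comment> \<open>In matrices: (1, 0; 0, 2) (-2, 1; 7, -4) = (-3, -1; 28, 9) W2.\<close>
  have "(-2 * z + 1) / (7 * z - 4) / 2 = (-3 * w + -1) / (28 * w + 9)"
    unfolding e n divide_divide_cancel[OF nz(2)] by (simp add: mult.commute)
  also have "f \<dots> = (28 * w + 9) ^ 4 * f w"
    using modular[of "-3" 9 "-1" 28 w] w by simp
  finally have fw: "f ((-2 * z + 1) / (7 * z - 4) / 2) = (28 * w + 9) ^ 4 * f w" .
  show ?thesis unfolding fw e slash_cancel_2 by (simp only: G_def w_def)
qed

lemma f_half_shift_slash:
  assumes z: "Im z > 0"
  shows "f (((-2 * z + 1) / (7 * z - 4) + 1) / 2) / 4 = (7 * z - 4) ^ 4 * (f ((z + 1) / 2) / 4)"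
proof -
  define w where "w = (z + 1) / 2"
  have w: "Im w > 0" using z by (simp add: w_def)
  have nz: "7 * z - 4 \<noteq> 0" using linear_nonzero[OF z, of 7 4] by simp
  have e: "14 * w + -11 = 7 * z - 4" by (simp add: w_def field_simps)
  have n: "5 * w + -4 = (5 * z - 3) / 2" by (simp add: w_def field_simps)
  \<comment> \<open>In matrices: (1, 1; 0, 2) (-2, 1; 7, -4) = (5, -4; 14, -11) (1, 1; 0,
    2).\<close>
  have "((-2 * z + 1) / (7 * z - 4) + 1) / 2 = (5 * w + -4) / (14 * w + -11)"
    unfolding e n using nz by (simp add: field_simps)
  also have "f \<dots> = (14 * w + -11) ^ 4 * f w"
    using modular[of 5 "-11" "-4" 14 w] w by simp
  finally show ?thesis unfolding e unfolding w_def by simp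
qed

lemma p_slash:
  assumes z: "Im z > 0"
  shows "p ((-2 * z + 1) / (7 * z - 4)) = (7 * z - 4) ^ 4 * p z"
proof -
  have "Im ((-2 * z + 1) / (7 * z - 4)) > 0"
    using Im_moebius_pos[OF z, of "-2" "-4" 1 7] by simp
  from p_altdef[OF this] show ?thesis
    unfolding G_slash[OF z] f_half_slash[OF z] f_half_shift_slash[OF z] p_altdef[OF z]
    by (simp add: algebra_simps)
qed

text \<open>The square of the matrix of W2 is 2 (15, -4; -56, 15), a scalar multiple of an element
  of Gamma0 14, so slashing twice with W2 returns f.\<close>

lemma G_W2:
  assumes z: "Im z > 0"
  shows "G (W2 z) = (14 * z - 4) ^ 4 * f z / 4"
proof -
  have nz: "14 * z - 4 \<noteq> 0" "-56 * z + 15 \<noteq> 0"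
    using linear_nonzero[OF z, of 14 4] linear_nonzero[OF z, of "-56" 15] by simp_all
  have e: "14 * W2 z - 4 = 2 * (-56 * z + 15) / (14 * z - 4)"
    unfolding W2_def using nz by (simp add: field_simps)
  have n: "-4 * W2 z + 1 = 2 * (15 * z + -4) / (14 * z - 4)"
    unfolding W2_def using nz by (simp add: field_simps)
  have "W2 (W2 z) = (15 * z + -4) / (-56 * z + 15)"
    unfolding W2_def[of "W2 z"] e n divide_divide_cancel[OF nz(1)]
    by (rule mult_divide_mult_cancel_left) simp
  also have "f \<dots> = (-56 * z + 15) ^ 4 * f z"
    using modular[of 15 15 "-4" "-56" z] z by simp
  finally show ?thesis unfolding G_def e using slash_cancel_1[OF nz(2)] by simp
qed

text \<open>W2 interchanges f and G, so p is an eigenfunction with eigenvalue s because s^2 = 1. On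
  the other hand W2 = (-2, 1; 7, -4) (2, 0; 0, 1), and p absorbs the first factor by
  \<open>p_slash\<close>.\<close>

lemma p_double:
  assumes z: "Im z > 0"
  shows "p z = 4 * s * p (2 * z)"
proof -
  have nz: "14 * z - 4 \<noteq> 0" using linear_nonzero[OF z, of 14 4] by simp
  have "f (W2 z) = (14 * z - 4) ^ 4 * G z / 4" unfolding G_def using nz by simp
  then have e1: "p (W2 z) = s * (14 * z - 4) ^ 4 * p z / 4"
    unfolding p_def G_W2[OF z] using s by (auto simp: field_simps)
  have e2: "p (W2 z) = (14 * z - 4) ^ 4 * p (2 * z)"
    using p_slash[of "2 * z"] z by (simp add: W2_def)
  have "(14 * z - 4) ^ 4 * (s * p z) = 4 * (s * (14 * z - 4) ^ 4 * p z / 4)" by (simp only: mult_ac) simp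
  also have "\<dots> = (14 * z - 4) ^ 4 * (4 * p (2 * z))" unfolding e1[symmetric] e2 by (simp only: mult_ac)
  finally have "s * p z = 4 * p (2 * z)" using nz unfolding mult_cancel_left by simp
  then have "s * s * p z = 4 * s * p (2 * z)" by (simp add: mult.assoc)
  moreover have "s * s = 1" using s by auto
  ultimately show ?thesis by simp
qed

text \<open>W2 (1, 1; 0, 1) = (29, 8; -98, -27) W2, and the left factor lies in Gamma0 14.\<close>

lemma G_plus_1:
  assumes z: "Im z > 0"
  shows "G (z + 1) = G z"
proof -
  define w where "w = W2 z"
  have w: "Im w > 0" using W2_pos[OF z] by (simp add: w_def)
  have nz: "14 * z - 4 \<noteq> 0" "14 * z + 10 \<noteq> 0"
    using linear_nonzero[OF z, of 14 4] linear_nonzero[OF z, of 14 10] by simp_all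
  have e: "-98 * w + -27 = (14 * z + 10) / (14 * z - 4)"
    unfolding w_def W2_def using nz by (simp add: field_simps)
  have n: "29 * w + 8 = (-4 * z - 3) / (14 * z - 4)"
    unfolding w_def W2_def using nz by (simp add: field_simps)
  have d: "14 * (z + 1) - 4 = 14 * z + 10" by simp
  have "W2 (z + 1) = (29 * w + 8) / (-98 * w + -27)"
    unfolding W2_def d e n divide_divide_cancel[OF nz(1)] by simp
  also have "f \<dots> = (-98 * w + -27) ^ 4 * f w"
    using modular[of 29 "-27" 8 "-98" w] w by simp
  finally show ?thesis unfolding G_def d e using nz by (simp add: power_divide w_def)
qed

lemma W2_holomorphic: "W2 holomorphic_on {z. Im z > 0}"
  unfolding W2_def by (intro holomorphic_intros) (use linear_nonzero(2)[of _ 14 4] in auto)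

lemma W7_holomorphic: "W7 holomorphic_on {z. Im z > 0}"
  unfolding W7_def by (intro holomorphic_intros) (use linear_nonzero(2)[of _ 14 7] in auto)

lemma f_compose_holomorphic:
  assumes "g holomorphic_on {z. Im z > 0}" "\<And>z. Im z > 0 \<Longrightarrow> Im (g z) > 0"
  shows "(\<lambda>z. f (g z)) holomorphic_on {z. Im z > 0}"
proof -
  have "g ` {z. Im z > 0} \<subseteq> {z. Im z > 0}" using assms(2) by auto
  from holomorphic_on_compose_gen[OF assms(1) hol this] show ?thesis by (simp add: o_def)
qed

lemma p_holomorphic: "p holomorphic_on {z. Im z > 0}"
proof -
  have "(\<lambda>z. f (W2 z)) holomorphic_on {z. Im z > 0}"
    by (rule f_compose_holomorphic[OF W2_holomorphic W2_pos])
  then show ?thesis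
    unfolding p_def G_def using hol
    by (intro holomorphic_intros) (use linear_nonzero(2)[of _ 14 4] in auto)
qed

lemma p_eq_0:
  assumes z: "Im z > 0"
  shows "p z = 0"
proof -
  have per: "p (z + 1 / 2 ^ n) = p z" if "Im z > 0" for n z
    using that
  proof (induction n arbitrary: z)
    case 0
    then show ?case by (simp add: p_def G_plus_1 f_plus_1)
  next
    case (Suc n)
    \<comment> \<open>Doubling the argument doubles the shift, so the period 2^(-n) of p yields the
      period 2^(-n-1).\<close>
    then have "p (z + 1 / 2 ^ Suc n) = 4 * s * p (2 * z + 1 / 2 ^ n)"
      using p_double[of "z + 1 / 2 ^ Suc n"] by (simp add: distrib_left)
    also have "\<dots> = p z" using Suc.IH[of "2 * z"] Suc.prems p_double[of z] by simp
    finally show ?case .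
  qed
  \<comment> \<open>The points i + 2^(-n) accumulate at i and p takes the value p(i) at each of
    them; the identity theorem makes p constant.\<close>
  have d: "p w - p \<i> = 0" if "Im w > 0" for w
  proof (rule analytic_continuation[of "\<lambda>w. p w - p \<i>" "{z. Im z > 0}" "range (\<lambda>n. \<i> + 1 / 2 ^ n)" \<i>])
    show "(\<lambda>w. p w - p \<i>) holomorphic_on {z. Im z > 0}" by (intro holomorphic_intros p_holomorphic)
    show "connected {z. Im z > 0}" by (intro convex_connected convex_halfspace_Im_gt)
    show "\<i> islimpt range (\<lambda>n. \<i> + 1 / 2 ^ n)"
      unfolding islimpt_sequential
    proof (intro exI conjI allI)
      have "(\<lambda>n. \<i> + (1 / 2) ^ n) \<longlonglongrightarrow> \<i> + 0"
        by (intro tendsto_add tendsto_const LIMSEQ_power_zero) simp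
      then show "(\<lambda>n. \<i> + 1 / 2 ^ n) \<longlonglongrightarrow> \<i>" by (simp add: power_divide)
    qed auto
  qed (use that per in \<open>auto simp: open_halfspace_Im_gt\<close>)
  have c: "p w = p \<i>" if "Im w > 0" for w using d[OF that] by simp
  have "p \<i> = 4 * s * p (2 * \<i>)" by (rule p_double) simp
  also have "p (2 * \<i>) = p \<i>" by (rule c) simp
  finally have "(1 - 4 * s) * p \<i> = 0" by (simp add: algebra_simps)
  moreover have "1 - 4 * s \<noteq> 0" using s by auto
  ultimately have "p \<i> = 0" by simp
  then show ?thesis using c[OF z] by simp
qed

lemma f_W2:
  assumes z: "Im z > 0"
  shows "f (W2 z) = - (s / 4) * (14 * z - 4) ^ 4 * f z"
proof -
  have nz: "14 * z - 4 \<noteq> 0" using linear_nonzero[OF z, of 14 4] by simp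
  have "f (W2 z) = (14 * z - 4) ^ 4 * G z / 4" unfolding G_def using nz by simp
  moreover have "G z = - s * f z" using p_eq_0[OF z] by (simp add: p_def add_eq_0_iff)
  ultimately show ?thesis by simp
qed

end

section \<open>The Atkin--Lehner involution at 7\<close>

lemma dedekind_eta_plus_nat_pow4:
  "dedekind_eta (z + of_nat n) ^ 4 = nome (of_nat n / 6) * dedekind_eta z ^ 4"
proof (induction n)
  case (Suc n)
  have "dedekind_eta (z + of_nat (Suc n)) ^ 4 = dedekind_eta ((z + of_nat n) + 1) ^ 4"
    by (simp add: algebra_simps)
  then show ?case
    unfolding dedekind_eta_T_pow4 Suc by (simp add: nome_add add_divide_distrib)
qed simp

lemma filterlim_Im_mult:
  assumes "c > (0::real)"
  shows "filterlim (\<lambda>z. of_real c * z) (filtercomap Im at_top) (filtercomap Im at_top)"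
proof -
  have "filterlim (\<lambda>y. c * y) at_top at_top"
    using assms filterlim_tendsto_pos_mult_at_top[OF tendsto_const _ filterlim_ident] by blast
  from filterlim_compose[OF this filterlim_filtercomap]
  show ?thesis by (simp add: filterlim_filtercomap_iff o_def)
qed

lemma euler_nome_tendsto: "k > 0 \<Longrightarrow> ((\<lambda>z. euler (nome z ^ k)) \<longlongrightarrow> 1) (filtercomap Im at_top)"
proof -
  assume k: "k > 0"
  have "euler 0 = 1" by (simp add: euler_def qpoch_def)
  moreover have "isCont euler 0"
    using euler_holomorphic holomorphic_on_imp_continuous_on[of euler "ball 0 1"]
    by (simp add: continuous_on_eq_continuous_at)
  ultimately have "euler \<midarrow>0\<rightarrow> 1" by (simp add: isCont_def)
  moreover have "filterlim (\<lambda>q::complex. q ^ k) (at 0) (at 0)"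
    using k by (auto simp: filterlim_at eventually_at_filter intro!: tendsto_eq_intros)
  from filterlim_compose[OF this filterlim_nome_at_0]
  have "filterlim (\<lambda>z. nome z ^ k) (at 0) (filtercomap Im at_top)" .
  ultimately show ?thesis by (rule filterlim_compose)
qed

lemma slash_cancel_3:
  fixes k :: "'a::field"
  assumes "D \<noteq> 0"
  shows "C * ((- D / k) ^ 4 * F) / D ^ 4 = C * F / k ^ 4"
  using assms by (simp add: power_divide)

context level14_form
begin

text \<open>
  Each matrix in this family of determinant 2 is a left multiple of the matrix of \<open>W2\<close> by an element
  of \<open>Gamma0 14\<close>.
\<close>
lemma f_type2:
  fixes \<alpha> \<beta> \<gamma> \<delta> :: int
  assumes det: "2 * \<alpha> * \<delta> - 7 * \<beta> * \<gamma> = 1" and z: "Im z > 0"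
  shows "f ((of_int (2 * \<alpha>) * z + of_int \<beta>) / (of_int (14 * \<gamma>) * z + of_int (2 * \<delta>)))
    = - (s / 4) * (of_int (14 * \<gamma>) * z + of_int (2 * \<delta>)) ^ 4 * f z"
proof -
  define w where "w = W2 z"
  define D where "D = of_int (14 * \<gamma>) * z + of_int (2 * \<delta>)"
  have w: "Im w > 0" using W2_pos[OF z] by (simp add: w_def)
  have nz: "14 * z - 4 \<noteq> 0" using linear_nonzero[OF z, of 14 4] by simp
  \<comment> \<open>The integer entries in \<open>e\<close> and \<open>n\<close> are those of (2
    \<alpha>, \<beta>; 14 \<gamma>, 2 \<delta>) times the inverse of the matrix of W2.\<close>
  have e: "of_int (- 28 * \<gamma> - 14 * \<delta>) * w + of_int (- 7 * \<gamma> - 4 * \<delta>) = D / (14 * z - 4)"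
    unfolding w_def W2_def D_def using nz by (simp add: divide_simps) (simp add: algebra_simps)
  have n: "of_int (- 4 * \<alpha> - 7 * \<beta>) * w + of_int (- \<alpha> - 2 * \<beta>) = (of_int (2 * \<alpha>) * z + of_int \<beta>) / (14 * z - 4)"
    unfolding w_def W2_def using nz by (simp add: divide_simps) (simp add: algebra_simps)
  have "(of_int (2 * \<alpha>) * z + of_int \<beta>) / D
      = (of_int (- 4 * \<alpha> - 7 * \<beta>) * w + of_int (- \<alpha> - 2 * \<beta>)) / (of_int (- 28 * \<gamma> - 14 * \<delta>) * w + of_int (- 7 * \<gamma> - 4 * \<delta>))"
    unfolding e n divide_divide_cancel[OF nz] ..
  also have "f \<dots> = (of_int (- 28 * \<gamma> - 14 * \<delta>) * w + of_int (- 7 * \<gamma> - 4 * \<delta>)) ^ 4 * f w"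
  proof (rule modular[OF _ _ w])
    show "(- 4 * \<alpha> - 7 * \<beta>) * (- 7 * \<gamma> - 4 * \<delta>) - (- \<alpha> - 2 * \<beta>) * (- 28 * \<gamma> - 14 * \<delta>) = 1"
      using det by (simp add: algebra_simps)
    have "- 28 * \<gamma> - 14 * \<delta> = 14 * (- 2 * \<gamma> - \<delta>)" by simp
    then show "14 dvd - 28 * \<gamma> - 14 * \<delta>" by (metis dvd_triv_left)
  qed
  also have "f w = - (s / 4) * (14 * z - 4) ^ 4 * f z"
    unfolding w_def by (rule f_W2[OF z])
  finally show ?thesis unfolding D_def[symmetric] e using nz by (simp add: power_divide)
qed

text \<open>f slashed with W7, with 49 = 7^2 as the determinant factor in weight 4. H and the seven
  terms of U7 are the eight coset terms of a trace to level 2.\<close>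

definition H where "H z = 49 * f (W7 z) / (14 * z - 7) ^ 4"
definition P where "P z = H z + \<mu> * f z"

lemma sum_lessThan_7: "(\<Sum>b<7. g b) = g 0 + g 1 + g 2 + g 3 + g 4 + g 5 + (g (6::nat) :: complex)"
  by (simp add: eval_nat_numeral)

lemma P_altdef:
  assumes "Im z > 0"
  shows "P z = H z + (f (z / 7) + f ((z + 1) / 7) + f ((z + 2) / 7) + f ((z + 3) / 7)
    + f ((z + 4) / 7) + f ((z + 5) / 7) + f ((z + 6) / 7)) / 49"
  using U7[OF assms] unfolding sum_lessThan_7 by (simp add: P_def)

text \<open>(1, b; 0, 7) (0, -1; 2, 0) = (2 b, -k; 14, -2 b') (1, b'; 0, 7) exactly when 2 b b' + 1
  = 7 k, and the first factor on the right is of the kind treated in \<open>f_type2\<close>.\<close>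

lemma f_seventh_slash:
  assumes z: "Im z > 0" and b: "7 dvd 2 * b * b' + (1::int)"
  shows "f ((- 1 / (2 * z) + of_int b) / 7) = - 4 * s * z ^ 4 * f ((z + of_int b') / 7)"
proof -
  obtain k where k: "2 * b * b' + 1 = 7 * k" using b by (elim dvdE)
  define w where "w = (z + of_int b') / 7"
  have w: "Im w > 0" using z by (simp add: w_def)
  have z0: "z \<noteq> 0" using z by auto
  have zw: "z = 7 * w - of_int b'" by (simp add: w_def field_simps)
  have k': "2 * of_int b * of_int b' + 1 = (7 * of_int k :: complex)"
    using arg_cong[OF k, of "of_int :: int \<Rightarrow> complex"] by simp
  have e: "of_int (14 * 1) * w + of_int (2 * (- b')) = 2 * z" by (simp add: zw)
  have n: "of_int (2 * b) * w + of_int (- k) = (2 * of_int b * z - 1) / 7"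
    using k' by (simp add: zw field_simps)
  have "(- 1 / (2 * z) + of_int b) / 7 = (of_int (2 * b) * w + of_int (- k)) / (of_int (14 * 1) * w + of_int (2 * (- b')))"
    unfolding e n using z0 by (simp add: field_simps)
  also have "f \<dots> = - (s / 4) * (of_int (14 * 1) * w + of_int (2 * (- b'))) ^ 4 * f w"
    by (rule f_type2[OF _ w]) (use k in \<open>simp add: algebra_simps\<close>)
  finally show ?thesis unfolding e by (simp add: power_mult_distrib w_def)
qed

text \<open>Up to sign (0, -1; 14, 0) is (-2, 1; 14, -8) W7, whose first factor has determinant 2
  and falls under \<open>f_type2\<close>.\<close>

lemma f_W14':
  assumes z: "Im z > 0"
  shows "f (- 1 / (14 * z)) = - (s / 4) * (14 * z) ^ 4 * f (W7 z) / (14 * z - 7) ^ 4"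
proof -
  define w where "w = W7 z"
  have w: "Im w > 0" using W7_pos[OF z] by (simp add: w_def)
  have nz: "14 * z - 7 \<noteq> 0" "z \<noteq> 0" using linear_nonzero[OF z, of 14 7] z by auto
  have e: "of_int (14 * 1) * w + of_int (2 * (- 4)) = - (14 * z) / (14 * z - 7)"
    unfolding w_def W7_def using nz by (simp add: field_simps)
  have n: "of_int (2 * (- 1)) * w + of_int 1 = 1 / (14 * z - 7)"
    unfolding w_def W7_def using nz by (simp add: field_simps)
  have "- 1 / (14 * z) = (of_int (2 * (- 1)) * w + of_int 1) / (of_int (14 * 1) * w + of_int (2 * (- 4)))"
    unfolding e n divide_divide_cancel[OF nz(1)] by simp
  also have "f \<dots> = - (s / 4) * (of_int (14 * 1) * w + of_int (2 * (- 4))) ^ 4 * f w"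
    by (rule f_type2[OF _ w]) simp
  finally show ?thesis unfolding e by (simp add: power_divide w_def)
qed

text \<open>W7 (0, -1; 2, 0) = (-8, -1; -14, -2) (1, 0; 0, 7), again with a first factor covered by
  \<open>f_type2\<close>.\<close>

lemma H_slash:
  assumes z: "Im z > 0"
  shows "H (- 1 / (2 * z)) = - 4 * s * z ^ 4 * (f (z / 7) / 49)"
proof -
  define w where "w = z / 7"
  have w: "Im w > 0" using z by (simp add: w_def)
  have zw: "z = 7 * w" by (simp add: w_def)
  have nz: "z \<noteq> 0" "z + 1 \<noteq> 0" using linear_nonzero[OF z, of 1 1] z by auto
  have d: "14 * (- 1 / (2 * z)) - 7 = - 7 * (z + 1) / z" using nz by (simp add: field_simps)
  have m: "7 * (- 1 / (2 * z)) - 4 = (- 8 * z - 7) / 2 / z" using nz by (simp add: field_simps)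
  have e: "of_int (14 * (- 1)) * w + of_int (2 * (- 1)) = - 2 * (z + 1)" by (simp add: zw)
  have n: "of_int (2 * (- 4)) * w + of_int (- 1) = (- 8 * z - 7) / 7" by (simp add: zw field_simps)
  have "W7 (- 1 / (2 * z)) = (of_int (2 * (- 4)) * w + of_int (- 1)) / (of_int (14 * (- 1)) * w + of_int (2 * (- 1)))"
    unfolding W7_def d m e n divide_divide_cancel[OF nz(1)] by (simp add: mult.commute)
  also have "f \<dots> = - (s / 4) * (of_int (14 * (- 1)) * w + of_int (2 * (- 1))) ^ 4 * f w"
    by (rule f_type2[OF _ w]) simp
  finally have fW: "f (W7 (- 1 / (2 * z))) = - (s / 4) * (- 2 * (z + 1)) ^ 4 * f w" unfolding e .
  show ?thesis unfolding H_def d fW w_def power_divide power_mult_distrib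
    using nz by (simp add: divide_simps)
qed

text \<open>The Fricke involution of level 2 exchanges H with the term b = 0 and permutes the terms
  b = 1, ..., 6 by 2 b b' = -1 modulo 7. Every term acquires the same factor, so P is an
  eigenfunction.\<close>

lemma P_slash:
  assumes z: "Im z > 0"
  shows "P (- 1 / (2 * z)) = - 4 * s * z ^ 4 * P z"
proof -
  have z0: "z \<noteq> 0" using z by auto
  have pos: "Im (- 1 / (2 * z)) > 0" using Im_moebius_pos[OF z, of 0 0 "-1" 2] by simp
  have nz: "14 * z - 7 \<noteq> 0" using linear_nonzero[OF z, of 14 7] by simp
  have "f (- 1 / (2 * z) / 7) = - 4 * s * z ^ 4 * (49 * H z)"
    using f_W14'[OF z] by (simp add: H_def power_mult_distrib)
  then show ?thesis
    using f_seventh_slash[OF z, of 1 3] f_seventh_slash[OF z, of 2 5] f_seventh_slash[OF z, of 3 1]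
      f_seventh_slash[OF z, of 4 6] f_seventh_slash[OF z, of 5 2] f_seventh_slash[OF z, of 6 4]
    unfolding P_altdef[OF z] P_altdef[OF pos] H_slash[OF z]
    by (simp add: algebra_simps add_divide_distrib diff_divide_distrib)
qed

text \<open>W7 (1, 1; 0, 1) = - (13, -7; 28, -15) W7, with (13, -7; 28, -15) in Gamma0 14.\<close>

lemma H_plus_1:
  assumes z: "Im z > 0"
  shows "H (z + 1) = H z"
proof -
  define w where "w = W7 z"
  have w: "Im w > 0" using W7_pos[OF z] by (simp add: w_def)
  have nz: "14 * z - 7 \<noteq> 0" "14 * z + 7 \<noteq> 0"
    using linear_nonzero[OF z, of 14 7] linear_nonzero[OF z, of 14 7] by simp_all
  have e: "28 * w + -15 = - (14 * z + 7) / (14 * z - 7)"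
    unfolding w_def W7_def using nz by (simp add: field_simps)
  have n: "13 * w + -7 = - (7 * z + 3) / (14 * z - 7)"
    unfolding w_def W7_def using nz by (simp add: field_simps)
  have d: "14 * (z + 1) - 7 = 14 * z + 7" "7 * (z + 1) - 4 = 7 * z + 3" by simp_all
  have "W7 (z + 1) = (13 * w + -7) / (28 * w + -15)"
    unfolding W7_def d e n divide_divide_cancel[OF nz(1)] by (rule minus_divide_divide[symmetric])
  also have "f \<dots> = (28 * w + -15) ^ 4 * f w"
    using modular[of 13 "-15" "-7" 28 w] w by simp
  finally have fW: "f (W7 (z + 1)) = (28 * w + -15) ^ 4 * f w" .
  show ?thesis unfolding H_def d fW e slash_cancel_3[OF nz(2)] by (simp only: w_def)
qed

lemma P_plus_1: "Im z > 0 \<Longrightarrow> P (z + 1) = P z"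
  by (simp add: P_def H_plus_1 f_plus_1)

lemma P_holomorphic: "P holomorphic_on {z. Im z > 0}"
proof -
  have "(\<lambda>z. f (W7 z)) holomorphic_on {z. Im z > 0}"
    by (rule f_compose_holomorphic[OF W7_holomorphic W7_pos])
  then show ?thesis
    unfolding P_def H_def using hol
    by (intro holomorphic_intros) (use linear_nonzero(2)[of _ 14 7] in auto)
qed

lemma f_tendsto_0: "(f \<longlongrightarrow> 0) (filtercomap Im at_top)"
  using cusp[of 1 1 0 0] by simp

lemma P_tendsto_0: "(P \<longlongrightarrow> 0) (filtercomap Im at_top)"
proof -
  \<comment> \<open>W7 is the map of (1, -4; 2, -7) in SL2Z applied to 7 z, so vanishing of f at the
    cusp 1/2 gives vanishing of H at infinity.\<close>
  have "((\<lambda>z. f ((z - 4) / (2 * z - 7)) / (2 * z - 7) ^ 4) \<longlongrightarrow> 0) (filtercomap Im at_top)"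
    using cusp[of 1 "-7" "-4" 2] by simp
  from filterlim_compose[OF this filterlim_Im_mult[of 7]]
  have "((\<lambda>z. f (W7 z) / (14 * z - 7) ^ 4) \<longlongrightarrow> 0) (filtercomap Im at_top)"
    by (simp add: W7_def)
  then have "((\<lambda>z. 49 * (f (W7 z) / (14 * z - 7) ^ 4) + \<mu> * f z) \<longlongrightarrow> 49 * 0 + \<mu> * 0) (filtercomap Im at_top)"
    by (intro tendsto_add tendsto_mult tendsto_const f_tendsto_0)
  then show ?thesis by (simp add: P_def[abs_def] H_def)
qed

lemma P_eq_0:
  assumes z: "Im z > 0"
  shows "P z = 0"
proof -
  \<comment> \<open>Of weight 8, like P^2. Squaring P removes the sign - s in
    \<open>P_slash\<close>.\<close>
  define D where "D z = (dedekind_eta z ^ 4 * dedekind_eta (2 * z) ^ 4)\<^sup>2" for z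
  define \<Phi> where "\<Phi> z = (P z)\<^sup>2 / D z" for z
  have D0: "D z \<noteq> 0" if "Im z > 0" for z using that by (simp add: D_def dedekind_eta_nonzero)
  have "\<Phi> z = 0"
  proof (rule invariant_holomorphic_eq_limit[where \<Phi> = \<Phi> and \<delta> = "1/4" and \<kappa> = "8/5"])
    have "(\<lambda>z. dedekind_eta (2 * z)) holomorphic_on {z. Im z > 0}"
    proof -
      have "(\<lambda>z. 2 * z) holomorphic_on {z. Im z > 0}" by (intro holomorphic_intros)
      moreover have "(\<lambda>z. 2 * z) ` {z. Im z > 0} \<subseteq> {z. Im z > 0}" by auto
      ultimately show ?thesis
        using holomorphic_on_compose_gen[OF _ dedekind_eta_holomorphic] unfolding o_def by blast
    qed
    then have "D holomorphic_on {z. Im z > 0}"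
      unfolding D_def using dedekind_eta_holomorphic by (intro holomorphic_intros)
    then show "\<Phi> holomorphic_on {z. Im z > 0}"
      unfolding \<Phi>_def using P_holomorphic D0 by (intro holomorphic_intros) auto
  next
    fix z :: complex assume z: "Im z > 0"
    have "dedekind_eta (2 * (z + 1)) ^ 4 = nome (1/3) * dedekind_eta (2 * z) ^ 4"
      using dedekind_eta_plus_nat_pow4[of "2 * z" 2] by (simp add: distrib_left)
    then have "D (z + 1) = (nome (1/6) * nome (1/3))\<^sup>2 * D z"
      by (simp add: D_def dedekind_eta_T_pow4 power_mult_distrib)
    also have "(nome (1/6) * nome (1/3))\<^sup>2 = 1"
      by (simp add: nome_add[symmetric] nome_power)
    finally have "D (z + 1) = D z" by simp
    then show "\<Phi> (z + 1) = \<Phi> z" by (simp add: \<Phi>_def P_plus_1[OF z])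
  next
    \<comment> \<open>P^2 is O(q^2) while D is q times a function tending to 1, so the quotient
      tends to 0.\<close>
    obtain L where L: "((\<lambda>z. P z / nome z) \<longlongrightarrow> L) (filtercomap Im at_top)"
      using periodic_holomorphic_tendsto_0[OF P_holomorphic P_plus_1 P_tendsto_0] by blast
    have Dq: "D z = nome z * (euler (nome z ^ 1) * euler (nome z ^ 2)) ^ 8" for z
    proof -
      have "D z = (nome (z / 24) ^ 8 * nome (2 * z / 24) ^ 8) * (euler (nome z) * euler (nome (2 * z))) ^ 8"
        by (simp add: D_def dedekind_eta_altdef euler_def power_mult_distrib power_mult[symmetric])
      also have "nome (z / 24) ^ 8 * nome (2 * z / 24) ^ 8 = nome z"
        by (simp add: nome_power nome_add[symmetric])
      finally show ?thesis by (simp add: nome_power)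
    qed
    have "filterlim nome (nhds 0) (filtercomap Im at_top)"
      using filterlim_nome_at_0 by (simp add: filterlim_at)
    then have "((\<lambda>z. (P z / nome z)\<^sup>2 * nome z / (euler (nome z ^ 1) * euler (nome z ^ 2)) ^ 8) \<longlongrightarrow> L\<^sup>2 * 0 / (1 * 1) ^ 8) (filtercomap Im at_top)"
      by (intro tendsto_intros L euler_nome_tendsto) auto
    moreover have "(P z / nome z)\<^sup>2 * nome z / (euler (nome z ^ 1) * euler (nome z ^ 2)) ^ 8 = \<Phi> z" for z
      unfolding \<Phi>_def Dq by (simp add: power2_eq_square)
    ultimately show "(\<Phi> \<longlongrightarrow> 0) (filtercomap Im at_top)" by simp
  next
    \<comment> \<open>Here |z|^2 <= 1/4 + 1/16 = 5/16, and z -> -1/(2z) multiplies the imaginary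
      part by 1/(2 |z|^2) >= 8/5.\<close>
    fix z :: complex assume z: "0 < Im z" "Im z < 1/4" "\<bar>Re z\<bar> \<le> 1/2"
    define z' where "z' = - 1 / (2 * z)"
    have z0: "z \<noteq> 0" using z by auto
    have n: "(norm z)\<^sup>2 \<le> 5/16"
    proof -
      have "(Re z)\<^sup>2 \<le> (1/2)\<^sup>2" using z by (simp add: abs_le_square_iff[symmetric])
      moreover have "(Im z)\<^sup>2 \<le> (1/4)\<^sup>2" using z by (intro power_mono) auto
      ultimately show ?thesis unfolding cmod_power2 by (simp add: power2_eq_square)
    qed
    have "Im z' = Im z / (2 * (norm z)\<^sup>2)"
    proof -
      have "Im z' = 2 * Im z / (norm (2 * z))\<^sup>2" by (simp add: z'_def Im_divide cmod_power2)
      then show ?thesis by (simp add: norm_mult power_mult_distrib)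
    qed
    moreover have "8 / 5 \<le> 1 / (2 * (norm z)\<^sup>2)" using n z0 by (simp add: field_simps)
    ultimately have "8 / 5 * Im z \<le> Im z'"
      using z mult_right_mono[of "8/5" "1 / (2 * (norm z)\<^sup>2)" "Im z"] by simp
    moreover have "\<Phi> z' = \<Phi> z"
    proof -
      have "dedekind_eta z' ^ 4 = - (2 * z)\<^sup>2 * dedekind_eta (2 * z) ^ 4"
        using dedekind_eta_S_pow4[of "2 * z"] z by (simp add: z'_def)
      moreover have "2 * z' = - 1 / z" by (simp add: z'_def)
      then have "dedekind_eta (2 * z') ^ 4 = - z\<^sup>2 * dedekind_eta z ^ 4"
        using dedekind_eta_S_pow4[of z] z by simp
      ultimately have "D z' = 16 * z ^ 8 * D z"
        by (simp add: D_def power_mult_distrib power_mult[symmetric] eval_nat_numeral mult_ac)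
      moreover have "(P z')\<^sup>2 = 16 * z ^ 8 * (P z)\<^sup>2"
        using P_slash[OF z(1)] s by (auto simp: z'_def power_mult_distrib power_mult[symmetric])
      ultimately show ?thesis using z0 by (simp add: \<Phi>_def)
    qed
    ultimately show "\<exists>z'. Im z' \<ge> 8/5 * Im z \<and> \<Phi> z' = \<Phi> z" by blast
  qed (use z in auto)
  then show ?thesis using D0[OF z] by (simp add: \<Phi>_def)
qed

lemma f_W7:
  assumes z: "Im z > 0"
  shows "f (W7 z) = - (\<mu> / 49) * (14 * z - 7) ^ 4 * f z"
proof -
  have nz: "14 * z - 7 \<noteq> 0" using linear_nonzero[OF z, of 14 7] by simp
  have "f (W7 z) = (14 * z - 7) ^ 4 * H z / 49" unfolding H_def using nz by simp
  moreover have "H z = - \<mu> * f z" using P_eq_0[OF z] by (simp add: P_def add_eq_0_iff)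
  ultimately show ?thesis by simp
qed

text \<open>W7 is an involution on points, so \<open>f_W7\<close> can be applied twice; the two
  automorphy factors multiply to (-7)^4 = 49^2.\<close>

lemma mu_square:
  assumes z: "Im z > 0" and fz: "f z \<noteq> 0"
  shows "\<mu>\<^sup>2 = 1"
proof -
  define w where "w = W7 z"
  have nz: "14 * z - 7 \<noteq> 0" using linear_nonzero[OF z, of 14 7] by simp
  have e: "14 * w - 7 = - 7 / (14 * z - 7)" "7 * w - 4 = - (7 * z) / (14 * z - 7)"
    unfolding w_def W7_def using nz by (simp_all add: field_simps)
  have "W7 w = z" unfolding W7_def[of w] e divide_divide_cancel[OF nz] by simp
  then have "f z = - (\<mu> / 49) * (14 * w - 7) ^ 4 * f w"
    using f_W7[OF W7_pos[OF z]] by (simp add: w_def)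
  also have "f w = - (\<mu> / 49) * (14 * z - 7) ^ 4 * f z"
    unfolding w_def by (rule f_W7[OF z])
  finally show ?thesis unfolding e using nz fz by (simp add: power_divide power2_eq_square)
qed

lemma f_W14:
  assumes z: "Im z > 0"
  shows "f (- 1 / (14 * z)) = 196 * s * \<mu> * z ^ 4 * f z"
proof -
  have nz: "14 * z - 7 \<noteq> 0" using linear_nonzero[OF z, of 14 7] by simp
  show ?thesis unfolding f_W14'[OF z] f_W7[OF z] using nz by (simp add: power_mult_distrib)
qed

end

section \<open>Eta quotients under the Atkin--Lehner involutions\<close>

text \<open>For the fourth power both generators have explicit multipliers: - z^2 for inversion and
  the sixth root of unity \<open>nome (1 / 6)\<close> for translation.\<close>

definition eta4 :: "complex \<Rightarrow> complex" where
  "eta4 z = dedekind_eta z ^ 4"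

lemma eta4_nonzero: "Im z > 0 \<Longrightarrow> eta4 z \<noteq> 0"
  by (simp add: eta4_def dedekind_eta_nonzero)

lemma eta4_S: "Im z > 0 \<Longrightarrow> eta4 (- 1 / z) = - z\<^sup>2 * eta4 z"
  unfolding eta4_def by (rule dedekind_eta_S_pow4)

lemma eta4_plus_int: "eta4 (z + of_int n) = nome (of_int n / 6) * eta4 z"
proof (cases n)
  case (nonneg k)
  then show ?thesis using dedekind_eta_plus_nat_pow4[of z k] by (simp add: eta4_def)
next
  case (neg k)
  have "eta4 z = nome (of_nat (Suc k) / 6) * eta4 (z + of_int n)"
    using dedekind_eta_plus_nat_pow4[of "z + of_int n" "Suc k"] neg by (simp add: eta4_def)
  also have "nome (of_nat (Suc k) / 6) = inverse (nome (of_int n / 6))"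
  proof -
    have "of_nat (Suc k) / 6 = - (of_int n / 6 :: complex)"
      by (simp only: neg of_int_minus of_int_of_nat_eq minus_divide_left minus_minus)
    then show ?thesis by (simp only: nome_minus)
  qed
  finally show ?thesis by simp
qed

text \<open>The building block T^m S T^n. Chaining it along continued fractions yields the
  multipliers of \<open>eta4\<close> for the matrices needed below; the second claim makes the
  chaining possible.\<close>

lemma eta4_TST:
  assumes w: "Im w > 0"
  shows "eta4 (of_int m - 1 / (w + of_int n)) = - nome (of_int (m + n) / 6) * (w + of_int n)\<^sup>2 * eta4 w"
    and "Im (of_int m - 1 / (w + of_int n)) > 0"
proof -
  have p: "Im (w + of_int n) > 0" using w by simp
  have "eta4 (- 1 / (w + of_int n) + of_int m) = nome (of_int m / 6) * (- (w + of_int n)\<^sup>2 * (nome (of_int n / 6) * eta4 w))"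
    unfolding eta4_plus_int[of "- 1 / (w + of_int n)"] eta4_S[OF p] eta4_plus_int[of w] ..
  also have "\<dots> = - (nome (of_int m / 6) * nome (of_int n / 6)) * (w + of_int n)\<^sup>2 * eta4 w"
    by (simp add: mult_ac)
  also have "nome (of_int m / 6) * nome (of_int n / 6) = nome (of_int (m + n) / 6)"
    by (simp add: nome_add[symmetric] add_divide_distrib)
  finally show "eta4 (of_int m - 1 / (w + of_int n)) = - nome (of_int (m + n) / 6) * (w + of_int n)\<^sup>2 * eta4 w"
    by (simp add: add.commute)
  show "Im (of_int m - 1 / (w + of_int n)) > 0"
    using Im_inverse_pos[OF p] by simp
qed

lemma times_divide_cancel:
  fixes c :: "'a::field"
  shows "c \<noteq> 0 \<Longrightarrow> c * (a / (c * b)) = a / b"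
  by simp

lemma minus_one_divide_minus:
  fixes a :: "'a::field"
  shows "- 1 / (- a / b) = b / a"
  by simp

lemma eta4_7_4_2_1:
  assumes w: "Im w > 0"
  shows "eta4 ((7 * w - 4) / (2 * w - 1)) = (2 * w - 1)\<^sup>2 * eta4 w"
    and "Im ((7 * w - 4) / (2 * w - 1)) > 0"
proof -
  \<comment> \<open>The continued fraction (7w - 4)/(2w - 1) = 3 - 1/(-2 - 1/(w - 1)), that is T^3 S
    T^(-2) S T^(-1).\<close>
  define x where "x = -2 - 1 / (w - 1)"
  have nz: "w - 1 \<noteq> 0" "2 * w - 1 \<noteq> 0"
    using linear_nonzero[OF w, of 1 1] linear_nonzero[OF w, of 2 1] by auto
  have x: "eta4 x = - nome (-1/2) * (w - 1)\<^sup>2 * eta4 w" "Im x > 0"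
    using eta4_TST[OF w, of "-2" "-1"] by (simp_all add: x_def)
  have xe: "x = - (2 * w - 1) / (w - 1)" unfolding x_def using nz by (simp add: field_simps)
  have eq: "(7 * w - 4) / (2 * w - 1) = 3 - 1 / x"
    unfolding xe using nz by (simp add: field_simps)
  have "nome (-1/2) = -1" using nome_minus[of "1/2"] by simp
  then show "eta4 ((7 * w - 4) / (2 * w - 1)) = (2 * w - 1)\<^sup>2 * eta4 w"
    unfolding eq using eta4_TST(1)[OF x(2), of 3 0] x(1) nz by (simp add: xe power_divide power2_commute[of 1 "2 * w"])
  show "Im ((7 * w - 4) / (2 * w - 1)) > 0"
    unfolding eq using eta4_TST(2)[OF x(2), of 3 0] by simp
qed

lemma eta4_S_frac:
  assumes "Im (a / b) > 0"
  shows "eta4 (- b / a) = - (a / b)\<^sup>2 * eta4 (a / b)"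
  using eta4_S[OF assms] by simp

text \<open>For each d dividing 14, d W7(z) is an SL2Z image of e z: W7 exchanges z with 7 z and 2 z
  with 14 z. The four lemmas record the multipliers.\<close>

lemma eta4_W7_1:
  assumes z: "Im z > 0"
  shows "eta4 ((7 * z - 4) / (14 * z - 7)) = (14 * z - 7)\<^sup>2 * eta4 (7 * z)"
proof -
  define w where "w = 7 * z"
  define x where "x = -2 - 1 / (w - 4)"
  have w: "Im w > 0" using z by (simp add: w_def)
  have nz: "w - 4 \<noteq> 0" "2 * w - 7 \<noteq> 0"
    using linear_nonzero[OF w, of 1 4] linear_nonzero[OF w, of 2 7] by auto
  have x: "eta4 x = - (w - 4)\<^sup>2 * eta4 w" "Im x > 0"
    using eta4_TST[OF w, of "-2" "-4"] nome_of_int[of "-1"] by (simp_all add: x_def)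
  have xe: "x = - (2 * w - 7) / (w - 4)" unfolding x_def using nz by (simp add: field_simps)
  have eq: "(7 * z - 4) / (14 * z - 7) = - 1 / x"
    unfolding xe minus_one_divide_minus by (simp add: w_def)
  show ?thesis
    unfolding eq eta4_S[OF x(2)] x(1) unfolding xe using nz
    by (simp add: w_def power_divide power2_commute[of 7 "14 * z"])
qed

lemma eta4_W7_2:
  assumes z: "Im z > 0"
  shows "eta4 (2 * ((7 * z - 4) / (14 * z - 7))) = - (14 * z - 7)\<^sup>2 * eta4 (14 * z)"
proof -
  have nz: "14 * z - 7 \<noteq> 0" using linear_nonzero[OF z, of 14 7] by auto
  have "2 * ((7 * z - 4) / (14 * z - 7)) = of_int 1 - 1 / (14 * z + of_int (-7))"
    using nz by (simp add: field_simps)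
  then show ?thesis using eta4_TST(1)[of "14 * z" 1 "-7"] z nome_of_int[of "-1"] by simp
qed

lemma eta4_W7_7:
  assumes z: "Im z > 0"
  shows "eta4 (7 * ((7 * z - 4) / (14 * z - 7))) = (2 * z - 1)\<^sup>2 * eta4 z"
proof -
  have e: "14 * z - 7 = 7 * (2 * z - 1)" by simp
  have "7 * ((7 * z - 4) / (14 * z - 7)) = (7 * z - 4) / (2 * z - 1)"
    unfolding e by (rule times_divide_cancel) simp
  then show ?thesis using eta4_7_4_2_1(1)[OF z] by (simp only:)
qed

lemma eta4_W7_14:
  assumes z: "Im z > 0"
  shows "eta4 (14 * ((7 * z - 4) / (14 * z - 7))) = - (2 * z - 1)\<^sup>2 * eta4 (2 * z)"
proof -
  have nz: "14 * z - 7 \<noteq> 0" "2 * z - 1 \<noteq> 0"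
    using linear_nonzero[OF z, of 14 7] linear_nonzero[OF z, of 2 1] by auto
  have "14 * ((7 * z - 4) / (14 * z - 7)) = of_int 7 - 1 / (2 * z + of_int (-1))"
    using nz by (simp add: field_simps)
  then show ?thesis using eta4_TST(1)[of "2 * z" 7 "-1"] z by simp
qed

text \<open>The same for W2, which exchanges z with 2 z and 7 z with 14 z. In this case the SL2Z map
  is the inversion after the one in \<open>eta4_7_4_2_1\<close>.\<close>

lemma eta4_W2_1:
  assumes z: "Im z > 0"
  shows "eta4 ((-4 * z + 1) / (14 * z - 4)) = - (14 * z - 4)\<^sup>2 * eta4 (2 * z)"
proof -
  define w where "w = 2 * z"
  have w: "Im w > 0" using z by (simp add: w_def)
  have nz: "2 * w - 1 \<noteq> 0" using linear_nonzero[OF w, of 2 1] by auto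
  have "(-4 * z + 1) / (14 * z - 4) = - (2 * w - 1) / (7 * w - 4)" by (simp add: w_def)
  also have "eta4 \<dots> = - ((7 * w - 4) / (2 * w - 1))\<^sup>2 * ((2 * w - 1)\<^sup>2 * eta4 w)"
    unfolding eta4_S_frac[OF eta4_7_4_2_1(2)[OF w]] eta4_7_4_2_1(1)[OF w] ..
  finally show ?thesis using nz by (simp add: power_divide) (simp add: w_def)
qed

lemma eta4_W2_2:
  assumes z: "Im z > 0"
  shows "eta4 (2 * ((-4 * z + 1) / (14 * z - 4))) = - (7 * z - 2)\<^sup>2 * eta4 z"
proof -
  define y where "y = 4 - 1 / z"
  define x where "x = 2 - 1 / y"
  have nz: "z \<noteq> 0" "4 * z - 1 \<noteq> 0" "7 * z - 2 \<noteq> 0"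
    using z linear_nonzero[OF z, of 4 1] linear_nonzero[OF z, of 7 2] by auto
  have y: "eta4 y = - nome (2/3) * z\<^sup>2 * eta4 z" "Im y > 0"
    using eta4_TST[OF z, of 4 0] by (simp_all add: y_def)
  have ye: "y = (4 * z - 1) / z" unfolding y_def using nz by (simp add: field_simps)
  have x: "eta4 x = - nome (1/3) * y\<^sup>2 * eta4 y" "Im x > 0"
    using eta4_TST[OF y(2), of 2 0] by (simp_all add: x_def)
  have xe: "x = (7 * z - 2) / (4 * z - 1)" unfolding x_def ye using nz by (simp add: field_simps)
  have "nome (1/3) * nome (2/3) = 1" unfolding nome_add[symmetric] by simp
  then have x': "eta4 x = (4 * z - 1)\<^sup>2 * eta4 z"
    unfolding x(1) y(1) unfolding ye using nz by (simp add: power_divide)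
  have "2 * ((-4 * z + 1) / (2 * (7 * z - 2))) = (-4 * z + 1) / (7 * z - 2)"
    by (simp del: distrib_left_numeral right_diff_distrib_numeral)
  moreover have "2 * (7 * z - 2) = 14 * z - 4" by simp
  ultimately have "2 * ((-4 * z + 1) / (14 * z - 4)) = (-4 * z + 1) / (7 * z - 2)" by metis
  also have "\<dots> = - 1 / x"
    unfolding xe by simp
  finally have eq: "2 * ((-4 * z + 1) / (14 * z - 4)) = - 1 / x" .
  show ?thesis
    unfolding eq eta4_S[OF x(2)] x' unfolding xe using nz by (simp add: power_divide)
qed

lemma eta4_W2_7:
  assumes z: "Im z > 0"
  shows "eta4 (7 * ((-4 * z + 1) / (14 * z - 4))) = - (14 * z - 4)\<^sup>2 * eta4 (14 * z)"
proof -
  have nz: "14 * z - 4 \<noteq> 0" using linear_nonzero[OF z, of 14 4] by auto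
  have "7 * ((-4 * z + 1) / (14 * z - 4)) = of_int (-2) - 1 / (14 * z + of_int (-4))"
    using nz by (simp add: field_simps)
  then show ?thesis using eta4_TST(1)[of "14 * z" "-2" "-4"] z nome_of_int[of "-1"] by simp
qed

lemma eta4_W2_14:
  assumes z: "Im z > 0"
  shows "eta4 (14 * ((-4 * z + 1) / (14 * z - 4))) = - (7 * z - 2)\<^sup>2 * eta4 (7 * z)"
proof -
  have nz: "14 * z - 4 \<noteq> 0" "7 * z - 2 \<noteq> 0"
    using linear_nonzero[OF z, of 14 4] linear_nonzero[OF z, of 7 2] by auto
  have "14 * ((-4 * z + 1) / (14 * z - 4)) = of_int (-4) - 1 / (7 * z + of_int (-2))"
    using nz by (simp add: field_simps)
  then show ?thesis using eta4_TST(1)[of "7 * z" "-4" "-2"] z nome_of_int[of "-1"] by simp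
qed

definition eta_prod :: "complex \<Rightarrow> complex" where
  "eta_prod z = eta4 z * eta4 (2 * z) * eta4 (7 * z) * eta4 (14 * z)"

text \<open>An eta quotient of weight 0 without zeros on the half plane. The involutions at 2 and 7
  invert it, hence their product fixes it.\<close>

definition eta_unit :: "complex \<Rightarrow> complex" where
  "eta_unit z = eta4 z * eta4 (14 * z) / (eta4 (2 * z) * eta4 (7 * z))"

text \<open>Of the four multipliers two carry a minus sign, so the signs cancel in the product. In
  the unit, numerator and denominator are exchanged and collect equal factors.\<close>

lemma
  assumes z: "Im z > 0"
  shows eta_prod_W7: "eta_prod ((7 * z - 4) / (14 * z - 7)) = (14 * z - 7) ^ 8 / 7 ^ 4 * eta_prod z"
    and eta_unit_W7: "eta_unit ((7 * z - 4) / (14 * z - 7)) = inverse (eta_unit z)"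
proof -
  have nz: "14 * z - 7 \<noteq> 0" "2 * z - 1 \<noteq> 0"
    using linear_nonzero[OF z, of 14 7] linear_nonzero[OF z, of 2 1] by auto
  have "2 * z - 1 = (14 * z - 7) / 7" by (simp add: field_simps)
  then have e: "(2 * z - 1)\<^sup>2 = (14 * z - 7)\<^sup>2 / 7\<^sup>2" by (simp only: power_divide)
  show "eta_prod ((7 * z - 4) / (14 * z - 7)) = (14 * z - 7) ^ 8 / 7 ^ 4 * eta_prod z"
    unfolding eta_prod_def eta4_W7_1[OF z] eta4_W7_2[OF z] eta4_W7_7[OF z] eta4_W7_14[OF z] e
    by (simp add: power_mult[symmetric] eval_nat_numeral)
  show "eta_unit ((7 * z - 4) / (14 * z - 7)) = inverse (eta_unit z)"
    unfolding eta_unit_def eta4_W7_1[OF z] eta4_W7_2[OF z] eta4_W7_7[OF z] eta4_W7_14[OF z]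
    using nz by (simp add: mult.commute)
qed

lemma
  assumes z: "Im z > 0"
  shows eta_prod_W2: "eta_prod ((-4 * z + 1) / (14 * z - 4)) = (14 * z - 4) ^ 8 / 2 ^ 4 * eta_prod z"
    and eta_unit_W2: "eta_unit ((-4 * z + 1) / (14 * z - 4)) = inverse (eta_unit z)"
proof -
  have nz: "14 * z - 4 \<noteq> 0" "7 * z - 2 \<noteq> 0"
    using linear_nonzero[OF z, of 14 4] linear_nonzero[OF z, of 7 2] by auto
  have "7 * z - 2 = (14 * z - 4) / 2" by (simp add: field_simps)
  then have e: "(7 * z - 2)\<^sup>2 = (14 * z - 4)\<^sup>2 / 2\<^sup>2" by (simp only: power_divide)
  show "eta_prod ((-4 * z + 1) / (14 * z - 4)) = (14 * z - 4) ^ 8 / 2 ^ 4 * eta_prod z"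
    unfolding eta_prod_def eta4_W2_1[OF z] eta4_W2_2[OF z] eta4_W2_7[OF z] eta4_W2_14[OF z] e
    by (simp add: power_mult[symmetric] eval_nat_numeral)
  show "eta_unit ((-4 * z + 1) / (14 * z - 4)) = inverse (eta_unit z)"
    unfolding eta_unit_def eta4_W2_1[OF z] eta4_W2_2[OF z] eta4_W2_7[OF z] eta4_W2_14[OF z]
    using nz by (simp add: mult.commute)
qed

lemma
  assumes z: "Im z > 0"
  shows eta_prod_W14: "eta_prod (- 1 / (14 * z)) = 196\<^sup>2 * z ^ 8 * eta_prod z"
    and eta_unit_W14: "eta_unit (- 1 / (14 * z)) = eta_unit z"
proof -
  have z0: "z \<noteq> 0" using z by auto
  have e: "eta4 (- 1 / (14 * z)) = - (14 * z)\<^sup>2 * eta4 (14 * z)"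
    "eta4 (2 * (- 1 / (14 * z))) = - (7 * z)\<^sup>2 * eta4 (7 * z)"
    "eta4 (7 * (- 1 / (14 * z))) = - (2 * z)\<^sup>2 * eta4 (2 * z)"
    "eta4 (14 * (- 1 / (14 * z))) = - z\<^sup>2 * eta4 z"
    using eta4_S[of "14 * z"] eta4_S[of "7 * z"] eta4_S[of "2 * z"] eta4_S[of z] z by simp_all
  show "eta_prod (- 1 / (14 * z)) = 196\<^sup>2 * z ^ 8 * eta_prod z"
    unfolding eta_prod_def e by (simp add: power_mult_distrib eval_nat_numeral mult_ac)
  show "eta_unit (- 1 / (14 * z)) = eta_unit z"
    unfolding eta_unit_def e using z0 by (simp add: power_mult_distrib mult.commute)
qed

text \<open>The roots of unity cancel because 1 + 2 + 7 + 14 is divisible by 6 and because 1 + 14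
  and 2 + 7 differ by 6.\<close>

lemma
  shows eta_prod_plus_1: "eta_prod (z + 1) = eta_prod z"
    and eta_unit_plus_1: "eta_unit (z + 1) = eta_unit z"
proof -
  have e: "eta4 (z + 1) = nome (1/6) * eta4 z" "eta4 (2 * (z + 1)) = nome (2/6) * eta4 (2 * z)"
    "eta4 (7 * (z + 1)) = nome (7/6) * eta4 (7 * z)" "eta4 (14 * (z + 1)) = nome (14/6) * eta4 (14 * z)"
    using eta4_plus_int[of z 1] eta4_plus_int[of "2 * z" 2] eta4_plus_int[of "7 * z" 7] eta4_plus_int[of "14 * z" 14]
    by (simp_all add: distrib_left)
  have 1: "nome (1/6) * nome (2/6) * nome (7/6) * nome (14/6) = 1"
    unfolding nome_add[symmetric] using nome_of_int[of 4] by simp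
  have "nome (1/6) * nome (14/6) = nome (1 + (2/6 + 7/6))"
    unfolding nome_add[symmetric] by simp
  then have 2: "nome (1/6) * nome (14/6) = nome (2/6) * nome (7/6)"
    unfolding nome_add by simp
  have "eta_prod (z + 1) = (nome (1/6) * nome (2/6) * nome (7/6) * nome (14/6)) * eta_prod z"
    unfolding eta_prod_def e by (simp only: mult_ac)
  then show "eta_prod (z + 1) = eta_prod z" unfolding 1 by simp
  have "eta_unit (z + 1) = (nome (1/6) * nome (14/6)) / (nome (2/6) * nome (7/6)) * eta_unit z"
    unfolding eta_unit_def e by (simp only: times_divide_times_eq mult_ac)
  then show "eta_unit (z + 1) = eta_unit z" unfolding 2 by simp
qed

lemma eta_prod_nonzero: "Im z > 0 \<Longrightarrow> eta_prod z \<noteq> 0"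
  by (simp add: eta_prod_def eta4_nonzero)

lemma eta_unit_nonzero: "Im z > 0 \<Longrightarrow> eta_unit z \<noteq> 0"
  by (simp add: eta_unit_def eta4_nonzero)

lemma eta4_mult_holomorphic: "k > 0 \<Longrightarrow> (\<lambda>z. eta4 (of_real k * z)) holomorphic_on {z. Im z > 0}"
proof -
  assume k: "k > 0"
  have "(\<lambda>z. of_real k * z) holomorphic_on {z. Im z > 0}" by (intro holomorphic_intros)
  moreover have "(\<lambda>z. of_real k * z) ` {z. Im z > 0} \<subseteq> {z. Im z > 0}" using k by auto
  ultimately have "(\<lambda>z. dedekind_eta (of_real k * z)) holomorphic_on {z. Im z > 0}"
    using holomorphic_on_compose_gen[OF _ dedekind_eta_holomorphic] unfolding o_def by blast
  then show ?thesis unfolding eta4_def by (intro holomorphic_intros)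
qed

lemma
  shows eta_prod_holomorphic: "eta_prod holomorphic_on {z. Im z > 0}"
    and eta_unit_holomorphic: "eta_unit holomorphic_on {z. Im z > 0}"
proof -
  note h = eta4_mult_holomorphic[of 1] eta4_mult_holomorphic[of 2] eta4_mult_holomorphic[of 7] eta4_mult_holomorphic[of 14]
  show "eta_prod holomorphic_on {z. Im z > 0}"
    unfolding eta_prod_def using h by (intro holomorphic_intros) simp_all
  show "eta_unit holomorphic_on {z. Im z > 0}"
    unfolding eta_unit_def using h by (intro holomorphic_intros) (simp_all add: eta4_nonzero)
qed

lemma eta_prod_eq_nome: "eta_prod z = nome z ^ 4 * euler_prod (nome z) ^ 4"
proof -
  have "eta_prod z = (nome (z/24) ^ 4 * nome (2*z/24) ^ 4 * nome (7*z/24) ^ 4 * nome (14*z/24) ^ 4) * euler_prod (nome z) ^ 4"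
    by (simp add: eta_prod_def eta4_def dedekind_eta_altdef euler_prod_def euler_def power_mult_distrib nome_power)
  also have "nome (z/24) ^ 4 * nome (2*z/24) ^ 4 * nome (7*z/24) ^ 4 * nome (14*z/24) ^ 4 = nome z ^ 4"
    unfolding nome_power nome_add[symmetric] by (rule arg_cong[of _ _ nome]) simp
  finally show ?thesis .
qed

text \<open>The square root of \<open>eta_prod\<close> given by squares of eta; it is the common
  denominator of the eta quotients in the claim.\<close>

definition eta_prod_half :: "complex \<Rightarrow> complex" where
  "eta_prod_half z = (dedekind_eta z * dedekind_eta (2 * z) * dedekind_eta (7 * z) * dedekind_eta (14 * z))\<^sup>2"

lemma eta_prod_half_square: "(eta_prod_half z)\<^sup>2 = eta_prod z"
  by (simp add: eta_prod_half_def eta_prod_def eta4_def power_mult_distrib power_mult[symmetric])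

lemma eta_prod_half_eq_nome: "eta_prod_half z = nome z ^ 2 * euler_prod (nome z) ^ 2"
proof -
  have "eta_prod_half z = (nome (z/24) * nome (2*z/24) * nome (7*z/24) * nome (14*z/24)) ^ 2 * euler_prod (nome z) ^ 2"
    by (simp add: eta_prod_half_def dedekind_eta_altdef euler_prod_def euler_def power_mult_distrib nome_power)
  also have "nome (z/24) * nome (2*z/24) * nome (7*z/24) * nome (14*z/24) = nome z"
    unfolding nome_add[symmetric] by (rule arg_cong[of _ _ nome]) simp
  finally show ?thesis .
qed

lemma form_quot_eq_eta:
  "nome z * form_quot s (nome z) = ((eta4 (2 * z) * eta4 (7 * z))\<^sup>2 - s * (eta4 z * eta4 (14 * z))\<^sup>2
     - (2 - 2 * s) * eta_prod z) / eta_prod_half z"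
proof -
  define q where "q = nome z"
  have a: "(eta4 (2 * z) * eta4 (7 * z))\<^sup>2 = q ^ 3 * (euler (q ^ 2) * euler (q ^ 7)) ^ 8"
  proof -
    have "(eta4 (2 * z) * eta4 (7 * z))\<^sup>2 = (nome (2*z/24) ^ 8 * nome (7*z/24) ^ 8) * (euler (q ^ 2) * euler (q ^ 7)) ^ 8"
      by (simp add: eta4_def dedekind_eta_altdef euler_def q_def power_mult_distrib nome_power[of z] power_mult[symmetric])
    also have "nome (2*z/24) ^ 8 * nome (7*z/24) ^ 8 = q ^ 3"
      unfolding nome_power nome_add[symmetric] q_def by (rule arg_cong[of _ _ nome]) simp
    finally show ?thesis .
  qed
  have b: "(eta4 z * eta4 (14 * z))\<^sup>2 = q ^ 5 * (euler q * euler (q ^ 14)) ^ 8"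
  proof -
    have "(eta4 z * eta4 (14 * z))\<^sup>2 = (nome (z/24) ^ 8 * nome (14*z/24) ^ 8) * (euler q * euler (q ^ 14)) ^ 8"
      by (simp add: eta4_def dedekind_eta_altdef euler_def q_def power_mult_distrib nome_power[of z] power_mult[symmetric])
    also have "nome (z/24) ^ 8 * nome (14*z/24) ^ 8 = q ^ 5"
      unfolding nome_power nome_add[symmetric] q_def by (rule arg_cong[of _ _ nome]) simp
    finally show ?thesis .
  qed
  have q0: "q \<noteq> 0" by (simp add: q_def)
  define X where "X = (euler (q ^ 2) * euler (q ^ 7)) ^ 8 - s * q ^ 2 * (euler q * euler (q ^ 14)) ^ 8 - (2 - 2 * s) * q * euler_prod q ^ 4"
  have "q ^ 3 * (euler (q ^ 2) * euler (q ^ 7)) ^ 8 - s * (q ^ 5 * (euler q * euler (q ^ 14)) ^ 8)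
     - (2 - 2 * s) * (q ^ 4 * euler_prod q ^ 4) = q ^ 3 * X"
    unfolding X_def by (simp add: algebra_simps eval_nat_numeral)
  moreover have "q ^ 3 * X / (q ^ 2 * euler_prod q ^ 2) = q * (X / euler_prod q ^ 2)"
    using q0 by (simp add: eval_nat_numeral)
  ultimately show ?thesis
    unfolding a b eta_prod_eq_nome eta_prod_half_eq_nome q_def[symmetric] form_quot_def X_def[symmetric]
    by simp
qed

text \<open>The claimed form divided by \<open>eta_prod_half\<close>, a polynomial in the unit and
  its inverse.\<close>

definition eta_combination :: "complex \<Rightarrow> complex \<Rightarrow> complex" where
  "eta_combination s z = inverse (eta_unit z) - s * eta_unit z - (2 - 2 * s)"

lemma form_quot_square:
  assumes z: "Im z > 0"
  shows "(nome z * form_quot s (nome z))\<^sup>2 = (eta_combination s z)\<^sup>2 * eta_prod z"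
proof -
  define a b where "a = eta4 (2 * z) * eta4 (7 * z)" and "b = eta4 z * eta4 (14 * z)"
  have nz: "a \<noteq> 0" "b \<noteq> 0" using z by (simp_all add: a_def b_def eta4_nonzero)
  have p: "eta_prod z = a * b" by (simp add: eta_prod_def a_def b_def)
  have u: "eta_unit z = b / a" by (simp add: eta_unit_def a_def b_def)
  have N: "eta_combination s z = (a\<^sup>2 - s * b\<^sup>2 - (2 - 2 * s) * (a * b)) / (a * b)"
    unfolding eta_combination_def u using nz by (simp add: field_simps power2_eq_square)
  have "(nome z * form_quot s (nome z))\<^sup>2 = (a\<^sup>2 - s * b\<^sup>2 - (2 - 2 * s) * (a * b))\<^sup>2 / (a * b)"
    unfolding form_quot_eq_eta power_divide eta_prod_half_square p unfolding a_def b_def ..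
  then show ?thesis unfolding N p using nz by (simp add: power2_eq_square)
qed

text \<open>Inverting the unit u changes the sign of 1/u - u for s = 1 and preserves 1/u + u - 4 for
  s = -1; the square is the same in both cases.\<close>

lemma eta_combination_inverse_square:
  assumes "s = 1 \<or> s = -1" "eta_unit w = inverse (eta_unit z)"
  shows "(eta_combination s w)\<^sup>2 = (eta_combination s z)\<^sup>2"
  using assms by (auto simp: eta_combination_def power2_eq_square algebra_simps)

lemma eval_fps_tendsto_shift2:
  fixes F :: "complex fps"
  assumes G: "G has_fps_expansion F" and 0: "fps_nth F 0 = 0" "fps_nth F 1 = 0" and nz: "F \<noteq> 0"
  shows "((\<lambda>q. G q / q ^ 2) \<longlongrightarrow> fps_nth F 2) (at 0)"
proof -
  have "2 \<le> subdegree F"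
  proof (rule subdegree_geI[OF nz])
    fix i :: nat assume "i < 2"
    then have "i = 0 \<or> i = 1" by auto
    with 0 show "fps_nth F i = 0" by auto
  qed
  from has_fps_expansion_shift[OF G this refl]
  have "isCont (\<lambda>x. if x = 0 then fps_nth F 2 else G x / x ^ 2) 0"
    by (rule has_fps_expansion_imp_continuous)
  then have "(\<lambda>x. if x = 0 then fps_nth F 2 else G x / x ^ 2) \<midarrow>0\<rightarrow> fps_nth F 2"
    by (simp add: isCont_def)
  then show ?thesis
    by (rule Lim_transform_eventually) (auto simp: eventually_at_filter)
qed

section \<open>The invariant function comparing the squares of f and t\<close>

context level14_form
begin

lemma f_square_W2: "Im z > 0 \<Longrightarrow> (f (W2 z))\<^sup>2 = (14 * z - 4) ^ 8 / 2 ^ 4 * (f z)\<^sup>2"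
  using s by (auto simp: f_W2 power_mult_distrib power_mult[symmetric] power_divide)

text \<open>\<open>mu_square\<close> needs a point where f does not vanish; at a zero of f both
  sides are 0.\<close>

lemma f_square_W7: "Im z > 0 \<Longrightarrow> (f (W7 z))\<^sup>2 = (14 * z - 7) ^ 8 / 7 ^ 4 * (f z)\<^sup>2"
proof (cases "f z = 0")
  case False
  assume z: "Im z > 0"
  have "(f (W7 z))\<^sup>2 = \<mu>\<^sup>2 * ((14 * z - 7) ^ 8 / 7 ^ 4 * (f z)\<^sup>2)"
    by (simp add: f_W7[OF z] power_mult_distrib power_mult[symmetric] power_divide)
  then show ?thesis by (simp add: mu_square[OF z False])
qed (simp add: f_W7)

lemma f_square_W14:
  assumes z: "Im z > 0"
  shows "(f (- 1 / (14 * z)))\<^sup>2 = 196\<^sup>2 * z ^ 8 * (f z)\<^sup>2"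
proof (cases "f z = 0")
  case True
  then show ?thesis unfolding f_W14[OF z] by simp
next
  case False
  have "(f (- 1 / (14 * z)))\<^sup>2 = s\<^sup>2 * \<mu>\<^sup>2 * (196\<^sup>2 * z ^ 8 * (f z)\<^sup>2)"
    unfolding f_W14[OF z] by (simp add: power_mult_distrib power_mult[symmetric])
  moreover have "s\<^sup>2 = 1" using s by auto
  ultimately show ?thesis by (simp add: mu_square[OF z False])
qed

definition \<Phi> where "\<Phi> z = (f z)\<^sup>2 / eta_prod z - (eta_combination s z)\<^sup>2"

lemma Phi_W2:
  assumes z: "Im z > 0"
  shows "\<Phi> (W2 z) = \<Phi> z"
proof -
  have "(14 * z - 4) ^ 8 / 2 ^ 4 \<noteq> 0" using linear_nonzero(2)[OF z, of 14 4] by simp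
  from mult_divide_mult_cancel_left[OF this, of "(f z)\<^sup>2" "eta_prod z"] show ?thesis
    using eta_combination_inverse_square[OF s eta_unit_W2[OF z]]
    unfolding \<Phi>_def f_square_W2[OF z] unfolding W2_def eta_prod_W2[OF z] by simp
qed

lemma Phi_W7:
  assumes z: "Im z > 0"
  shows "\<Phi> (W7 z) = \<Phi> z"
proof -
  have "(14 * z - 7) ^ 8 / 7 ^ 4 \<noteq> 0" using linear_nonzero(2)[OF z, of 14 7] by simp
  from mult_divide_mult_cancel_left[OF this, of "(f z)\<^sup>2" "eta_prod z"] show ?thesis
    using eta_combination_inverse_square[OF s eta_unit_W7[OF z]]
    unfolding \<Phi>_def f_square_W7[OF z] unfolding W7_def eta_prod_W7[OF z] by simp
qed

lemma Phi_W14: "Im z > 0 \<Longrightarrow> \<Phi> (- 1 / (14 * z)) = \<Phi> z"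
  using f_square_W14[of z] eta_prod_W14[of z] eta_unit_W14[of z]
  by (auto simp: \<Phi>_def eta_combination_def)

lemma Phi_plus_1: "Im z > 0 \<Longrightarrow> \<Phi> (z + 1) = \<Phi> z"
  by (simp add: \<Phi>_def eta_combination_def f_plus_1 eta_prod_plus_1 eta_unit_plus_1)

lemma Phi_holomorphic: "\<Phi> holomorphic_on {z. Im z > 0}"
  unfolding \<Phi>_def eta_combination_def
  by (intro holomorphic_intros hol eta_prod_holomorphic eta_unit_holomorphic)
     (auto simp: eta_prod_nonzero eta_unit_nonzero)

text \<open>The maps with matrices W14, W2, its inverse, W7 and W7 T have their poles at 0, 2/7,
  -2/7, 1/2 and -1/2. The discs around these points in which they raise heights by 21/20 cover the
  strip below height 1/20; the cuts at 1/4 and 35/100 divide it among them.\<close>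

lemma Phi_step:
  assumes z: "0 < Im z" "Im z < 1/20" "\<bar>Re z\<bar> \<le> 1/2"
  shows "\<exists>z'. Im z' \<ge> 21/20 * Im z \<and> \<Phi> z' = \<Phi> z"
proof -
  have Im_div: "Im ((of_real a * w + of_real b) / (14 * w + of_real d)) = (a * d - b * 14) * Im w / ((14 * Re w + d)\<^sup>2 + 196 * (Im w)\<^sup>2)"
    for a b d :: real and w
    by (simp add: Im_divide power_mult_distrib algebra_simps)
  have y2: "196 * (Im z)\<^sup>2 \<le> 49/100"
    using power_mono[of "Im z" "1/20" 2] z by (simp add: power2_eq_square)
  have bound: "21/20 * Im z \<le> k * Im z / ((14 * x)\<^sup>2 + 196 * (Im z)\<^sup>2)"
    if "\<bar>x\<bar> \<le> r" "21/20 * (196 * r\<^sup>2 + 49/100) \<le> k" for k x r :: real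
  proof -
    have "x\<^sup>2 \<le> r\<^sup>2" using that(1) by (simp add: abs_le_square_iff[symmetric])
    then have le: "(14 * x)\<^sup>2 + 196 * (Im z)\<^sup>2 \<le> 196 * r\<^sup>2 + 49/100"
      using y2 by (simp add: power_mult_distrib)
    have "21/20 * ((14 * x)\<^sup>2 + 196 * (Im z)\<^sup>2) \<le> 21/20 * (196 * r\<^sup>2 + 49/100)"
      by (rule mult_left_mono[OF le]) simp
    then have "21/20 * ((14 * x)\<^sup>2 + 196 * (Im z)\<^sup>2) \<le> k"
      using that(2) by (rule order_trans)
    moreover have "(14 * x)\<^sup>2 + 196 * (Im z)\<^sup>2 > 0" using z by (intro add_nonneg_pos) auto
    ultimately have "21/20 \<le> k / ((14 * x)\<^sup>2 + 196 * (Im z)\<^sup>2)" by (simp add: field_simps)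
    from mult_right_mono[OF this, of "Im z"] z show ?thesis by simp
  qed
  consider "\<bar>Re z\<bar> \<le> 1/4" | "1/4 \<le> Re z" "Re z \<le> 35/100" | "- 35/100 \<le> Re z" "Re z \<le> -1/4" | "35/100 \<le> Re z" | "Re z \<le> - 35/100"
    by linarith
  then show ?thesis
  proof cases
    case 1
    have "Im (- 1 / (14 * z)) = 14 * Im z / ((14 * Re z)\<^sup>2 + 196 * (Im z)\<^sup>2)"
      using Im_div[of 0 z "-1" 0] by simp
    moreover have "21/20 * Im z \<le> 14 * Im z / ((14 * Re z)\<^sup>2 + 196 * (Im z)\<^sup>2)"
      by (rule bound[where r = "1/4"]) (use 1 in \<open>simp_all add: power2_eq_square\<close>)
    ultimately show ?thesis using Phi_W14[OF z(1)] by metis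
  next
    case 2
    have "Im (W2 z) = 2 * Im z / ((14 * (Re z - 2/7))\<^sup>2 + 196 * (Im z)\<^sup>2)"
      using Im_div[of "-4" z 1 "-4"] by (simp add: W2_def)
    moreover have "21/20 * Im z \<le> 2 * Im z / ((14 * (Re z - 2/7))\<^sup>2 + 196 * (Im z)\<^sup>2)"
    proof (rule bound[where r = "9/140"])
      show "\<bar>Re z - 2/7\<bar> \<le> 9/140" using 2 by linarith
    qed (simp add: power2_eq_square)
    ultimately show ?thesis using Phi_W2[OF z(1)] by metis
  next
    case 3
    \<comment> \<open>The preimage of z under W2, so invariance is applied at z' instead of
      z.\<close>
    define z' where "z' = (4 * z + 1) / (14 * z + 4)"
    have nz: "14 * z + 4 \<noteq> 0" using linear_nonzero[OF z(1), of 14 4] by simp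
    have "Im z' = 2 * Im z / ((14 * (Re z + 2/7))\<^sup>2 + 196 * (Im z)\<^sup>2)"
      using Im_div[of 4 z 1 4] by (simp add: z'_def)
    moreover have "21/20 * Im z \<le> 2 * Im z / ((14 * (Re z + 2/7))\<^sup>2 + 196 * (Im z)\<^sup>2)"
    proof (rule bound[where r = "9/140"])
      show "\<bar>Re z + 2/7\<bar> \<le> 9/140" using 3 by linarith
    qed (simp add: power2_eq_square)
    ultimately have le: "21/20 * Im z \<le> Im z'" by simp
    have "14 * z' - 4 = - 2 / (14 * z + 4)" "- 4 * z' + 1 = - (2 * z) / (14 * z + 4)"
      unfolding z'_def using nz by (simp_all add: field_simps)
    then have "W2 z' = z" unfolding W2_def using nz by simp
    moreover have "Im z' > 0" using le z by linarith
    ultimately show ?thesis using Phi_W2[of z'] le by metis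
  next
    case 4
    have "Im (W7 z) = 7 * Im z / ((14 * (Re z - 1/2))\<^sup>2 + 196 * (Im z)\<^sup>2)"
      using Im_div[of 7 z "-4" "-7"] by (simp add: W7_def)
    moreover have "21/20 * Im z \<le> 7 * Im z / ((14 * (Re z - 1/2))\<^sup>2 + 196 * (Im z)\<^sup>2)"
    proof (rule bound[where r = "15/100"])
      show "\<bar>Re z - 1/2\<bar> \<le> 15/100" using 4 z(3) by linarith
    qed (simp add: power2_eq_square)
    ultimately show ?thesis using Phi_W7[OF z(1)] by metis
  next
    case 5
    have "Im (W7 (z + 1)) = 7 * Im z / ((14 * (Re z + 1/2))\<^sup>2 + 196 * (Im z)\<^sup>2)"
      using Im_div[of 7 "z + 1" "-4" "-7"] by (simp add: W7_def add.commute)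
    moreover have "21/20 * Im z \<le> 7 * Im z / ((14 * (Re z + 1/2))\<^sup>2 + 196 * (Im z)\<^sup>2)"
    proof (rule bound[where r = "15/100"])
      show "\<bar>Re z + 1/2\<bar> \<le> 15/100" using 5 z(3) by linarith
    qed (simp add: power2_eq_square)
    ultimately show ?thesis using Phi_W7[of "z + 1"] Phi_plus_1[OF z(1)] z by (metis add.right_neutral one_complex.sel(2) plus_complex.sel(2))
  qed
qed

lemma Phi_eq_limit:
  assumes "(\<Phi> \<longlongrightarrow> C) (filtercomap Im at_top)" "Im z > 0"
  shows "\<Phi> z = C"
  by (rule invariant_holomorphic_eq_limit[OF Phi_holomorphic Phi_plus_1 assms(1), of "1/20" "21/20"])
     (use Phi_step assms in auto)

end

section \<open>Identification of the newforms\<close>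

lemma nome_surj:
  assumes "q \<noteq> 0" "norm q < 1"
  obtains z where "Im z > 0" "nome z = q"
proof
  show n: "nome (Ln q / (2 * of_real pi * \<i>)) = q" using assms by (simp add: nome_def)
  show "Im (Ln q / (2 * of_real pi * \<i>)) > 0"
    using norm_nome_less_1[of "Ln q / (2 * of_real pi * \<i>)"] n assms by simp
qed

lemma q_expansion_sums: "has_q_expansion f a \<Longrightarrow> Im z > 0 \<Longrightarrow> (\<lambda>n. a n * nome z ^ n) sums f z"
  by (simp add: has_q_expansion_def upper_half_plane_def)

lemma q_expansion_conv_radius:
  assumes "has_q_expansion f a"
  shows "fps_conv_radius (Abs_fps a) \<ge> 1"
  unfolding fps_conv_radius_def
proof (rule conv_radius_geI_ex')
  fix r :: real assume r: "0 < r" "ereal r < 1"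
  then obtain z where "Im z > 0" "nome z = of_real r" by (elim nome_surj[rotated 2]) auto
  then show "summable (\<lambda>n. fps_nth (Abs_fps a) n * of_real r ^ n)"
    using q_expansion_sums[OF assms, of z] by (simp add: sums_iff)
qed

lemma eval_q_expansion:
  assumes "has_q_expansion f a" "Im z > 0"
  shows "eval_fps (Abs_fps a) (nome z) = f z"
  using q_expansion_sums[OF assms] by (simp add: eval_fps_def sums_iff)

lemma q_expansion_has_fps_expansion:
  assumes "has_q_expansion f a"
  shows "eval_fps (Abs_fps a) has_fps_expansion Abs_fps a"
proof (rule eval_fps_has_fps_expansion)
  show "fps_conv_radius (Abs_fps a) > 0"
    using q_expansion_conv_radius[OF assms] less_le_trans[of 0 "1::ereal"] by simp
qed

text \<open>Needed because \<open>newforms\<close> provides some expansion with a 1 = 1, while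
  another one is given. The values of \<open>nome\<close> omit 0, so agreement at q = 0 comes from
  continuity.\<close>

lemma q_expansion_unique:
  assumes a: "has_q_expansion f a"
    and b: "has_q_expansion f b"
  shows "a = b"
proof -
  note A = q_expansion_has_fps_expansion[OF a] and B = q_expansion_has_fps_expansion[OF b]
  have "eventually (\<lambda>q. eval_fps (Abs_fps a) q = eval_fps (Abs_fps b) q) (at 0)"
  proof -
    have "eventually (\<lambda>q::complex. q \<in> ball 0 1) (at 0)"
      by (intro eventually_at_in_open') auto
    moreover have "eventually (\<lambda>q::complex. q \<noteq> 0) (at 0)" by (simp add: eventually_at_filter)
    ultimately show ?thesis
    proof eventually_elim
      case (elim q)
      then obtain z where "Im z > 0" "nome z = q" by (elim nome_surj[rotated 2]) auto
      then show ?case using eval_q_expansion[OF a, of z] eval_q_expansion[OF b, of z] by simp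
    qed
  qed
  note ev = this
  have "isCont (eval_fps (Abs_fps a)) 0" "isCont (eval_fps (Abs_fps b)) 0"
    using has_fps_expansion_imp_continuous[OF A] has_fps_expansion_imp_continuous[OF B] by simp_all
  then have lim: "eval_fps (Abs_fps a) \<midarrow>0\<rightarrow> eval_fps (Abs_fps a) 0" "eval_fps (Abs_fps b) \<midarrow>0\<rightarrow> eval_fps (Abs_fps b) 0"
    by (simp_all add: isCont_def)
  have "eval_fps (Abs_fps a) 0 = eval_fps (Abs_fps b) 0"
    by (rule LIM_unique[OF Lim_transform_eventually[OF lim(1) ev] lim(2)])
  with \<open>eventually (\<lambda>q. eval_fps (Abs_fps a) q = eval_fps (Abs_fps b) q) (at 0)\<close>
  have "eventually (\<lambda>q. eval_fps (Abs_fps a) q = eval_fps (Abs_fps b) q) (nhds 0)"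
    by (auto simp: eventually_at_filter elim: eventually_mono)
  with A have "eval_fps (Abs_fps b) has_fps_expansion Abs_fps a"
    by (rule has_fps_expansion_eventually_eq)
  then have "Abs_fps a = Abs_fps b" using B by (rule fps_expansion_unique_complex)
  then show ?thesis by (metis fps_nth_Abs_fps ext)
qed

lemma q_expansion_nth_0:
  assumes a: "has_q_expansion f a"
    and lim: "(f \<longlongrightarrow> 0) (filtercomap Im at_top)"
  shows "a 0 = 0"
proof -
  have "isCont (eval_fps (Abs_fps a)) 0"
    using has_fps_expansion_imp_continuous[OF q_expansion_has_fps_expansion[OF a]] by simp
  then have "eval_fps (Abs_fps a) \<midarrow>0\<rightarrow> a 0"
    by (simp add: isCont_def eval_fps_at_0)
  from filterlim_compose[OF this filterlim_nome_at_0]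
  have "((\<lambda>z. eval_fps (Abs_fps a) (nome z)) \<longlongrightarrow> a 0) (filtercomap Im at_top)" .
  moreover have "eventually (\<lambda>z. eval_fps (Abs_fps a) (nome z) = f z) (filtercomap Im at_top)"
    using eventually_Im_greater[of 0] by eventually_elim (simp add: eval_q_expansion[OF a])
  ultimately have "(f \<longlongrightarrow> a 0) (filtercomap Im at_top)"
    by (rule Lim_transform_eventually)
  then show ?thesis using lim by (rule tendsto_unique[OF filtercomap_Im_neq_bot])
qed

text \<open>For z = 2y and w = \<open>nome y\<close> the relation reads A(w) + A(-w) = c A(w^2); the
  coefficients of w^2 and w^4 give the two claims.\<close>

lemma q_expansion_U2:
  assumes a: "has_q_expansion f a" and a0: "a 0 = 0"
    and U: "\<And>z. Im z > 0 \<Longrightarrow> f (z / 2) + f ((z + 1) / 2) = c * f z"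
  shows "2 * a 2 = c * a 1" "2 * a 4 = c * a 2"
proof -
  define A where "A = Abs_fps a"
  note F = q_expansion_has_fps_expansion[OF a, folded A_def]
  have n: "(\<lambda>w::complex. - 1 * w) has_fps_expansion fps_const (- 1) * fps_X"
    by (intro fps_expansion_intros)
  have sq: "(\<lambda>w::complex. w ^ 2) has_fps_expansion fps_X ^ 2"
    by (intro fps_expansion_intros)
  have 1: "(\<lambda>w. eval_fps A w + eval_fps A (- w)) has_fps_expansion A + fps_compose A (fps_const (- 1) * fps_X)"
    using has_fps_expansion_add[OF F has_fps_expansion_compose[OF F n]] by (simp add: o_def)
  have 2: "(\<lambda>w. c * eval_fps A (w ^ 2)) has_fps_expansion fps_const c * fps_compose A (fps_X ^ 2)"
    using has_fps_expansion_cmult_left[OF has_fps_expansion_compose[OF F sq], of c] by (simp add: o_def)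
  have "eventually (\<lambda>w. eval_fps A w + eval_fps A (- w) = c * eval_fps A (w ^ 2)) (nhds 0)"
  proof -
    have "eventually (\<lambda>w::complex. w \<in> ball 0 1) (nhds 0)" by (intro eventually_nhds_in_open) auto
    then show ?thesis
    proof eventually_elim
      case (elim w)
      show ?case
      proof (cases "w = 0")
        case True
        then show ?thesis using a0 by (simp add: eval_fps_at_0 A_def)
      next
        case False
        then obtain y where y: "Im y > 0" "nome y = w" using elim by (elim nome_surj) auto
        have e: "(2 * y + 1) / 2 = y + 1 / 2" by (simp add: add_divide_distrib)
        have "nome ((2 * y + 1) / 2) = - w" unfolding e nome_add using y(2) by simp
        moreover have "nome (2 * y) = w ^ 2" using nome_power[of y 2] y(2) by simp
        ultimately show ?thesis
          using U[of "2 * y"] y eval_q_expansion[OF a, of y] eval_q_expansion[OF a, of "(2 * y + 1) / 2"]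
            eval_q_expansion[OF a, of "2 * y"]
          by (simp add: A_def)
      qed
    qed
  qed
  from has_fps_expansion_eventually_eq[OF 1 this] have eq: "A + fps_compose A (fps_const (- 1) * fps_X) = fps_const c * fps_compose A (fps_X ^ 2)"
    using 2 by (rule fps_expansion_unique_complex)
  have "fps_nth (fps_compose A (fps_X ^ 2)) 4 = fps_nth A 2"
    unfolding fps_compose_nth power_mult[symmetric] fps_X_power_nth
    by (simp add: eval_nat_numeral sum.atLeast0_atMost_Suc)
  then show "2 * a 4 = c * a 2"
    using arg_cong[OF eq, of "\<lambda>F. fps_nth F 4"] unfolding fps_add_nth fps_nth_compose_linear by (simp add: A_def)
  show "2 * a 2 = c * a 1"
    using arg_cong[OF eq, of "\<lambda>F. fps_nth F 2"] unfolding fps_add_nth fps_nth_compose_linear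
    by (simp add: A_def fps_compose_X_power_nth_0_3)
qed

context level14_form
begin

lemma f_eq_form_quot:
  assumes a: "has_q_expansion f a"
    and a1: "a 1 = 1" and a2: "a 2 = 2 * s" and a4: "a 4 = 4"
    and z: "Im z > 0"
  shows "f z = nome z * form_quot s (nome z)"
proof -
  have a0: "a 0 = 0" by (rule q_expansion_nth_0[OF a f_tendsto_0])
  \<comment> \<open>Dividing by q makes the expansion start with 1, so its coefficients are those of
    f moved down by one index.\<close>
  define b where "b n = a (Suc n)" for n
  have "(\<lambda>n. b n * nome z ^ n) sums (f z / nome z)" if "Im z > 0" for z
  proof -
    have "(\<lambda>n. a (Suc n) * nome z ^ Suc n) sums f z"
      using sums_Suc_iff[of "\<lambda>n. a n * nome z ^ n"] q_expansion_sums[OF a that] a0 by simp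
    from sums_divide[OF this, of "nome z"] show ?thesis by (simp add: b_def)
  qed
  then have b: "has_q_expansion (\<lambda>z. f z / nome z) b"
    by (simp add: has_q_expansion_def upper_half_plane_def)
  define \<psi> where "\<psi> = Abs_fps b"
  note F = q_expansion_has_fps_expansion[OF b, folded \<psi>_def]
  note ev = eval_q_expansion[OF b, folded \<psi>_def]
  have hol\<psi>: "eval_fps \<psi> holomorphic_on ball 0 1"
  proof (rule holomorphic_on_subset[OF holomorphic_on_eval_fps[OF subset_refl]])
    show "ball 0 1 \<subseteq> eball 0 (fps_conv_radius \<psi>)"
      using q_expansion_conv_radius[OF b] unfolding \<psi>_def
      by (intro ball_eball_mono) (simp add: one_ereal_def)
  qed
  obtain p \<tau> where p: "euler_prod has_fps_expansion p" and \<tau>: "form_quot s has_fps_expansion \<tau>"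
    and p_nth: "fps_nth (p ^ 4) 0 = 1" "fps_nth (p ^ 4) 1 = -4"
    and \<tau>_nth: "fps_nth \<tau> 0 = 1" "fps_nth \<tau> 1 = 2 * s" "fps_nth \<tau> 3 = 4"
    by (rule euler_prod_form_quot_expansions[OF s])
  have \<psi>_nth: "fps_nth \<psi> 0 = 1" "fps_nth \<psi> 1 = 2 * s" "fps_nth \<psi> 3 = 4"
    using a1 a2 a4 by (simp_all add: \<psi>_def b_def eval_nat_numeral)
  \<comment> \<open>The expansion of (f^2 - t^2)/q^2; its coefficients 2 and 3 belong to q^4 and q^5
    in f^2 - t^2.\<close>
  define M where "M = \<psi> * \<psi> - \<tau> * \<tau>"
  define x where "x = fps_nth \<psi> 2 - fps_nth \<tau> 2"
  have M_nth: "fps_nth M 0 = 0" "fps_nth M 1 = 0" "fps_nth M 2 = 2 * x" "fps_nth M 3 = 4 * s * x"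
    using \<psi>_nth \<tau>_nth unfolding M_def x_def fps_sub_nth One_nat_def fps_mult_nth_0_3
    by (simp_all add: algebra_simps)
  have Mexp: "(\<lambda>q. eval_fps \<psi> q * eval_fps \<psi> q - form_quot s q * form_quot s q) has_fps_expansion M"
    unfolding M_def by (intro fps_expansion_intros F \<tau>)
  have \<Phi>_q: "\<Phi> z = (eval_fps \<psi> (nome z) * eval_fps \<psi> (nome z) - form_quot s (nome z) * form_quot s (nome z)) / nome z ^ 2 / euler_prod (nome z) ^ 4"
    if z: "Im z > 0" for z
  proof -
    have "\<Phi> z = ((f z)\<^sup>2 - (nome z * form_quot s (nome z))\<^sup>2) / eta_prod z"
      using eta_prod_nonzero[OF z] form_quot_square[OF z, of s] by (simp add: \<Phi>_def diff_divide_distrib)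
    also have "f z = nome z * eval_fps \<psi> (nome z)" using ev[OF z] by simp
    finally show ?thesis
      unfolding eta_prod_eq_nome power_mult_distrib right_diff_distrib[symmetric]
      by (simp add: power2_eq_square eval_nat_numeral)
  qed
  have "M = 0"
  proof (rule ccontr)
    assume M0: "M \<noteq> 0"
    define C where "C = fps_nth M 2"
    have "((\<lambda>z. (eval_fps \<psi> (nome z) * eval_fps \<psi> (nome z) - form_quot s (nome z) * form_quot s (nome z)) / nome z ^ 2) \<longlongrightarrow> C) (filtercomap Im at_top)"
      using filterlim_compose[OF eval_fps_tendsto_shift2[OF Mexp M_nth(1,2) M0] filterlim_nome_at_0] by (simp add: C_def)
    moreover have "((\<lambda>z. euler_prod (nome z) ^ 4) \<longlongrightarrow> 1) (filtercomap Im at_top)"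
      unfolding euler_prod_def
      using euler_nome_tendsto[of 1] euler_nome_tendsto[of 2] euler_nome_tendsto[of 7] euler_nome_tendsto[of 14]
      by (auto intro!: tendsto_eq_intros)
    ultimately have "((\<lambda>z. (eval_fps \<psi> (nome z) * eval_fps \<psi> (nome z) - form_quot s (nome z) * form_quot s (nome z)) / nome z ^ 2
       / euler_prod (nome z) ^ 4) \<longlongrightarrow> C / 1) (filtercomap Im at_top)"
      by (intro tendsto_divide) auto
    moreover have "eventually (\<lambda>z. (eval_fps \<psi> (nome z) * eval_fps \<psi> (nome z) - form_quot s (nome z) * form_quot s (nome z)) / nome z ^ 2
       / euler_prod (nome z) ^ 4 = \<Phi> z) (filtercomap Im at_top)"
      using eventually_Im_greater[of 0] by eventually_elim (simp add: \<Phi>_q)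
    ultimately have "(\<Phi> \<longlongrightarrow> C / 1) (filtercomap Im at_top)" by (rule Lim_transform_eventually)
    then have \<Phi>C: "\<Phi> z = C" if "Im z > 0" for z using Phi_eq_limit[of C] that by simp
    have "(\<lambda>q. C * (q ^ 2 * euler_prod q ^ 4)) has_fps_expansion fps_const C * (fps_X ^ 2 * p ^ 4)"
      by (intro fps_expansion_intros p)
    moreover have "eventually (\<lambda>q. C * (q ^ 2 * euler_prod q ^ 4) = eval_fps \<psi> q * eval_fps \<psi> q - form_quot s q * form_quot s q) (nhds 0)"
    proof -
      have "eventually (\<lambda>q::complex. q \<in> ball 0 1) (nhds 0)" by (intro eventually_nhds_in_open) auto
      then show ?thesis
      proof eventually_elim
        case (elim q)
        show ?case
        proof (cases "q = 0")
          case True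
          have "eval_fps \<psi> 0 = 1" "form_quot s 0 = 1"
            using \<psi>_nth(1) \<tau>_nth(1) \<tau> by (simp_all add: eval_fps_at_0 has_fps_expansion_imp_0_eq_fps_nth_0)
          then show ?thesis using True by simp
        next
          case False
          then obtain z where z: "Im z > 0" "nome z = q" using elim by (elim nome_surj) auto
          have "euler_prod q \<noteq> 0" using elim by (simp add: euler_prod_nonzero)
          then show ?thesis using \<Phi>_q[OF z(1)] \<Phi>C[OF z(1)] False unfolding z(2) by (simp add: field_simps)
        qed
      qed
    qed
    ultimately have "(\<lambda>q. eval_fps \<psi> q * eval_fps \<psi> q - form_quot s q * form_quot s q) has_fps_expansion fps_const C * (fps_X ^ 2 * p ^ 4)"
      by (rule has_fps_expansion_eventually_eq)
    with Mexp have "M = fps_const C * (fps_X ^ 2 * p ^ 4)" by (rule fps_expansion_unique_complex)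
    then have MC: "M = fps_X ^ 2 * (fps_const C * p ^ 4)" by (simp add: mult_ac)
    \<comment> \<open>p^4 = 1 - 4q + ..., so coefficients 2 and 3 of M are C and -4 C. They are also
      2x and 4 s x, whence (s + 2) x = 0.\<close>
    have "fps_nth M 3 = - 4 * C"
      unfolding MC fps_X_power_mult_nth using p_nth by simp
    then have "4 * s * x = - 4 * (2 * x)" using M_nth by (simp add: C_def)
    then have "(s + 2) * x = 0" by (simp add: algebra_simps)
    moreover have "s + 2 \<noteq> 0" using s by auto
    ultimately have "C = 0" using M_nth by (simp add: C_def)
    with MC M0 show False by simp
  qed
  then have "(\<psi> - \<tau>) * (\<psi> + \<tau>) = 0" by (simp add: M_def algebra_simps)
  \<comment> \<open>The sum has constant term 2, which selects the root +t of f^2 = t^2.\<close>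
  moreover have "fps_nth (\<psi> + \<tau>) 0 \<noteq> 0" using \<psi>_nth \<tau>_nth by simp
  then have "\<psi> + \<tau> \<noteq> 0" by (metis fps_zero_nth)
  ultimately have "\<psi> - \<tau> = 0" by simp
  have "(\<lambda>q. eval_fps \<psi> q - form_quot s q) has_fps_expansion \<psi> - \<tau>"
    by (intro fps_expansion_intros F \<tau>)
  then have "(\<lambda>q. eval_fps \<psi> q - form_quot s q) has_fps_expansion 0"
    unfolding \<open>\<psi> - \<tau> = 0\<close> .
  then have "eval_fps \<psi> (nome z) - form_quot s (nome z) = 0"
    by (rule has_fps_expansion_0_analytic_continuation[where A = "ball 0 1"])
       (use z in \<open>auto intro!: holomorphic_intros hol\<psi> form_quot_holomorphic\<close>)
  then show ?thesis using ev[OF z] by (simp add: field_simps)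
qed

end

lemma power_quotient_cancel:
  fixes x :: "'a::field"
  assumes "x \<noteq> 0"
  shows "(x ^ 4)\<^sup>2 / (x * y)\<^sup>2 = x ^ 6 / y\<^sup>2"
proof -
  have "(x ^ 4)\<^sup>2 = x\<^sup>2 * x ^ 6" by (simp flip: power_add power_mult)
  then show ?thesis unfolding power_mult_distrib[of x y]
    using mult_divide_mult_cancel_left[of "x\<^sup>2" "x ^ 6" "y\<^sup>2"] assms by simp
qed

lemma form_quot_eta:
  assumes z: "Im z > 0"
  shows "nome z * form_quot s (nome z) =
    dedekind_eta (2 * z) ^ 6 * dedekind_eta (7 * z) ^ 6 / (dedekind_eta z ^ 2 * dedekind_eta (14 * z) ^ 2)
    - s * (dedekind_eta z ^ 6 * dedekind_eta (14 * z) ^ 6 / (dedekind_eta (2 * z) ^ 2 * dedekind_eta (7 * z) ^ 2))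
    - (2 - 2 * s) * (dedekind_eta z ^ 2 * dedekind_eta (2 * z) ^ 2 * dedekind_eta (7 * z) ^ 2 * dedekind_eta (14 * z) ^ 2)"
proof -
  define x y where "x = dedekind_eta (2 * z) * dedekind_eta (7 * z)" and "y = dedekind_eta z * dedekind_eta (14 * z)"
  have nz: "x \<noteq> 0" "y \<noteq> 0" using z by (simp_all add: x_def y_def dedekind_eta_nonzero)
  have h: "eta_prod_half z = (x * y)\<^sup>2"
    unfolding eta_prod_half_def x_def y_def by (simp only: mult_ac)
  have p: "eta_prod z = (x * y)\<^sup>2 * (x * y)\<^sup>2"
    using eta_prod_half_square[of z] by (simp add: h power2_eq_square[of "(x * y)\<^sup>2"])
  have e: "eta4 (2 * z) * eta4 (7 * z) = x ^ 4" "eta4 z * eta4 (14 * z) = y ^ 4"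
    by (simp_all add: eta4_def x_def y_def power_mult_distrib)
  have "nome z * form_quot s (nome z) = (x ^ 4)\<^sup>2 / (x * y)\<^sup>2 - s * ((y ^ 4)\<^sup>2 / (y * x)\<^sup>2) - (2 - 2 * s) * (x * y)\<^sup>2"
  proof -
    have "(a - s * b - c * (h * h)) / h = a / h - s * (b / h) - c * h" if "h \<noteq> 0" for a b c h :: complex
      using that by (simp add: diff_divide_distrib)
    from this[of "(x * y)\<^sup>2"] nz show ?thesis
      unfolding form_quot_eq_eta e h p mult.commute[of y x] by simp
  qed
  also have "\<dots> = x ^ 6 / y\<^sup>2 - s * (y ^ 6 / x\<^sup>2) - (2 - 2 * s) * (x * y)\<^sup>2"
    by (simp only: power_quotient_cancel[OF nz(1)] power_quotient_cancel[OF nz(2)])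
  finally show ?thesis
    unfolding x_def y_def power_mult_distrib by (simp only: mult_ac)
qed

section \<open>From Hecke eigenforms of level 14 to the locale\<close>

lemma hecke_divisors_prime:
  fixes p :: nat
  assumes "prime p" "p dvd N"
  shows "{d. d dvd p \<and> coprime (p div d) N} = {p}"
proof -
  have "\<not> coprime p N" using assms by (auto simp: coprime_absorb_left)
  moreover have "d = 1 \<or> d = p" if "d dvd p" for d
    using assms(1) that unfolding prime_nat_iff by blast
  moreover have "p > 0" using assms(1) by (rule prime_gt_0_nat)
  ultimately show ?thesis by fastforce
qed

lemma hecke_4_14_2: "hecke 4 14 2 f z = (f (z / 2) + f ((z + 1) / 2)) / 2"
proof -
  have "{d. d dvd 2 \<and> coprime (2 div d) 14} = {2::nat}" by (rule hecke_divisors_prime) simp_all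
  moreover have "(\<Sum>b<2. g b) = g 0 + g (1::nat)" for g :: "nat \<Rightarrow> complex"
    by (simp add: numeral_2_eq_2)
  ultimately show ?thesis unfolding hecke_def by (simp add: add_divide_distrib)
qed

lemma hecke_4_14_7: "hecke 4 14 7 f z = (\<Sum>b<7. f ((z + of_nat b) / 7)) / 7"
  unfolding hecke_def by (subst hecke_divisors_prime) (simp_all add: sum_divide_distrib[symmetric])

lemma newform_level14_eq:
  assumes new: "\<Delta> \<in> newforms 4 14" and q: "has_q_expansion \<Delta> a" and a2: "a 2 = 2 * s"
    and s: "s = 1 \<or> s = -1" and z: "Im z > 0"
  shows "\<Delta> z = nome z * form_quot s (nome z)"
proof -
  have uhp: "w \<in> upper_half_plane \<longleftrightarrow> Im w > 0" for w by (simp add: upper_half_plane_def)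
  have S: "upper_half_plane = {z. Im z > 0}" by (simp add: upper_half_plane_def)
  have eigen: "hecke_eigenform 4 14 \<Delta>" and "\<exists>a. has_q_expansion \<Delta> a \<and> a 1 = 1"
    using new by (auto simp: newforms_def)
  then obtain a' where a': "has_q_expansion \<Delta> a'" "a' 1 = 1" by blast
  have "a = a'" by (rule q_expansion_unique[OF q a'(1)])
  then have a1: "a 1 = 1" using a'(2) by simp
  have cf: "\<Delta> \<in> cusp_forms 4 14" using eigen by (simp add: hecke_eigenform_def)
  define mat :: "int \<Rightarrow> int \<Rightarrow> int \<Rightarrow> int \<Rightarrow> int^2^2" where "mat a b c d = vector [vector [a, b], vector [c, d]]" for a b c d
  have mat: "mat a b c d $ 1 $ 1 = a" "mat a b c d $ 1 $ 2 = b" "mat a b c d $ 2 $ 1 = c" "mat a b c d $ 2 $ 2 = d" for a b c d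
    by (simp_all add: mat_def)
  have sl: "mat a b c d \<in> SL2Z" if "a * d - b * c = 1" for a b c d
    using that by (simp add: SL2Z_def det_2 mat)
  have hol: "\<Delta> holomorphic_on {z. Im z > 0}"
    using cf by (simp add: cusp_forms_def S)
  have modular: "\<Delta> ((of_int a * z + of_int b) / (of_int c * z + of_int d)) = (of_int c * z + of_int d) ^ 4 * \<Delta> z"
    if det: "a * d - b * c = 1" and c: "14 dvd c" and z: "Im z > 0" for a b c d z
  proof -
    have "mat a b c d \<in> Gamma0 14" using sl[OF det] c by (simp add: Gamma0_def mat)
    then have e: "slash 4 (mat a b c d) \<Delta> z = \<Delta> z" using cf z by (simp add: cusp_forms_def uhp)
    have "of_int c * z + of_int d \<noteq> (0::complex)"
    proof
      assume "of_int c * z + of_int d = (0::complex)"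
      then have "of_int c * Im z = 0" "of_int c * Re z + of_int d = 0" by (simp_all add: complex_eq_iff)
      with z have "c = 0" "d = 0" by auto
      with det show False by simp
    qed
    then have "\<Delta> ((of_int a * z + of_int b) / (of_int c * z + of_int d))
        = (of_int c * z + of_int d) ^ 4 * (\<Delta> ((of_int a * z + of_int b) / (of_int c * z + of_int d)) / (of_int c * z + of_int d) ^ 4)"
      by simp
    also have "\<Delta> ((of_int a * z + of_int b) / (of_int c * z + of_int d)) / (of_int c * z + of_int d) ^ 4 = \<Delta> z"
      using e by (simp only: slash_def moebius_action_def mat)
    finally show ?thesis .
  qed
  have cusp: "((\<lambda>z. \<Delta> ((of_int a * z + of_int b) / (of_int c * z + of_int d)) / (of_int c * z + of_int d) ^ 4) \<longlongrightarrow> 0) (filtercomap Im at_top)"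
    if "a * d - b * c = 1" for a b c d
  proof -
    have "(slash 4 (mat a b c d) \<Delta> \<longlongrightarrow> 0) (filtercomap Im at_top)"
      using cf sl[OF that] by (simp add: cusp_forms_def)
    then show ?thesis by (simp add: slash_def[abs_def] moebius_action_def mat)
  qed
  have eig: "\<exists>c. \<forall>z\<in>upper_half_plane. hecke 4 14 n \<Delta> z = c * \<Delta> z" if "n \<ge> 1" for n
    using eigen that by (simp add: hecke_eigenform_def)
  obtain c2 where "\<forall>z\<in>upper_half_plane. hecke 4 14 2 \<Delta> z = c2 * \<Delta> z"
    using eig[of 2] by auto
  then have L: "hecke 4 14 2 \<Delta> z = c2 * \<Delta> z" if "Im z > 0" for z using that by (auto simp: uhp)
  obtain c7 where "\<forall>z\<in>upper_half_plane. hecke 4 14 7 \<Delta> z = c7 * \<Delta> z"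
    using eig[of 7] by auto
  then have Mu: "hecke 4 14 7 \<Delta> z = c7 * \<Delta> z" if "Im z > 0" for z using that by (auto simp: uhp)
  have U: "\<Delta> (z / 2) + \<Delta> ((z + 1) / 2) = 2 * c2 * \<Delta> z" if "Im z > 0" for z
    using L[OF that] unfolding hecke_4_14_2 by (simp add: divide_eq_eq)
  have a0: "a 0 = 0"
    using cusp[of 1 1 0 0] by (intro q_expansion_nth_0[OF q]) simp_all
  have a24: "2 * a 2 = 2 * c2 * a 1" "2 * a 4 = 2 * c2 * a 2"
    by (rule q_expansion_U2[OF q a0 U]; assumption)+
  \<comment> \<open>With a 1 = 1 the coefficient relations say that c2 = a 2 and a 4 = c2 * a 2,
    which gives 4 s^2 = 4.\<close>
  have c2: "c2 = 2 * s" using a24(1) unfolding a1 a2 by simp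
  have "2 * a 4 = 8 * (s * s)" using a24(2) unfolding a2 c2 by simp
  moreover have "s * s = 1" using s by auto
  ultimately have a4: "a 4 = 4" by simp
  have U2: "\<Delta> (z / 2) + \<Delta> ((z + 1) / 2) = 4 * s * \<Delta> z" if "Im z > 0" for z
    using U[OF that] by (simp add: c2)
  \<comment> \<open>The Hecke sum carries 7^3 / 7^4 = 1/7, so the eigenvalue c7 corresponds to \<mu>
    = c7 / 7.\<close>
  have U7: "(\<Sum>b<7. \<Delta> ((z + of_nat b) / 7)) = 49 * (c7 / 7) * \<Delta> z" if "Im z > 0" for z
    using Mu[OF that] unfolding hecke_4_14_7 by (simp add: divide_eq_eq)
  interpret level14_form \<Delta> s "c7 / 7"
    by (rule level14_form.intro; fact hol modular cusp U2 s U7)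
  show ?thesis by (rule f_eq_form_quot[OF q a1 a2 a4 z])
qed

theorem mainTheorem5:
  fixes \<Delta>\<^sub>1 \<Delta>\<^sub>2 :: "complex \<Rightarrow> complex" and \<tau>\<^sub>1 \<tau>\<^sub>2 :: "nat \<Rightarrow> complex"
  assumes "\<Delta>\<^sub>1 \<in> newforms 4 14" and "has_q_expansion \<Delta>\<^sub>1 \<tau>\<^sub>1" and "\<tau>\<^sub>1 2 = 2"
    and "\<Delta>\<^sub>2 \<in> newforms 4 14" and "has_q_expansion \<Delta>\<^sub>2 \<tau>\<^sub>2" and "\<tau>\<^sub>2 2 = -2"
  shows "(\<forall>z\<in>upper_half_plane. \<Delta>\<^sub>1 z =
            - (dedekind_eta z ^ 6 * dedekind_eta (14 * z) ^ 6
                / (dedekind_eta (2 * z) ^ 2 * dedekind_eta (7 * z) ^ 2))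
            + dedekind_eta (2 * z) ^ 6 * dedekind_eta (7 * z) ^ 6
                / (dedekind_eta z ^ 2 * dedekind_eta (14 * z) ^ 2)) \<and>
         (\<forall>z\<in>upper_half_plane. \<Delta>\<^sub>2 z =
            - 4 * dedekind_eta z ^ 2 * dedekind_eta (2 * z) ^ 2
                * dedekind_eta (7 * z) ^ 2 * dedekind_eta (14 * z) ^ 2
            + dedekind_eta z ^ 6 * dedekind_eta (14 * z) ^ 6
                / (dedekind_eta (2 * z) ^ 2 * dedekind_eta (7 * z) ^ 2)
            + dedekind_eta (2 * z) ^ 6 * dedekind_eta (7 * z) ^ 6
                / (dedekind_eta z ^ 2 * dedekind_eta (14 * z) ^ 2))"
proof (intro conjI ballI)
  fix z assume "z \<in> upper_half_plane"
  then have z: "Im z > 0" by (simp add: upper_half_plane_def)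
  \<comment> \<open>s is half of the q^2-coefficient; for s = 1 the term with 2 - 2 s disappears,
    and for s = -1 below it has coefficient 4.\<close>
  have "\<Delta>\<^sub>1 z = nome z * form_quot 1 (nome z)"
    by (rule newform_level14_eq[OF assms(1,2) _ _ z]) (simp_all add: assms(3))
  then show "\<Delta>\<^sub>1 z =
            - (dedekind_eta z ^ 6 * dedekind_eta (14 * z) ^ 6
                / (dedekind_eta (2 * z) ^ 2 * dedekind_eta (7 * z) ^ 2))
            + dedekind_eta (2 * z) ^ 6 * dedekind_eta (7 * z) ^ 6
                / (dedekind_eta z ^ 2 * dedekind_eta (14 * z) ^ 2)"
    unfolding form_quot_eta[OF z] by simp
  have "\<Delta>\<^sub>2 z = nome z * form_quot (-1) (nome z)"
    by (rule newform_level14_eq[OF assms(4,5) _ _ z]) (simp_all add: assms(6))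
  then show "\<Delta>\<^sub>2 z =
            - 4 * dedekind_eta z ^ 2 * dedekind_eta (2 * z) ^ 2
                * dedekind_eta (7 * z) ^ 2 * dedekind_eta (14 * z) ^ 2
            + dedekind_eta z ^ 6 * dedekind_eta (14 * z) ^ 6
                / (dedekind_eta (2 * z) ^ 2 * dedekind_eta (7 * z) ^ 2)
            + dedekind_eta (2 * z) ^ 6 * dedekind_eta (7 * z) ^ 6
                / (dedekind_eta z ^ 2 * dedekind_eta (14 * z) ^ 2)"
    unfolding form_quot_eta[OF z] by simp
qed

end
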